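(* Let $(c_L,c_M,h_L,h_M)\in\mathbb C^4$ with $c_M\neq0$. The Verma module $V_{W(2,2)}(h_L,h_M,c_L,c_M)$ over $W(2,2)$ has a subsingular vector if and only if $2h_M+\frac{p^2-1}{12}c_M=0$ for some $p\in\mathbb Z_+$ and $$h_L=h'_{p,r}=-\frac{p^2-1}{24}c_L+\frac{(13p+1)(p-1)}{12}+\frac{(1-r)p}{2}$$ for some $r\in\mathbb Z_+$.
   Context: $W(2,2)$ is the complex Lie algebra with basis $L_n,M_n$ ($n\in\mathbb Z$), $\mathbf c_L,\mathbf c_M$ and brackets $[L_m,L_n]=(m-n)L_{m+n}+\frac1{12}\delta_{m+n,0}(m^3-m)\mathbf c_L$, $[L_m,M_n]=(m-n)M_{m+n}+\frac1{12}\delta_{m+n,0}(m^3-m)\mathbf c_M$, $[M_m,M_n]=0$, with $\mathbf c_L,\mathbf c_M$ central. $V_{W(2,2)}(h_L,h_M,c_L,c_M)$ is the Verma module generated freely over the negative part by a highest weight vector $\mathbf 1$ annihilated by all $L_n,M_n$ with $n>0$, on which $\mathbf c_L,\mathbf c_M,L_0,M_0$ act by $c_L,c_M,h_L,h_M$. A singular vector (in a highest weight module) is a nonzero common eigenvector of $L_0,M_0,\mathbf c_L,\mathbf c_M$ annihilated by all $L_n,M_n$ with $n>0$. Let $J'$ be the submodule of the Verma module generated by all singular vectors not in $\mathbb C\mathbf 1$. A subsingular vector is an $L_0$-eigenvector $u'$ of the Verma module whose image modulo $J'$ is a singular vector not proportional to the image of $\mathbf 1$. $\mathbb Z_+=\{1,2,\dots\}$.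 *)

theory Defs
  imports Complex_Main "HOL-Library.Poly_Mapping"
begin

section \<open>Left ideals and two-sided ideals of a noncommutative ring\<close>

definition left_ideal :: "'a::ring_1 set \<Rightarrow> bool" where
  "left_ideal I \<longleftrightarrow>
     0 \<in> I \<and> (\<forall>a\<in>I. \<forall>b\<in>I. a + b \<in> I) \<and> (\<forall>u. \<forall>a\<in>I. u * a \<in> I)"

definition two_sided_ideal :: "'a::ring_1 set \<Rightarrow> bool" where
  "two_sided_ideal I \<longleftrightarrow> left_ideal I \<and> (\<forall>u. \<forall>a\<in>I. a * u \<in> I)"

lemma two_sided_ideal_hull: "two_sided_ideal (two_sided_ideal hull S)"
  by (rule hull_in) (auto simp: two_sided_ideal_def left_ideal_def)


section \<open>The Lie algebra \<open>W(2,2)\<close>\<close>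

datatype gen = genL int | genM int | genCL | genCM

text \<open>
  The underlying vector space consists of the finitely supported functions
  \<open>gen \<Rightarrow>\<^sub>0 complex\<close>. The bracket is given on basis vectors only, its values being
  elements of that space.
\<close>

fun w22_bracket :: "gen \<Rightarrow> gen \<Rightarrow> (gen \<Rightarrow>\<^sub>0 complex)" where
  "w22_bracket (genL m) (genL n) =
     Poly_Mapping.single (genL (m + n)) (of_int (m - n)) +
     (if m + n = 0 then Poly_Mapping.single genCL (of_int (m ^ 3 - m) / 12) else 0)"
| "w22_bracket (genL m) (genM n) =
     Poly_Mapping.single (genM (m + n)) (of_int (m - n)) +
     (if m + n = 0 then Poly_Mapping.single genCM (of_int (m ^ 3 - m) / 12) else 0)"
| "w22_bracket (genM m) (genL n) =
     Poly_Mapping.single (genM (m + n)) (of_int (m - n)) +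
     (if m + n = 0 then Poly_Mapping.single genCM (of_int (m ^ 3 - m) / 12) else 0)"
| "w22_bracket (genM m) (genM n) = 0"
| "w22_bracket genCL _ = 0"
| "w22_bracket genCM _ = 0"
| "w22_bracket _ genCL = 0"
| "w22_bracket _ genCM = 0"

lemma w22_bracket_antisym: "w22_bracket x y = - w22_bracket y x"
proof -
  have *: "n = - m \<Longrightarrow> (of_int (n ^ 3 - n) :: complex) / 12 = - (of_int (m ^ 3 - m) / 12)"
    for m n :: int
    by (simp add: power3_eq_cube field_simps)
  show ?thesis
    by (cases x; cases y)
       (auto simp: add_eq_0_iff2 single_uminus[symmetric] add.commute[of "_ :: int"] *
             intro!: poly_mapping_eqI simp: Poly_Mapping.lookup_add Poly_Mapping.lookup_single when_def
             power3_eq_cube field_simps)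
qed


section \<open>The universal enveloping algebra of \<open>W(2,2)\<close>\<close>

text \<open>
  The tensor algebra is the monoid algebra of the free monoid on \<open>gen\<close>. Words get a type of
  their own so that lists are not made an instance of \<^class>\<open>monoid_add\<close>; \<open>0\<close> is the empty
  word and \<open>+\<close> is concatenation, as the product on \<open>_ \<Rightarrow>\<^sub>0 _\<close> requires.
\<close>

datatype word = Word (letters: "gen list")

instantiation word :: monoid_add
begin

definition zero_word :: word where "0 = Word []"

definition plus_word :: "word \<Rightarrow> word \<Rightarrow> word" where
  "u + v = Word (letters u @ letters v)"

instance
  by standard (auto simp: zero_word_def plus_word_def)

end

type_synonym tensor_alg = "word \<Rightarrow>\<^sub>0 complex"

definition tensor_gen :: "gen \<Rightarrow> tensor_alg" where
  "tensor_gen g = Poly_Mapping.single (Word [g]) 1"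

definition tensor_lin :: "(gen \<Rightarrow>\<^sub>0 complex) \<Rightarrow> tensor_alg" where
  "tensor_lin x =
     (\<Sum>g\<in>Poly_Mapping.keys x. Poly_Mapping.single (Word [g]) (Poly_Mapping.lookup x g))"

text \<open>
  By bilinearity, imposing \<open>x \<otimes> y - y \<otimes> x = [x, y]\<close> for basis vectors imposes it for all
  elements of the Lie algebra.
\<close>

definition uea_ideal :: "tensor_alg set" where
  "uea_ideal = two_sided_ideal hull
     {tensor_gen x * tensor_gen y - tensor_gen y * tensor_gen x
        - tensor_lin (w22_bracket x y) | x y. True}"

lemma uea_ideal_add: "a \<in> uea_ideal \<Longrightarrow> b \<in> uea_ideal \<Longrightarrow> a + b \<in> uea_ideal"
  and uea_ideal_zero: "0 \<in> uea_ideal"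
  and uea_ideal_left: "a \<in> uea_ideal \<Longrightarrow> t * a \<in> uea_ideal"
  and uea_ideal_right: "a \<in> uea_ideal \<Longrightarrow> a * t \<in> uea_ideal"
  using two_sided_ideal_hull unfolding uea_ideal_def two_sided_ideal_def left_ideal_def
  by blast+

lemma uea_ideal_minus: "a \<in> uea_ideal \<Longrightarrow> - a \<in> uea_ideal"
  using uea_ideal_left[of a "- 1"] by simp

lemma lookup_mult_empty_word:
  "Poly_Mapping.lookup (a * b) (0 :: word) = Poly_Mapping.lookup a 0 * Poly_Mapping.lookup (b :: tensor_alg) 0"
proof -
  have *: "(0 :: word) = l + q \<longleftrightarrow> l = 0 \<and> q = 0" for l q
    by (cases l; cases q) (auto simp: zero_word_def plus_word_def)
  have "(\<Sum>q. Poly_Mapping.lookup b q when (0 :: word) = l + q) = (Poly_Mapping.lookup b 0 when l = 0)" for l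
    by (cases "l = 0") (simp_all add: *)
  then show ?thesis
    by (simp add: Poly_Mapping.lookup_mult mult_when)
qed

lemma lookup_tensor_lin_empty_word: "Poly_Mapping.lookup (tensor_lin x) (0 :: word) = 0"
  by (simp add: tensor_lin_def Poly_Mapping.lookup_sum Poly_Mapping.lookup_single zero_word_def)

lemma lookup_uea_ideal_empty_word:
  assumes "a \<in> uea_ideal"
  shows "Poly_Mapping.lookup a (0 :: word) = 0"
proof -
  have "two_sided_ideal {a :: tensor_alg. Poly_Mapping.lookup a 0 = 0}"
    by (auto simp: two_sided_ideal_def left_ideal_def Poly_Mapping.lookup_add lookup_mult_empty_word)
  moreover have "Poly_Mapping.lookup (tensor_gen x) 0 = 0" for x
    by (simp add: tensor_gen_def Poly_Mapping.lookup_single zero_word_def)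
  ultimately have "uea_ideal \<subseteq> {a. Poly_Mapping.lookup a 0 = 0}"
    unfolding uea_ideal_def
    by (intro hull_minimal)
       (auto simp: Poly_Mapping.lookup_minus lookup_mult_empty_word lookup_tensor_lin_empty_word)
  with assms show ?thesis by auto
qed

quotient_type uea = tensor_alg / "\<lambda>s t. s - t \<in> uea_ideal"
proof (rule equivpI)
  show "reflp (\<lambda>s t. s - t \<in> uea_ideal)"
    by (simp add: reflp_def uea_ideal_zero)
  show "symp (\<lambda>s t. s - t \<in> uea_ideal)"
    by (rule sympI) (use uea_ideal_minus in fastforce)
  show "transp (\<lambda>s t. s - t \<in> uea_ideal)"
    by (rule transpI) (use uea_ideal_add in fastforce)
qed

instantiation uea :: ring_1
begin

lift_definition zero_uea :: uea is "0" .

lift_definition one_uea :: uea is "1" .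

lift_definition plus_uea :: "uea \<Rightarrow> uea \<Rightarrow> uea" is "(+)"
  by (metis uea_ideal_add add_diff_add)

lift_definition uminus_uea :: "uea \<Rightarrow> uea" is "uminus"
  by (metis uea_ideal_minus minus_diff_minus)

lift_definition minus_uea :: "uea \<Rightarrow> uea \<Rightarrow> uea" is "(-)"
proof -
  fix a b c d :: tensor_alg
  assume "a - b \<in> uea_ideal" "c - d \<in> uea_ideal"
  then have "(a - b) + - (c - d) \<in> uea_ideal"
    by (intro uea_ideal_add uea_ideal_minus)
  then show "(a - c) - (b - d) \<in> uea_ideal"
    by (simp add: algebra_simps)
qed

lift_definition times_uea :: "uea \<Rightarrow> uea \<Rightarrow> uea" is "(*)"
proof -
  fix a b c d :: tensor_alg
  assume "a - b \<in> uea_ideal" "c - d \<in> uea_ideal"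
  then have "(a - b) * c + b * (c - d) \<in> uea_ideal"
    by (intro uea_ideal_add uea_ideal_left uea_ideal_right)
  then show "a * c - b * d \<in> uea_ideal"
    by (simp add: algebra_simps)
qed

instance
proof
  show "(0 :: uea) \<noteq> 1"
    by transfer (use uea_ideal_minus lookup_uea_ideal_empty_word in fastforce)
qed (transfer; simp add: algebra_simps uea_ideal_zero)+

end

lift_definition uea_scale :: "complex \<Rightarrow> uea \<Rightarrow> uea" (infixr \<open>\<cdot>\<close> 75)
  is "\<lambda>c t. Poly_Mapping.single 0 c * t"
  by (metis uea_ideal_left right_diff_distrib)

lift_definition uea_gen :: "gen \<Rightarrow> uea" is tensor_gen .

lift_definition uea_lin :: "(gen \<Rightarrow>\<^sub>0 complex) \<Rightarrow> uea" is tensor_lin .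

lemma uea_commutator:
  "uea_gen x * uea_gen y - uea_gen y * uea_gen x = uea_lin (w22_bracket x y)"
proof transfer
  fix x y
  show "tensor_gen x * tensor_gen y - tensor_gen y * tensor_gen x
          - tensor_lin (w22_bracket x y) \<in> uea_ideal"
    unfolding uea_ideal_def by (rule hull_inc) blast
qed

abbreviation "U_L n \<equiv> uea_gen (genL n)"
abbreviation "U_M n \<equiv> uea_gen (genM n)"
abbreviation "U_CL \<equiv> uea_gen genCL"
abbreviation "U_CM \<equiv> uea_gen genCM"


section \<open>Verma modules, singular and subsingular vectors\<close>

text \<open>
  Cyclic modules are written as \<open>U/K\<close> for a left ideal \<open>K\<close> of the enveloping algebra
  \<open>U\<close>, with \<open>U\<close> acting by left multiplication. A vector of \<open>U/K\<close> is given by a representative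
  \<open>u \<in> U\<close>, so that \<open>u = v\<close> in \<open>U/K\<close> reads \<open>u - v \<in> K\<close>, and the submodules of \<open>U/K\<close>
  are the left ideals containing \<open>K\<close>.

  The Verma module is \<open>U/K\<close> for the \<open>K\<close> below. Its highest weight vector is the class of
  \<open>1\<close>; by the Poincare-Birkhoff-Witt theorem it is free of rank one over the enveloping
  algebra of the span of all \<open>L\<^sub>n\<close>, \<open>M\<^sub>n\<close> with \<open>n < 0\<close>.
\<close>

definition verma_ideal :: "complex \<Rightarrow> complex \<Rightarrow> complex \<Rightarrow> complex \<Rightarrow> uea set" where
  "verma_ideal hL hM cL cM = left_ideal hull
     ({U_L n | n. n > 0} \<union> {U_M n | n. n > 0} \<union>
      {U_L 0 - hL \<cdot> 1, U_M 0 - hM \<cdot> 1, U_CL - cL \<cdot> 1, U_CM - cM \<cdot> 1})"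

definition eigenvector_mod :: "uea set \<Rightarrow> uea \<Rightarrow> uea \<Rightarrow> bool" where
  "eigenvector_mod K x u \<longleftrightarrow> u \<notin> K \<and> (\<exists>a. x * u - a \<cdot> u \<in> K)"

definition singular_mod :: "uea set \<Rightarrow> uea \<Rightarrow> bool" where
  "singular_mod K u \<longleftrightarrow>
     eigenvector_mod K (U_L 0) u \<and> eigenvector_mod K (U_M 0) u \<and>
     eigenvector_mod K U_CL u \<and> eigenvector_mod K U_CM u \<and>
     (\<forall>n>0. U_L n * u \<in> K \<and> U_M n * u \<in> K)"

definition multiple_of_one_mod :: "uea set \<Rightarrow> uea \<Rightarrow> bool" where
  "multiple_of_one_mod K u \<longleftrightarrow> (\<exists>a. u - a \<cdot> 1 \<in> K)"

text \<open>The preimage in \<open>U\<close> of the submodule \<open>J'\<close> of the Verma module.\<close>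

definition singular_ideal :: "complex \<Rightarrow> complex \<Rightarrow> complex \<Rightarrow> complex \<Rightarrow> uea set" where
  "singular_ideal hL hM cL cM =
     (let K = verma_ideal hL hM cL cM in
      left_ideal hull (K \<union> {u. singular_mod K u \<and> \<not> multiple_of_one_mod K u}))"

definition subsingular :: "complex \<Rightarrow> complex \<Rightarrow> complex \<Rightarrow> complex \<Rightarrow> uea \<Rightarrow> bool" where
  "subsingular hL hM cL cM u \<longleftrightarrow>
     eigenvector_mod (verma_ideal hL hM cL cM) (U_L 0) u \<and>
     singular_mod (singular_ideal hL hM cL cM) u \<and>
     \<not> multiple_of_one_mod (singular_ideal hL hM cL cM) u"

definition h' :: "complex \<Rightarrow> nat \<Rightarrow> nat \<Rightarrow> complex" where
  "h' cL p r = - ((of_nat p ^ 2 - 1) / 24) * cL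
     + (13 * of_nat p + 1) * (of_nat p - 1) / 12 + (1 - of_nat r) * of_nat p / 2"

end

theory Submission
  imports Defs "HOL-Library.Multiset"
begin

text \<open>
  Write \<open>V\<close> for the Verma module and \<open>\<phi> n = 2 h\<^sub>M + (n\<^sup>2 - 1) c\<^sub>M / 12\<close>, so that
  \<open>[M\<^sub>n, L\<^bsub>-n\<^esub>]\<close> acts as \<open>n \<phi> n\<close> on vectors with \<open>M\<^sub>0 = h\<^sub>M\<close>. As \<open>c\<^sub>M\<close> is nonzero, at most one
  \<open>n \<ge> 1\<close> has \<open>\<phi> n = 0\<close>; call it \<open>p\<close>, and put \<open>p = 0\<close> if there is none.

  By the Poincare-Birkhoff-Witt theorem \<open>V\<close> has the coordinates of a polynomial ring \<open>A[l\<^sub>1, l\<^sub>2, \<dots>]\<close>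
  over \<open>A = \<complex>[x\<^sub>1, x\<^sub>2, \<dots>]\<close>, with \<open>l\<^sub>m\<close> for \<open>L\<^bsub>-m\<^esub>\<close> and \<open>x\<^sub>m\<close> for \<open>M\<^bsub>-m\<^esub>\<close>. Filter \<open>V\<close> by the number
  of \<open>L\<close>'s. On the associated graded space \<open>M\<^sub>n\<close> is the \<open>A\<close>-linear derivation
  \<open>D n = \<Sum>\<^sub>m d(n,m) \<partial>/\<partial>l\<^sub>m\<close>, and on \<open>A\<close> itself \<open>L\<^sub>n\<close> is \<open>E n = \<Sum>\<^sub>m d(n,m) \<partial>/\<partial>x\<^sub>m\<close>, with the same
  coefficients: \<open>d(n,m) = 0\<close> for \<open>m < n\<close>, \<open>d(n,n) = n \<phi> n\<close>, and
  \<open>d(n,m) = (n + m) x\<^bsub>m-n\<^esub>\<close> for \<open>m > n\<close>. The system is triangular and only the \<open>p\<close>-th diagonal entry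
  vanishes, so its solutions form one line, spanned by the coefficients \<open>b\<close> of
  \<open>Z = L\<^bsub>-p\<^esub> + b\<^sub>1 L\<^bsub>-p+1\<^esub> + \<dots>\<close> (lemma \<open>elimination\<close>). Everything else is derived from
  \<open>Z\<close> and from \<open>Q = [M\<^sub>0, Z] = \<Sum>\<^sub>i (p - i) b\<^sub>i M\<^bsub>-(p-i)\<^esub>\<close>.

  \<^item> The vector \<open>Q \<one>\<close> is singular (\<open>L_lift_Q\<close>), and it generates the submodule \<open>J\<close> whose coordinates
    are the multiples of \<open>Q\<close> (\<open>\<Phi>_mult_lift_Q\<close>). The symbol of a singular vector is killed by all \<open>D n\<close>
    with \<open>n \<ge> 0\<close>; since \<open>D 0\<close> supplies the missing pivot \<open>Q\<close>, such a vector lies in \<open>A\<close>, and if its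
    level is positive, Euler's identity shows that it is a multiple of \<open>Q\<close>. So \<open>J' = J\<close>
    (\<open>singular_ideal_eq_J\<close>). If \<open>p = 0\<close> then \<open>J = 0\<close>, and nothing can be subsingular.

  \<^item> Modulo \<open>J\<close>, a vector killed by all \<open>M\<^sub>n\<close> with \<open>n > 0\<close> is a sum of terms \<open>a\<^sub>i Z\<^sup>i \<one>\<close> with
    \<open>a\<^sub>i \<in> A\<close> (\<open>Z_expansion\<close>). If the vector is singular, its leading coefficient is killed by all
    \<open>E n\<close> modulo \<open>Q\<close>, hence constant, so that its level is \<open>p k\<close> for some \<open>k\<close>. Applying \<open>L\<^sub>p\<close> multiplies
    the leading coefficient by \<open>\<gamma> k = 2 p k (h\<^sub>L - h'\<^bsub>p,k\<^esub>)\<close> and turns \<open>Z\<^sup>k\<close> into \<open>Z\<^bsup>k-1\<^esup>\<close>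
    (\<open>L_p_step\<close>, \<open>\<gamma>_formula\<close>). So a subsingular vector forces \<open>\<gamma> k = 0\<close>.

  \<^item> Conversely let \<open>\<gamma> k = 0\<close>. At level \<open>p k\<close> the terms \<open>a Z\<^sup>i \<one>\<close> are indexed by the partitions of \<open>p k\<close>,
    and so are the sorted words in the \<open>L\<^sub>n\<close> with \<open>n > 0\<close> of that total. The word \<open>L\<^sub>p\<^sup>k\<close> kills
    all these vectors modulo \<open>J\<close>, so fewer conditions than unknowns remain, and some nonzero
    combination is sent to \<open>0\<close> by every word that lowers it to level \<open>0\<close>. Applying to it a word
    of largest total that does not send it into \<open>J\<close> produces a subsingular vector
    (\<open>\<gamma>_0_imp_subsingular\<close>).
\<close>

section \<open>Polynomials with exponents given by multisets\<close>

type_synonym 'v pol = "'v multiset \<Rightarrow>\<^sub>0 complex"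

definition Const :: "complex \<Rightarrow> 'v pol" where
  "Const c = Poly_Mapping.single 0 c"

definition Var :: "'v \<Rightarrow> 'v pol" where
  "Var v = Poly_Mapping.single {#v#} 1"

lemma Const_0 [simp]: "Const 0 = 0"
  and Const_1 [simp]: "Const 1 = 1"
  by (simp_all add: Const_def)

lemma Const_add: "Const (a + b) = Const a + Const b"
  and Const_diff: "Const (a - b) = Const a - Const b"
  and Const_uminus: "Const (- a) = - Const a"
  and Const_mult: "Const (a * b) = Const a * Const b"
  by (simp_all add: Const_def single_add single_diff single_uminus mult_single)

lemma Const_of_int: "Const (of_int n) = of_int n"
  and Const_of_nat: "Const (of_nat k) = of_nat k"
  by (simp_all add: Const_def)

lemma lookup_Const: "Poly_Mapping.lookup (Const c) \<mu> = (if \<mu> = {#} then c else 0)"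
  by (simp add: Const_def Poly_Mapping.lookup_single when_def)

lemma Const_eq_0_iff [simp]: "Const c = 0 \<longleftrightarrow> c = 0"
  by (metis Const_0 lookup_Const lookup_zero)

lemma lookup_Const_mult [simp]:
  "Poly_Mapping.lookup (Const c * f) \<mu> = c * Poly_Mapping.lookup f \<mu>"
proof -
  have "Const c * f = Poly_Mapping.map ((*) c) f"
    by (simp add: Const_def mult_map_scale_conv_mult)
  then show ?thesis
    by (simp add: Poly_Mapping.map.rep_eq when_def)
qed

lemma Const_mult_dvd_cancel:
  assumes "c \<noteq> 0" and "q dvd Const c * f"
  shows "q dvd (f :: 'v pol)"
proof -
  have "f = Const (inverse c) * (Const c * f)"
    using assms(1) by (simp add: mult.assoc [symmetric] Const_mult [symmetric])
  then show ?thesis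
    using assms(2) by (metis dvd_mult)
qed

lemma sum_singles:
  "(f :: 'a \<Rightarrow>\<^sub>0 'b :: comm_monoid_add) =
     (\<Sum>k\<in>Poly_Mapping.keys f. Poly_Mapping.single k (Poly_Mapping.lookup f k))"
  by (rule poly_mapping_eqI)
     (simp add: Poly_Mapping.lookup_sum Poly_Mapping.lookup_single when_def in_keys_iff)

lemma single_induct [case_names add single]:
  assumes add: "\<And>f g. P f \<Longrightarrow> P g \<Longrightarrow> P (f + g)"
    and single: "\<And>k c. P (Poly_Mapping.single k c)"
  shows "P (f :: 'a \<Rightarrow>\<^sub>0 'b :: comm_monoid_add)"
proof -
  have "P (\<Sum>k\<in>S. Poly_Mapping.single k (Poly_Mapping.lookup f k))" if "finite S" for S
    using that
  proof (induction S)
    case empty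
    show ?case using single[of undefined 0] by simp
  qed (simp add: add single)
  from this[of "Poly_Mapping.keys f"] show ?thesis
    by (simp flip: sum_singles)
qed

lemma Var_mult_single: "Var v * Poly_Mapping.single \<mu> c = Poly_Mapping.single (add_mset v \<mu>) c"
  by (simp add: Var_def mult_single)

lemma pol_induct [case_names Const add Var]:
  assumes "\<And>c. P (Const c)"
    and "\<And>f g. P f \<Longrightarrow> P g \<Longrightarrow> P (f + g)"
    and "\<And>v f. P f \<Longrightarrow> P (Var v * f)"
  shows "P (f :: 'v pol)"
proof (induction f rule: single_induct)
  case (single \<mu> c)
  show ?case
    by (induction \<mu>) (use assms(1)[of c] assms(3) in \<open>auto simp: Const_def Var_mult_single[symmetric]\<close>)
qed (rule assms(2))

lemma lookup_Var_mult:
  "Poly_Mapping.lookup (Var v * f) \<mu> =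
     (if v \<in># \<mu> then Poly_Mapping.lookup f (\<mu> - {#v#}) else 0)"
proof (induction f rule: single_induct)
  case (single \<nu> c)
  show ?case
    by (auto simp: Var_mult_single Poly_Mapping.lookup_single when_def insert_DiffM2 dest: multi_member_split)
qed (simp add: distrib_left Poly_Mapping.lookup_add)

subsection \<open>Weighted degrees\<close>

definition wdeg :: "('v \<Rightarrow> nat) \<Rightarrow> 'v multiset \<Rightarrow> nat" where
  "wdeg w \<mu> = sum_mset (image_mset w \<mu>)"

text \<open>
  The degree is an integer, so that lowering it needs no side condition: a polynomial that is
  homogeneous of negative degree is \<open>0\<close>.
\<close>

definition homog :: "('v \<Rightarrow> nat) \<Rightarrow> int \<Rightarrow> 'v pol \<Rightarrow> bool" where
  "homog w d f \<longleftrightarrow> (\<forall>\<mu>\<in>Poly_Mapping.keys f. int (wdeg w \<mu>) = d)"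

definition wdeg_lt :: "('v \<Rightarrow> nat) \<Rightarrow> nat \<Rightarrow> 'v pol set" where
  "wdeg_lt w k = {f. \<forall>\<mu>\<in>Poly_Mapping.keys f. wdeg w \<mu> < k}"

lift_definition hcomp :: "('v \<Rightarrow> nat) \<Rightarrow> nat \<Rightarrow> 'v pol \<Rightarrow> 'v pol" is
  "\<lambda>w k f \<mu>. if wdeg w \<mu> = k then f \<mu> else 0"
  by (rule finite_subset[rotated]) auto

lemma wdeg_simps [simp]:
  "wdeg w {#} = 0" "wdeg w (add_mset v \<mu>) = w v + wdeg w \<mu>"
  "wdeg w (\<mu> + \<nu>) = wdeg w \<mu> + wdeg w \<nu>"
  by (simp_all add: wdeg_def)

lemma homog_0 [simp]: "homog w d 0"
  by (simp add: homog_def)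

lemma homog_Const [simp]: "homog w 0 (Const c)"
  by (simp add: homog_def Const_def)

lemma homog_Var [simp]: "homog w (int (w v)) (Var v)"
  by (simp add: homog_def Var_def)

lemma homog_add: "homog w d f \<Longrightarrow> homog w d g \<Longrightarrow> homog w d (f + g)"
  using Poly_Mapping.keys_add[of f g] by (fastforce simp: homog_def)

lemma homog_minus: "homog w d f \<Longrightarrow> homog w d (- f)"
  by (simp add: homog_def)

lemma homog_diff: "homog w d f \<Longrightarrow> homog w d g \<Longrightarrow> homog w d (f - g)"
  using homog_add[of w d f "- g"] by (simp add: homog_minus)

lemma homog_sum: "(\<And>i. i \<in> I \<Longrightarrow> homog w d (f i)) \<Longrightarrow> homog w d (sum f I)"
  by (induction I rule: infinite_finite_induct) (auto intro: homog_add)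

lemma homog_mult:
  assumes "homog w d f" "homog w e g"
  shows "homog w (d + e) (f * g)"
  using assms Poly_Mapping.keys_mult[of f g] by (fastforce simp: homog_def)

lemma homog_mult': "homog w d f \<Longrightarrow> homog w e g \<Longrightarrow> d + e = t \<Longrightarrow> homog w t (f * g)"
  using homog_mult by blast

lemma homog_Const_mult: "homog w d f \<Longrightarrow> homog w d (Const c * f)"
  using homog_mult[OF homog_Const] by fastforce

lemma homog_neg: "homog w d f \<Longrightarrow> d < 0 \<Longrightarrow> f = 0"
  by (metis homog_def keys_eq_empty of_nat_less_0_iff all_not_in_conv)

lemma homog_lookup: "homog w d f \<Longrightarrow> int (wdeg w \<mu>) \<noteq> d \<Longrightarrow> Poly_Mapping.lookup f \<mu> = 0"
  by (auto simp: homog_def in_keys_iff)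

lemma wdeg_lt_0 [simp]: "wdeg_lt w 0 = {0}"
  by (auto simp: wdeg_lt_def)

lemma zero_in_wdeg_lt [simp]: "0 \<in> wdeg_lt w k"
  by (simp add: wdeg_lt_def)

lemma wdeg_lt_mono: "f \<in> wdeg_lt w k \<Longrightarrow> k \<le> l \<Longrightarrow> f \<in> wdeg_lt w l"
  by (fastforce simp: wdeg_lt_def)

lemma wdeg_lt_add: "f \<in> wdeg_lt w k \<Longrightarrow> g \<in> wdeg_lt w k \<Longrightarrow> f + g \<in> wdeg_lt w k"
  using Poly_Mapping.keys_add[of f g] by (fastforce simp: wdeg_lt_def)

lemma wdeg_lt_minus: "f \<in> wdeg_lt w k \<Longrightarrow> - f \<in> wdeg_lt w k"
  by (simp add: wdeg_lt_def)

lemma wdeg_lt_diff: "f \<in> wdeg_lt w k \<Longrightarrow> g \<in> wdeg_lt w k \<Longrightarrow> f - g \<in> wdeg_lt w k"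
  using wdeg_lt_add[of f w k "- g"] by (simp add: wdeg_lt_minus)

lemma wdeg_lt_sum: "(\<And>i. i \<in> I \<Longrightarrow> f i \<in> wdeg_lt w k) \<Longrightarrow> sum f I \<in> wdeg_lt w k"
  by (induction I rule: infinite_finite_induct) (auto intro: wdeg_lt_add)

lemma wdeg_lt_mult:
  assumes "f \<in> wdeg_lt w (Suc i)" "g \<in> wdeg_lt w k"
  shows "f * g \<in> wdeg_lt w (i + k)"
  using assms Poly_Mapping.keys_mult[of f g] by (fastforce simp: wdeg_lt_def)

lemma wdeg_lt_mult0: "f \<in> wdeg_lt w (Suc 0) \<Longrightarrow> g \<in> wdeg_lt w k \<Longrightarrow> f * g \<in> wdeg_lt w k"
  using wdeg_lt_mult[of f w 0 g k] by simp

lemma wdeg_lt_Const [simp]: "Const c \<in> wdeg_lt w (Suc k)"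
  by (simp add: wdeg_lt_def Const_def)

lemma wdeg_lt_Const_mult: "f \<in> wdeg_lt w k \<Longrightarrow> Const c * f \<in> wdeg_lt w k"
  by (rule wdeg_lt_mult0) simp_all

lemma wdeg_lt_Var: "w v < k \<Longrightarrow> Var v \<in> wdeg_lt w k"
  by (simp add: wdeg_lt_def Var_def)

lemma homog_imp_wdeg_lt: "homog w (int d) f \<Longrightarrow> f \<in> wdeg_lt w (Suc d)"
  by (auto simp: wdeg_lt_def homog_def)

lemma homog_0_iff_wdeg_lt: "homog w 0 f \<longleftrightarrow> f \<in> wdeg_lt w (Suc 0)"
  by (auto simp: wdeg_lt_def homog_def)

lemma wdeg_lt_exists: "\<exists>k. f \<in> wdeg_lt w k"
proof -
  have "f \<in> wdeg_lt w (Suc (\<Sum>\<mu>\<in>Poly_Mapping.keys f. wdeg w \<mu>))"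
    by (auto simp: wdeg_lt_def less_Suc_eq_le intro: member_le_sum)
  then show ?thesis ..
qed

lemma lookup_hcomp: "Poly_Mapping.lookup (hcomp w k f) \<mu> =
    (if wdeg w \<mu> = k then Poly_Mapping.lookup f \<mu> else 0)"
  by transfer simp

lemma hcomp_add: "hcomp w k (f + g) = hcomp w k f + hcomp w k g"
  and hcomp_diff: "hcomp w k (f - g) = hcomp w k f - hcomp w k g"
  by (rule poly_mapping_eqI, simp add: lookup_hcomp Poly_Mapping.lookup_add Poly_Mapping.lookup_minus)+

lemma homog_hcomp [simp]: "homog w (int k) (hcomp w k f)"
  by (auto simp: homog_def in_keys_iff lookup_hcomp split: if_splits)

lemma hcomp_homog: "homog w d f \<Longrightarrow> hcomp w k f = (if d = int k then f else 0)"
  by (rule poly_mapping_eqI) (auto simp: lookup_hcomp homog_lookup)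

lemma homog_hcomp_other: "homog w' d f \<Longrightarrow> homog w' d (hcomp w k f)"
  by (auto simp: homog_def in_keys_iff lookup_hcomp split: if_splits)

lemma hcomp_eq_0: "f \<in> wdeg_lt w k \<Longrightarrow> hcomp w k f = 0"
  by (rule poly_mapping_eqI) (auto simp: lookup_hcomp wdeg_lt_def in_keys_iff)

lemma diff_hcomp_wdeg_lt: "f \<in> wdeg_lt w (Suc k) \<Longrightarrow> f - hcomp w k f \<in> wdeg_lt w k"
  by (auto simp: wdeg_lt_def in_keys_iff lookup_hcomp Poly_Mapping.lookup_minus split: if_splits)
     (metis in_keys_iff less_antisym)

lemma hcomp_mult_homog0:
  assumes "homog w 0 q"
  shows "hcomp w k (q * f) = q * hcomp w k f"
proof (induction f rule: single_induct)
  case (single \<mu> c)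
  have "homog w (int (wdeg w \<mu>)) (Poly_Mapping.single \<mu> c)"
    by (simp add: homog_def)
  with homog_mult[OF assms this] show ?case
    by (simp add: hcomp_homog)
qed (simp add: hcomp_add distrib_left)

subsection \<open>Derivations\<close>

text \<open>
  The partial derivative with respect to \<open>v\<close>. Giving its coefficients directly makes additivity
  and the commutation of partial derivatives immediate.
\<close>

lift_definition pd :: "'v \<Rightarrow> 'v pol \<Rightarrow> 'v pol" is
  "\<lambda>v f \<mu>. of_nat (Suc (count \<mu> v)) * f (add_mset v \<mu>)"
proof -
  fix v and f :: "'v multiset \<Rightarrow> complex"
  assume "finite {\<mu>. f \<mu> \<noteq> 0}"
  then have "finite (add_mset v -` {\<mu>. f \<mu> \<noteq> 0})"
    by (rule finite_vimageI) (auto intro: injI)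
  then show "finite {\<mu>. of_nat (Suc (count \<mu> v)) * f (add_mset v \<mu>) \<noteq> 0}"
    by (rule finite_subset[rotated]) auto
qed

lemma lookup_pd: "Poly_Mapping.lookup (pd v f) \<mu> =
    of_nat (Suc (count \<mu> v)) * Poly_Mapping.lookup f (add_mset v \<mu>)"
  by transfer simp

lemma pd_add: "pd v (f + g) = pd v f + pd v g"
  and pd_0 [simp]: "pd v 0 = 0"
  by (rule poly_mapping_eqI,
      simp add: lookup_pd Poly_Mapping.lookup_add Poly_Mapping.lookup_minus algebra_simps)+

lemma pd_sum: "pd v (sum f I) = (\<Sum>i\<in>I. pd v (f i))"
  by (induction I rule: infinite_finite_induct) (simp_all add: pd_add)

lemma pd_Const [simp]: "pd v (Const c) = 0"
  by (rule poly_mapping_eqI) (simp add: lookup_pd lookup_Const)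

lemma pd_1 [simp]: "pd v 1 = 0"
  using pd_Const[of v 1] by (simp del: pd_Const)

lemma pd_Var_mult: "pd v (Var u * f) = (if u = v then f else 0) + Var u * pd v f"
proof (rule poly_mapping_eqI)
  fix \<mu>
  show "Poly_Mapping.lookup (pd v (Var u * f)) \<mu> =
      Poly_Mapping.lookup ((if u = v then f else 0) + Var u * pd v f) \<mu>"
  proof (cases "u = v")
    case True
    show ?thesis
    proof (cases "v \<in># \<mu>")
      case v: True
      then obtain \<nu> where "\<mu> = add_mset v \<nu>"
        by (meson multi_member_split)
      with True show ?thesis
        by (simp add: lookup_pd Poly_Mapping.lookup_add lookup_Var_mult distrib_right)
    next
      case v: False
      then have "count \<mu> v = 0"
        by (simp add: count_eq_zero_iff)
      with True v show ?thesis
        by (simp add: lookup_pd Poly_Mapping.lookup_add lookup_Var_mult)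
    qed
  next
    case u: False
    show ?thesis
    proof (cases "u \<in># \<mu>")
      case True
      then obtain \<nu> where "\<mu> = add_mset u \<nu>"
        by (meson multi_member_split)
      with u show ?thesis
        by (simp add: lookup_pd Poly_Mapping.lookup_add lookup_Var_mult)
    next
      case False
      with u show ?thesis
        by (simp add: lookup_pd Poly_Mapping.lookup_add lookup_Var_mult)
    qed
  qed
qed

lemma pd_Const_mult: "pd v (Const c * f) = Const c * pd v f"
  by (rule poly_mapping_eqI) (simp add: lookup_pd)

lemma pd_mult: "pd v (f * g) = pd v f * g + f * pd v g"
proof (induction f rule: pol_induct)
  case (Const c)
  show ?case by (simp add: pd_Const_mult)
next
  case (add f g')
  then show ?case by (simp add: distrib_right pd_add algebra_simps)
next
  case (Var u f)
  then show ?case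
    by (simp add: pd_Var_mult mult.assoc) (simp add: algebra_simps)
qed

lemma pd_Var: "pd v (Var u) = (if u = v then 1 else 0)"
  using pd_Var_mult[of v u 1] by simp

lemma pd_commute: "pd u (pd v f) = pd v (pd u f)"
  by (rule poly_mapping_eqI) (auto simp: lookup_pd add_mset_commute)

lemma keys_pd: "\<mu> \<in> Poly_Mapping.keys (pd v f) \<Longrightarrow> add_mset v \<mu> \<in> Poly_Mapping.keys f"
  by (auto simp: in_keys_iff lookup_pd)

lemma homog_pd: "homog w d f \<Longrightarrow> homog w (d - int (w v)) (pd v f)"
  by (force simp: homog_def dest!: keys_pd)

lemma wdeg_lt_pd': "f \<in> wdeg_lt w k \<Longrightarrow> w v = 1 \<Longrightarrow> pd v f \<in> wdeg_lt w (k - 1)"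
  by (force simp: wdeg_lt_def dest!: keys_pd)

lemma hcomp_pd: "w v = 1 \<Longrightarrow> hcomp w k (pd v f) = pd v (hcomp w (Suc k) f)"
  by (rule poly_mapping_eqI) (simp add: lookup_hcomp lookup_pd)

definition vars :: "'v pol \<Rightarrow> 'v set" where
  "vars f = (\<Union>\<mu>\<in>Poly_Mapping.keys f. set_mset \<mu>)"

lemma finite_vars [simp]: "finite (vars f)"
  by (simp add: vars_def)

lemma pd_eq_0: "v \<notin> vars f \<Longrightarrow> pd v f = 0"
  by (rule poly_mapping_eqI) (simp add: lookup_pd vars_def, metis UN_I in_keys_iff union_single_eq_member)

text \<open>
  The derivation that sends every variable \<open>v\<close> to \<open>c v\<close>.
\<close>

definition der :: "('v \<Rightarrow> 'v pol) \<Rightarrow> 'v pol \<Rightarrow> 'v pol" where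
  "der c f = (\<Sum>v\<in>vars f. c v * pd v f)"

lemma der_superset: "finite S \<Longrightarrow> vars f \<subseteq> S \<Longrightarrow> der c f = (\<Sum>v\<in>S. c v * pd v f)"
  unfolding der_def by (rule sum.mono_neutral_left) (auto simp: pd_eq_0)

lemma der_common:
  obtains S where "finite S" "\<And>c. der c f = (\<Sum>v\<in>S. c v * pd v f)"
    "\<And>c. der c g = (\<Sum>v\<in>S. c v * pd v g)" "\<And>c. der c h = (\<Sum>v\<in>S. c v * pd v h)"
  using that[of "vars f \<union> vars g \<union> vars h"] der_superset[of "vars f \<union> vars g \<union> vars h"] by auto

lemma der_add: "der c (f + g) = der c f + der c g"
  by (rule der_common[of f g "f + g"]) (simp add: pd_add distrib_left sum.distrib)

lemma der_0 [simp]: "der c 0 = 0"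
  by (simp add: der_def)

lemma der_mult: "der c (f * g) = der c f * g + f * der c g"
  by (rule der_common[of f g "f * g"])
     (simp add: pd_mult distrib_left sum.distrib sum_distrib_left sum_distrib_right mult_ac)

lemma der_Const [simp]: "der c (Const a) = 0"
  by (simp add: der_def)

lemma der_1 [simp]: "der c 1 = 0"
  using der_Const[of c 1] by (simp del: der_Const)

lemma der_Var [simp]: "der c (Var v) = c v"
proof -
  have "vars (Var v) = {v}" by (simp add: vars_def Var_def)
  then show ?thesis by (simp add: der_def pd_Var)
qed

lemma der_Var_mult: "der c (Var v * f) = c v * f + Var v * der c f"
  by (simp add: der_mult)

lemma homog_der:
  assumes "homog w d f" "\<And>v. v \<in> vars f \<Longrightarrow> homog w (int (w v) + t) (c v)"
  shows "homog w (d + t) (der c f)"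
  unfolding der_def using assms by (intro homog_sum homog_mult'[OF _ homog_pd]) auto

text \<open>
  Euler's identity: the operator \<open>\<Sum>\<^sub>v w(v) v \<partial>/\<partial>v\<close> multiplies a monomial by its weighted degree.
\<close>

lemma euler:
  assumes "homog w (int d) f"
  shows "der (\<lambda>v. of_nat (w v) * Var v) f = of_nat d * f"
proof (rule poly_mapping_eqI)
  fix \<mu>
  have *: "Poly_Mapping.lookup (of_nat k * g) \<mu> = of_nat k * Poly_Mapping.lookup g \<mu>" for k and g :: "'a pol"
    by (metis Const_of_nat lookup_Const_mult)
  have "Poly_Mapping.lookup (Var v * pd v f) \<mu> = of_nat (count \<mu> v) * Poly_Mapping.lookup f \<mu>" for v
  proof (cases "v \<in># \<mu>")
    case True
    then have "add_mset v (\<mu> - {#v#}) = \<mu>" "Suc (count (\<mu> - {#v#}) v) = count \<mu> v"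
      by auto
    with True show ?thesis by (simp add: lookup_Var_mult lookup_pd del: count_diff)
  qed (simp add: lookup_Var_mult lookup_pd count_eq_zero_iff)
  then have "Poly_Mapping.lookup (der (\<lambda>v. of_nat (w v) * Var v) f) \<mu> =
      (\<Sum>v\<in>vars f. of_nat (w v * count \<mu> v) * Poly_Mapping.lookup f \<mu>)"
    by (simp add: der_def Poly_Mapping.lookup_sum mult.assoc *)
  also have "\<dots> = of_nat (\<Sum>v\<in>vars f. w v * count \<mu> v) * Poly_Mapping.lookup f \<mu>"
    by (simp add: sum_distrib_right)
  also have "\<dots> = of_nat d * Poly_Mapping.lookup f \<mu>"
  proof (cases "\<mu> \<in> Poly_Mapping.keys f")
    case True
    have "(\<Sum>v\<in>S. w v * count \<nu> v) = wdeg w \<nu>" if "finite S" "set_mset \<nu> \<subseteq> S" for S \<nu>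
      using that(2)
    proof (induction \<nu>)
      case (add x \<nu>)
      have "(\<Sum>v\<in>S. w v * count (add_mset x \<nu>) v) =
          (\<Sum>v\<in>S. w v * count \<nu> v + (if v = x then w v else 0))"
        by (intro sum.cong) auto
      with add \<open>finite S\<close> show ?case
        by (simp add: sum.distrib)
    qed simp
    from this[of "vars f" \<mu>] have "(\<Sum>v\<in>vars f. w v * count \<mu> v) = wdeg w \<mu>"
      using True by (auto simp: vars_def)
    then show ?thesis using assms True by (simp add: homog_def)
  qed (simp add: in_keys_iff)
  finally show "Poly_Mapping.lookup (der (\<lambda>v. of_nat (w v) * Var v) f) \<mu> =
      Poly_Mapping.lookup (of_nat d * f) \<mu>"
    by (simp add: *)
qed

section \<open>A Poincare-Birkhoff-Witt theorem\<close>

text \<open>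
  The generators are ordered so that a sorted word consists of negative \<open>L\<close>'s, then negative
  \<open>M\<close>'s, then generators that act on the highest weight vector by scalars. This is the order in
  which a monomial is applied to the highest weight vector in the basis used for the Verma module.
\<close>

fun gen_class :: "gen \<Rightarrow> nat" where
  "gen_class (genL n) = (if n < 0 then 0 else 2)"
| "gen_class (genM n) = (if n < 0 then 1 else 3)"
| "gen_class genCL = 4"
| "gen_class genCM = 5"

fun gen_index :: "gen \<Rightarrow> int" where
  "gen_index (genL n) = n"
| "gen_index (genM n) = n"
| "gen_index _ = 0"

lemma gen_eqI: "gen_class g = gen_class h \<Longrightarrow> gen_index g = gen_index h \<Longrightarrow> g = h"
  by (cases g; cases h) (auto split: if_splits)

instantiation gen :: linorder
begin

definition less_gen :: "gen \<Rightarrow> gen \<Rightarrow> bool" where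
  "g < h \<longleftrightarrow> gen_class g < gen_class h \<or> gen_class g = gen_class h \<and> gen_index g < gen_index h"

definition less_eq_gen :: "gen \<Rightarrow> gen \<Rightarrow> bool" where
  "g \<le> h \<longleftrightarrow> gen_class g < gen_class h \<or> gen_class g = gen_class h \<and> gen_index g \<le> gen_index h"

instance
  by standard (auto simp: less_gen_def less_eq_gen_def intro: gen_eqI)

end

definition lin_ext :: "('a \<Rightarrow> 'v pol) \<Rightarrow> ('a \<Rightarrow>\<^sub>0 complex) \<Rightarrow> 'v pol" where
  "lin_ext F p = (\<Sum>g\<in>Poly_Mapping.keys p. Const (Poly_Mapping.lookup p g) * F g)"

abbreviation bracket_sum :: "(gen \<Rightarrow> 'v pol) \<Rightarrow> gen \<Rightarrow> gen \<Rightarrow> 'v pol" where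
  "bracket_sum F x y \<equiv> lin_ext F (w22_bracket x y)"

lemma lin_ext_superset:
  "finite S \<Longrightarrow> Poly_Mapping.keys p \<subseteq> S \<Longrightarrow>
    lin_ext F p = (\<Sum>g\<in>S. Const (Poly_Mapping.lookup p g) * F g)"
  unfolding lin_ext_def by (rule sum.mono_neutral_left) (auto simp: in_keys_iff)

lemma lin_ext_add: "lin_ext F (p + q) = lin_ext F p + lin_ext F q"
proof -
  let ?S = "Poly_Mapping.keys p \<union> Poly_Mapping.keys q"
  have "Poly_Mapping.keys (p + q) \<subseteq> ?S"
    by (rule Poly_Mapping.keys_add)
  then show ?thesis
    by (simp add: lin_ext_superset[of ?S] Poly_Mapping.lookup_add Const_add distrib_right sum.distrib)
qed

lemma lin_ext_single [simp]: "lin_ext F (Poly_Mapping.single g c) = Const c * F g"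
  by (cases "c = 0") (simp_all add: lin_ext_def)

lemma lin_ext_0 [simp]: "lin_ext F 0 = 0"
  by (simp add: lin_ext_def)

lemma lin_ext_minus: "lin_ext F (- p) = - lin_ext F p"
  by (simp add: lin_ext_def Const_uminus sum_negf)

lemma lin_ext_diff: "lin_ext F (p - q) = lin_ext F p - lin_ext F q"
  using lin_ext_add[of F p "- q"] by (simp add: lin_ext_minus)

lemma lin_ext_sum: "lin_ext F (sum f S) = (\<Sum>i\<in>S. lin_ext F (f i))"
  by (induction S rule: infinite_finite_induct) (simp_all add: lin_ext_add)

lemma bracket_sum_simps [simp]:
  "bracket_sum F (genL m) (genL n) = of_int (m - n) * F (genL (m + n)) +
     (if m + n = 0 then of_int (m ^ 3 - m) * (Const (1/12) * F genCL) else 0)"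
  "bracket_sum F (genL m) (genM n) = of_int (m - n) * F (genM (m + n)) +
     (if m + n = 0 then of_int (m ^ 3 - m) * (Const (1/12) * F genCM) else 0)"
  "bracket_sum F (genM m) (genL n) = of_int (m - n) * F (genM (m + n)) +
     (if m + n = 0 then of_int (m ^ 3 - m) * (Const (1/12) * F genCM) else 0)"
  "bracket_sum F (genM m) (genM n) = 0"
  "bracket_sum F genCL y = 0" "bracket_sum F genCM y = 0"
  "bracket_sum F x genCL = 0" "bracket_sum F x genCM = 0"
proof -
  have *: "Const (of_int k / 12) = of_int k * Const (1 / 12)" for k
    using Const_mult[of "of_int k" "1 / 12"] by (simp add: Const_of_int del: of_int_diff)
  show "bracket_sum F (genL m) (genL n) = of_int (m - n) * F (genL (m + n)) +
     (if m + n = 0 then of_int (m ^ 3 - m) * (Const (1/12) * F genCL) else 0)"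
    by (simp add: lin_ext_add Const_of_int * mult.assoc del: of_int_diff)
  show "bracket_sum F (genL m) (genM n) = of_int (m - n) * F (genM (m + n)) +
     (if m + n = 0 then of_int (m ^ 3 - m) * (Const (1/12) * F genCM) else 0)"
    by (simp add: lin_ext_add Const_of_int * mult.assoc del: of_int_diff)
  show "bracket_sum F (genM m) (genL n) = of_int (m - n) * F (genM (m + n)) +
     (if m + n = 0 then of_int (m ^ 3 - m) * (Const (1/12) * F genCM) else 0)"
    by (simp add: lin_ext_add Const_of_int * mult.assoc del: of_int_diff)
  show "bracket_sum F (genM m) (genM n) = 0"
    "bracket_sum F genCL y = 0" "bracket_sum F genCM y = 0"
    by (simp_all)
  show "bracket_sum F x genCL = 0" "bracket_sum F x genCM = 0"
    by (cases x; simp)+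
qed

lemma bracket_sum_antisym: "bracket_sum F y x = - bracket_sum F x y"
  by (simp add: w22_bracket_antisym[of y x] lin_ext_minus)

lemma bracket_sum_refl [simp]: "bracket_sum F x x = 0"
  by (cases x) (auto simp: power3_eq_cube)

lemma bracket_sum_add:
  "bracket_sum (\<lambda>g. F g + G g) x y = bracket_sum F x y + bracket_sum G x y"
  by (simp add: lin_ext_def distrib_left sum.distrib)

lemma bracket_sum_diff:
  "bracket_sum (\<lambda>g. F g - G g) x y = bracket_sum F x y - bracket_sum G x y"
  by (simp add: lin_ext_def right_diff_distrib sum_subtractf)

lemma bracket_sum_mult: "bracket_sum (\<lambda>g. f * F g) x y = f * bracket_sum F x y"
  by (simp add: lin_ext_def sum_distrib_left mult_ac)

lemma bracket_sum_cong:
  "(\<And>g. g \<in> Poly_Mapping.keys (w22_bracket x y) \<Longrightarrow> F g = G g) \<Longrightarrow> bracket_sum F x y = bracket_sum G x y"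
  by (simp add: lin_ext_def)

lemma bracket_sum_commute:
  "bracket_sum (\<lambda>g. bracket_sum (\<lambda>h. F g h) a b) x y = bracket_sum (\<lambda>h. bracket_sum (\<lambda>g. F g h) x y) a b"
  unfolding lin_ext_def
  by (simp add: sum_distrib_left mult_ac) (rule sum.swap)

text \<open>
  The Jacobi identity after applying a linear functional \<open>F\<close>. All brackets with a central element
  vanish, so only the three-\<open>L\<close> and the two-\<open>L\<close>-one-\<open>M\<close> case have content. Both are the scalar
  identity \<open>main\<close>, whose central part is the cocycle property of \<open>m\<^sup>3 - m\<close>.
\<close>

lemma jacobi:
  "bracket_sum (\<lambda>g. bracket_sum F g z) x y + bracket_sum (\<lambda>g. bracket_sum F g x) y z +
     bracket_sum (\<lambda>g. bracket_sum F g y) z x = 0"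
proof -
  have cubic: "(m - n) * ((m + n) ^ 3 - (m + n)) + (n - k) * ((n + k) ^ 3 - (n + k)) +
      (k - m) * ((k + m) ^ 3 - (k + m)) = 0" if "m + n + k = 0" for m n k :: int
  proof -
    have k: "k = - m - n" using that by simp
    show ?thesis unfolding k by (simp add: algebra_simps power3_eq_cube)
  qed
  have main: "of_int (m - n) * (of_int (m + n - k) * f (m + n + k) +
        (if m + n + k = 0 then of_int ((m + n) ^ 3 - (m + n)) * c else 0)) +
      of_int (n - k) * (of_int (n + k - m) * f (n + k + m) +
        (if n + k + m = 0 then of_int ((n + k) ^ 3 - (n + k)) * c else 0)) +
      of_int (k - m) * (of_int (k + m - n) * f (k + m + n) +
        (if k + m + n = 0 then of_int ((k + m) ^ 3 - (k + m)) * c else 0)) = (0 :: 'a pol)"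
    for m n k :: int and f and c :: "'a pol"
  proof -
    have eq: "n + k + m = m + n + k" "k + m + n = m + n + k" by simp_all
    have 1: "of_int ((m - n) * (m + n - k) + (n - k) * (n + k - m) + (k - m) * (k + m - n)) * f (m + n + k) = 0"
      by (simp add: algebra_simps)
    have six: "a + a' + (b + b') + (d + d') = 0" if "a + b + d = 0" "a' + b' + d' = 0"
      for a b d a' b' d' :: "'a pol"
    proof -
      have "a + a' + (b + b') + (d + d') = (a + b + d) + (a' + b' + d')"
        by (simp add: ac_simps)
      with that show ?thesis by simp
    qed
    show ?thesis
    proof (cases "m + n + k = 0")
      case True
      have 2: "of_int ((m - n) * ((m + n) ^ 3 - (m + n)) + (n - k) * ((n + k) ^ 3 - (n + k)) +
          (k - m) * ((k + m) ^ 3 - (k + m))) * c = 0"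
        using cubic[OF True] by simp
      show ?thesis
        unfolding eq if_P[OF True]
        using 1[unfolded of_int_mult of_int_add distrib_right] 2[unfolded of_int_mult of_int_add distrib_right]
        by (simp only: distrib_left mult.assoc) (rule six)
    next
      case False
      show ?thesis
        unfolding eq if_not_P[OF False]
        using 1[unfolded of_int_mult of_int_add distrib_right]
        by (simp only: distrib_left mult.assoc mult_zero_right add_0_right)
    qed
  qed
  have nested:
    "bracket_sum (\<lambda>g. bracket_sum F g z) (genL m) (genL n) = of_int (m - n) * bracket_sum F (genL (m + n)) z"
    "bracket_sum (\<lambda>g. bracket_sum F g z) (genL m) (genM n) = of_int (m - n) * bracket_sum F (genM (m + n)) z"
    "bracket_sum (\<lambda>g. bracket_sum F g z) (genM m) (genL n) = of_int (m - n) * bracket_sum F (genM (m + n)) z"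
    for m n z
    by (simp_all only: bracket_sum_simps mult_zero_right if_cancel add_0_right)
  note mainL = main[where f = "\<lambda>i. F (genL i)" and c = "Const (1 / 12) * F genCL"]
    and mainM = main[where f = "\<lambda>i. F (genM i)" and c = "Const (1 / 12) * F genCM"]
  have zero: "bracket_sum (\<lambda>g. bracket_sum F g z) (genM m) (genM n) = 0" for m n z
    by (simp only: bracket_sum_simps)
  show ?thesis
    by (cases x; cases y; cases z)
       (simp_all only: nested zero bracket_sum_simps(4-8) mult_zero_right add_0_left add_0_right,
        simp_all only: bracket_sum_simps mainL mainM mult_zero_right if_cancel add_0_left add_0_right)
qed

subsection \<open>Normal forms of words\<close>

fun inversions :: "gen list \<Rightarrow> nat" where
  "inversions [] = 0"
| "inversions (x # w) = size (filter_mset (\<lambda>y. y < x) (mset w)) + inversions w"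

lemma inversions_swap: "y < x \<Longrightarrow> inversions (u @ [y, x] @ v) < inversions (u @ [x, y] @ v)"
  by (induction u) auto

definition word_less :: "(gen list \<times> gen list) set" where
  "word_less = measures [length, inversions]"

lemma inversions_append:
  "inversions (w @ v) = inversions w + inversions v +
     (\<Sum>x\<in>#mset w. size (filter_mset (\<lambda>y. y < x) (mset v)))"
  by (induction w) auto

lemma inversions_context:
  assumes "mset l = mset l'" "inversions l < inversions l'"
  shows "inversions (u @ l @ v) < inversions (u @ l' @ v)"
  by (induction u) (use assms in \<open>auto simp: inversions_append\<close>)

lemma wf_word_less: "wf word_less"
  by (simp add: word_less_def)

lemma word_less_shorter: "length w' < length w \<Longrightarrow> (w', w) \<in> word_less"
  by (simp add: word_less_def)

lemma word_less_swap: "y < x \<Longrightarrow> (u @ [y, x] @ v, u @ [x, y] @ v) \<in> word_less"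
  using inversions_swap[of y x u v] by (simp add: word_less_def)

lemma word_less_reorder:
  "mset l = mset l' \<Longrightarrow> inversions l < inversions l' \<Longrightarrow> (u @ l @ v, u @ l' @ v) \<in> word_less"
  by (auto simp: word_less_def inversions_context dest: mset_eq_length)

lemma first_descent:
  assumes "\<not> sorted w"
  shows "\<exists>u x y v. w = u @ [x, y] @ v \<and> y < x \<and> sorted (u @ [x :: 'a :: linorder])"
  using assms
proof (induction w)
  case (Cons a w)
  show ?case
  proof (cases w)
    case w: (Cons b w')
    show ?thesis
    proof (cases "b < a")
      case True
      then show ?thesis
        using w by (intro exI[of _ "[]"] exI[of _ a] exI[of _ b] exI[of _ w']) simp
    next
      case False
      with Cons w have "\<not> sorted w"
        by (metis linorder_not_less sorted2)
      from Cons.IH[OF this] obtain u x y v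
        where *: "w = u @ [x, y] @ v" "y < x" "sorted (u @ [x])" by blast
      have "sorted (a # u @ [x])"
        using * w False by (cases u) auto
      with * show ?thesis
        by (intro exI[of _ "a # u"] exI[of _ x] exI[of _ y] exI[of _ v]) simp
    qed
  qed (use Cons in simp)
qed simp

lemma word_induct [consumes 0, case_names sorted descent]:
  assumes sorted: "\<And>w. sorted w \<Longrightarrow> P w"
    and descent: "\<And>u x y v. y < x \<Longrightarrow> P (u @ [y, x] @ v) \<Longrightarrow>
      (\<And>w. length w < length (u @ [x, y] @ v) \<Longrightarrow> P w) \<Longrightarrow> P (u @ [x, y] @ v)"
  shows "P (w :: gen list)"
  using wf_word_less
proof (induction w rule: wf_induct_rule)
  case (less w)
  show ?case
  proof (cases "sorted w")
    case False
    from first_descent[OF this] obtain u x y v where w: "w = u @ [x, y] @ v" "y < x"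
      by (elim exE conjE)
    have "P (u @ [x, y] @ v)"
    proof (rule descent[OF w(2)])
      show "P (u @ [y, x] @ v)"
        by (rule less.IH) (unfold w(1), rule word_less_swap[OF w(2)])
      show "P w'" if "length w' < length (u @ [x, y] @ v)" for w'
        by (rule less.IH) (unfold w(1), rule word_less_shorter[OF that])
    qed
    then show ?thesis
      by (simp only: w(1))
  qed (rule sorted)
qed

text \<open>
  The rewriting \<open>x y = y x + [x, y]\<close> is applied to the first descent of a word; \<open>e\<close> prescribes
  the values on sorted words. The swap removes an inversion and the bracket shortens the word.
\<close>

function normal_form :: "(gen list \<Rightarrow> 'v pol) \<Rightarrow> gen list \<Rightarrow> 'v pol" where
  "normal_form e w =
     (if sorted w then e w
      else let (u, x, y, v) = (SOME (u, x, y, v). w = u @ [x, y] @ v \<and> y < x \<and> sorted (u @ [x]))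
        in normal_form e (u @ [y, x] @ v) + bracket_sum (\<lambda>g. normal_form e (u @ [g] @ v)) x y)"
  by pat_completeness auto

lemma first_descent_some:
  assumes "\<not> sorted w"
    and "(u, x, y, v) = (SOME (u, x, y, v). w = u @ [x, y] @ v \<and> y < x \<and> sorted (u @ [x]))"
  shows "w = u @ [x, y] @ v \<and> y < x \<and> sorted (u @ [x :: 'a :: linorder])"
proof -
  have "\<exists>t. case t of (u, x, y, v) \<Rightarrow> w = u @ [x, y] @ v \<and> y < x \<and> sorted (u @ [x])"
    using first_descent[OF assms(1)] by auto
  from someI_ex[OF this] show ?thesis
    using assms(2) by (simp split: prod.splits)
qed

termination normal_form
proof (relation "inv_image word_less snd")
  show "wf (inv_image word_less (snd :: (gen list \<Rightarrow> 'v pol) \<times> gen list \<Rightarrow> _))"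
    by (simp add: wf_word_less)
next
  fix e :: "gen list \<Rightarrow> 'v pol" and w :: "gen list" and t u t' x t'' y v
  assume "\<not> sorted w"
    and *: "t = (SOME (u, x, y, v). w = u @ [x, y] @ v \<and> y < x \<and> sorted (u @ [x]))"
    "(u, t') = t" "(x, t'') = t'" "(y, v) = t''"
  then have w: "w = u @ [x, y] @ v \<and> y < x"
    using first_descent_some[of w u x y v] by auto
  then show "((e, u @ [y, x] @ v), e, w) \<in> inv_image word_less snd"
    using word_less_swap[of y x u v] by simp
  fix g
  from w show "((e, u @ [g] @ v), e, w) \<in> inv_image word_less snd"
    by (simp add: word_less_shorter)
qed

declare normal_form.simps [simp del]

lemma normal_form_sorted: "sorted w \<Longrightarrow> normal_form e w = e w"
  by (subst normal_form.simps) simp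

lemma normal_form_step:
  assumes "\<not> sorted w"
  obtains u x y v where "w = u @ [x, y] @ v" "y < x" "sorted (u @ [x])"
    "normal_form e w = normal_form e (u @ [y, x] @ v) + bracket_sum (\<lambda>g. normal_form e (u @ [g] @ v)) x y"
proof -
  obtain u x y v where *: "(SOME (u, x, y, v). w = u @ [x, y] @ v \<and> y < x \<and> sorted (u @ [x])) = (u, x, y, v)"
    by (rule prod_cases4)
  have "normal_form e w = normal_form e (u @ [y, x] @ v) + bracket_sum (\<lambda>g. normal_form e (u @ [g] @ v)) x y"
    by (subst normal_form.simps) (simp only: assms if_False * Let_def prod.case)
  then show ?thesis
    using first_descent_some[OF assms *[symmetric]] that by blast
qed

text \<open>
  The rewriting rule holds at every position, not only at the first descent; hence the values on
  sorted words can be prescribed freely, which is the Poincare-Birkhoff-Witt theorem. The proof is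
  the diamond lemma: two disjoint descents can be resolved in either order, and for overlapping
  descents \<open>a > x > y\<close> the two results differ by an instance of the Jacobi identity.
\<close>

theorem normal_form_swap:
  "normal_form e (u @ [x, y] @ v) =
     normal_form e (u @ [y, x] @ v) + bracket_sum (\<lambda>g. normal_form e (u @ [g] @ v)) x y"
proof -
  let ?N = "normal_form e"
  have "?N w = ?N (u @ [y, x] @ v) + bracket_sum (\<lambda>g. ?N (u @ [g] @ v)) x y"
    if "w = u @ [x, y] @ v" "y < x" for w u x y v
    using wf_word_less that
  proof (induction w arbitrary: u x y v rule: wf_induct_rule)
    case (less w u x y v)
    have IH: "?N (u' @ [a, b] @ v') = ?N (u' @ [b, a] @ v') + bracket_sum (\<lambda>g. ?N (u' @ [g] @ v')) a b"
      if "(u' @ [a, b] @ v', w) \<in> word_less" "(u' @ [b, a] @ v', w) \<in> word_less" for u' a b v'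
    proof (cases a b rule: linorder_cases)
      case less
      from less.IH[OF that(2) refl less] show ?thesis
        by (simp add: bracket_sum_antisym[of _ a b])
    qed (use less.IH[OF that(1) refl] in auto)
    have "\<not> sorted w"
      using less.prems by (auto simp: sorted_append)
    \<comment> \<open>The definition resolves the first descent \<open>a b\<close>, which lies at or before \<open>x y\<close>.\<close>
    then obtain u0 a b v0 where w0: "w = u0 @ [a, b] @ v0" "b < a" "sorted (u0 @ [a])"
      and step: "?N w = ?N (u0 @ [b, a] @ v0) + bracket_sum (\<lambda>g. ?N (u0 @ [g] @ v0)) a b"
      by (rule normal_form_step)
    have len: "length u0 \<le> length u"
    proof (rule ccontr)
      assume *: "\<not> length u0 \<le> length u"
      have "(u0 @ [a]) ! length u = w ! length u" "(u0 @ [a]) ! Suc (length u) = w ! Suc (length u)"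
        using * by (auto simp: w0(1) nth_append less_Suc_eq)
      moreover have "w ! length u = x" "w ! Suc (length u) = y"
        by (simp_all add: less.prems(1) nth_append)
      moreover have "(u0 @ [a]) ! length u \<le> (u0 @ [a]) ! Suc (length u)"
        using w0(3) * by (intro sorted_nth_mono) auto
      ultimately show False using less.prems(2) by simp
    qed
    have ww: "u0 @ a # b # v0 = u @ x # y # v"
      using w0(1) less.prems(1) by simp
    have "u0 = take (length u0) u"
      using arg_cong[OF ww, of "take (length u0)"] len by simp
    then obtain t where t1: "u = u0 @ t"
      by (metis append_take_drop_id)
    with ww have t: "u = u0 @ t" "a # b # v0 = t @ x # y # v"
      by simp_all
    consider "t = []" | "t = [a]" "b = x" "v0 = y # v" | t' where "t = a # b # t'" "v0 = t' @ x # y # v"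
      using t(2) by (cases t rule: remdups_adj.cases) auto
    then show ?case
    proof cases
      case 1
      with t step show ?thesis by simp
    next
      \<comment> \<open>The descents overlap: both ways of sorting \<open>a x y\<close> are expanded down to \<open>y x a\<close>.\<close>
      case 2
      have w: "w = u0 @ [a, x, y] @ v" and lt: "x < a" "y < x"
        using 2 w0 t less.prems by simp_all
      have sw: "(u0 @ l @ v, w) \<in> word_less"
        if "inversions l < inversions [a, x, y]" "mset l = mset [a, x, y]" for l
        unfolding w using that(2,1) by (rule word_less_reorder)
      have short: "(u0 @ l @ v, w) \<in> word_less" if "length l \<le> 2" for l
        using that by (simp add: w word_less_shorter)
      have lt': "y < a" "\<not> a < x" "\<not> x < y" "\<not> a < y"
        using lt by auto
      have inv: "inversions [a, x, y] = 3"
        using lt lt' by simp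
      have adj1: "?N (u0 @ [c, d, e'] @ v) = ?N (u0 @ [d, c, e'] @ v) + bracket_sum (\<lambda>g. ?N (u0 @ [g, e'] @ v)) c d"
        if "inversions [c, d, e'] < 3" "inversions [d, c, e'] < 3" "{#c, d, e'#} = {#a, x, y#}" for c d e'
        using IH[of u0 c d "e' # v"] sw[of "[c, d, e']"] sw[of "[d, c, e']"] that inv
        by (simp add: add_mset_commute)
      have adj2: "?N (u0 @ [c, d, e'] @ v) = ?N (u0 @ [c, e', d] @ v) + bracket_sum (\<lambda>g. ?N (u0 @ [c, g] @ v)) d e'"
        if "inversions [c, d, e'] < 3" "inversions [c, e', d] < 3" "{#c, d, e'#} = {#a, x, y#}" for c d e'
        using IH[of "u0 @ [c]" d e' v] sw[of "[c, d, e']"] sw[of "[c, e', d]"] that inv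
        by (simp add: add_mset_commute)
      have pair: "?N (u0 @ [c, d] @ v) = ?N (u0 @ [d, c] @ v) + bracket_sum (\<lambda>g. ?N (u0 @ [g] @ v)) c d" for c d
        using IH[of u0 c d v] short[of "[c, d]"] short[of "[d, c]"] by simp
      let ?F = "\<lambda>g. ?N (u0 @ [g] @ v)"
      have pairs: "bracket_sum (\<lambda>g. ?N (u0 @ [g, z] @ v)) c d =
          bracket_sum (\<lambda>g. ?N (u0 @ [z, g] @ v)) c d + bracket_sum (\<lambda>g. bracket_sum ?F g z) c d" for c d z
        by (subst bracket_sum_add [symmetric]) (rule arg_cong[where f = "\<lambda>F. bracket_sum F c d"], rule ext, rule pair)
      have "?N w = ?N (u0 @ [x, a, y] @ v) + bracket_sum (\<lambda>g. ?N (u0 @ [g, y] @ v)) a x"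
        using step 2 by simp
      also have "?N (u0 @ [x, a, y] @ v) = ?N (u0 @ [x, y, a] @ v) + bracket_sum (\<lambda>g. ?N (u0 @ [x, g] @ v)) a y"
        by (rule adj2) (use lt lt' in \<open>auto simp: add_mset_commute\<close>)
      also have "?N (u0 @ [x, y, a] @ v) = ?N (u0 @ [y, x, a] @ v) + bracket_sum (\<lambda>g. ?N (u0 @ [g, a] @ v)) x y"
        by (rule adj1) (use lt lt' in \<open>auto simp: add_mset_commute\<close>)
      finally have 1: "?N w = ?N (u0 @ [y, x, a] @ v) + bracket_sum (\<lambda>g. ?N (u0 @ [g, a] @ v)) x y +
          bracket_sum (\<lambda>g. ?N (u0 @ [x, g] @ v)) a y + bracket_sum (\<lambda>g. ?N (u0 @ [g, y] @ v)) a x" .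
      have "?N (u0 @ [a, y, x] @ v) = ?N (u0 @ [y, a, x] @ v) + bracket_sum (\<lambda>g. ?N (u0 @ [g, x] @ v)) a y"
        by (rule adj1) (use lt lt' in \<open>auto simp: add_mset_commute\<close>)
      also have "?N (u0 @ [y, a, x] @ v) = ?N (u0 @ [y, x, a] @ v) + bracket_sum (\<lambda>g. ?N (u0 @ [y, g] @ v)) a x"
        by (rule adj2) (use lt lt' in \<open>auto simp: add_mset_commute\<close>)
      finally have eq2: "?N (u @ [y, x] @ v) = ?N (u0 @ [y, x, a] @ v) + bracket_sum (\<lambda>g. ?N (u0 @ [y, g] @ v)) a x +
          bracket_sum (\<lambda>g. ?N (u0 @ [g, x] @ v)) a y"
        using t 2 by simp
      have eq3: "bracket_sum (\<lambda>g. ?N (u @ [g] @ v)) x y = bracket_sum (\<lambda>g. ?N (u0 @ [a, g] @ v)) x y"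
        using t 2 by simp
      have "bracket_sum (\<lambda>g. bracket_sum ?F g x) a y = - bracket_sum (\<lambda>g. bracket_sum ?F g x) y a"
        by (rule bracket_sum_antisym)
      moreover have "bracket_sum (\<lambda>g. bracket_sum ?F g a) x y + bracket_sum (\<lambda>g. bracket_sum ?F g x) y a +
          bracket_sum (\<lambda>g. bracket_sum ?F g y) a x = 0"
        by (rule jacobi)
      ultimately show ?thesis
        unfolding 1 eq2 eq3 pairs by (simp add: algebra_simps add_eq_0_iff)
    next
      \<comment> \<open>The descents \<open>a b\<close> and \<open>x y\<close> are disjoint and can be resolved in either order.\<close>
      case (3 t')
      have w: "w = u0 @ [a, b] @ t' @ [x, y] @ v"
        using 3 w0 by simp
      have "?N w = ?N ((u0 @ [b, a] @ t') @ [x, y] @ v) +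
          bracket_sum (\<lambda>g. ?N ((u0 @ [g] @ t') @ [x, y] @ v)) a b"
        using step 3 by simp
      also have "?N ((u0 @ [b, a] @ t') @ [x, y] @ v) = ?N ((u0 @ [b, a] @ t') @ [y, x] @ v) +
          bracket_sum (\<lambda>g. ?N ((u0 @ [b, a] @ t') @ [g] @ v)) x y"
      proof (rule less.IH[OF _ refl less.prems(2)])
        show "((u0 @ [b, a] @ t') @ [x, y] @ v, w) \<in> word_less"
          using word_less_swap[OF w0(2), of u0 "t' @ [x, y] @ v"] by (simp add: w)
      qed
      also have "bracket_sum (\<lambda>g. ?N ((u0 @ [g] @ t') @ [x, y] @ v)) a b =
          bracket_sum (\<lambda>g. ?N ((u0 @ [g] @ t') @ [y, x] @ v) +
            bracket_sum (\<lambda>h. ?N ((u0 @ [g] @ t') @ [h] @ v)) x y) a b"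
        by (intro arg_cong[where f = "\<lambda>F. bracket_sum F a b"] ext IH) (simp_all add: w word_less_shorter)
      also have "\<dots> = bracket_sum (\<lambda>g. ?N (u0 @ [g] @ t' @ [y, x] @ v)) a b +
          bracket_sum (\<lambda>h. bracket_sum (\<lambda>g. ?N (u0 @ [g] @ t' @ [h] @ v)) a b) x y"
        by (simp add: bracket_sum_add) (rule bracket_sum_commute)
      finally have 1: "?N w = ?N (u0 @ [b, a] @ t' @ [y, x] @ v) +
          bracket_sum (\<lambda>g. ?N (u0 @ [g] @ t' @ [y, x] @ v)) a b +
          (bracket_sum (\<lambda>g. ?N (u0 @ [b, a] @ t' @ [g] @ v)) x y +
          bracket_sum (\<lambda>h. bracket_sum (\<lambda>g. ?N (u0 @ [g] @ t' @ [h] @ v)) a b) x y)"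
        by simp
      have 2: "?N (u @ [y, x] @ v) = ?N (u0 @ [b, a] @ t' @ [y, x] @ v) +
          bracket_sum (\<lambda>g. ?N (u0 @ [g] @ t' @ [y, x] @ v)) a b"
      proof -
        have "?N (u0 @ [a, b] @ (t' @ [y, x] @ v)) = ?N (u0 @ [b, a] @ (t' @ [y, x] @ v)) +
          bracket_sum (\<lambda>g. ?N (u0 @ [g] @ (t' @ [y, x] @ v))) a b"
        proof (rule less.IH[OF _ refl w0(2)])
          show "(u0 @ [a, b] @ t' @ [y, x] @ v, w) \<in> word_less"
            using word_less_swap[OF less.prems(2), of "u0 @ [a, b] @ t'" v] by (simp add: w)
        qed
        then show ?thesis using t 3 by simp
      qed
      have 3: "bracket_sum (\<lambda>h. ?N (u @ [h] @ v)) x y =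
          bracket_sum (\<lambda>h. ?N (u0 @ [b, a] @ t' @ [h] @ v) +
             bracket_sum (\<lambda>g. ?N (u0 @ [g] @ t' @ [h] @ v)) a b) x y"
      proof (intro arg_cong[where f = "\<lambda>F. bracket_sum F x y"] ext)
        fix h
        have "?N (u0 @ [a, b] @ (t' @ [h] @ v)) = ?N (u0 @ [b, a] @ (t' @ [h] @ v)) +
            bracket_sum (\<lambda>g. ?N (u0 @ [g] @ (t' @ [h] @ v))) a b"
          by (rule IH) (simp_all add: w word_less_shorter)
        then show "?N (u @ [h] @ v) = ?N (u0 @ [b, a] @ t' @ [h] @ v) +
             bracket_sum (\<lambda>g. ?N (u0 @ [g] @ t' @ [h] @ v)) a b"
          using t 3 by simp
      qed
      show ?thesis
        unfolding 1 2 3 bracket_sum_add by simp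
    qed
  qed
  note main = this
  show ?thesis
  proof (cases x y rule: linorder_cases)
    case less
    from main[OF refl less, of u v] show ?thesis
      by (simp add: bracket_sum_antisym[of _ x y])
  qed (use main[OF refl] in auto)
qed

section \<open>Computing in the enveloping algebra\<close>

lemma tensor_scalar_central: "Poly_Mapping.single 0 c * (t :: tensor_alg) = t * Poly_Mapping.single 0 c"
  by (induction t rule: single_induct) (simp_all add: mult_single mult.commute algebra_simps)

lemma uea_scale_mult_left [simp]: "(c \<cdot> u) * v = c \<cdot> (u * v)"
  by transfer (simp add: mult.assoc uea_ideal_zero)

lemma uea_scale_mult_right [simp]: "u * (c \<cdot> v) = c \<cdot> (u * v)"
proof transfer
  fix u v :: tensor_alg and c :: complex
  have "u * (Poly_Mapping.single 0 c * v) = Poly_Mapping.single 0 c * (u * v)"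
    by (simp only: mult.assoc [symmetric] tensor_scalar_central [of c u])
  then show "u * (Poly_Mapping.single 0 c * v) - Poly_Mapping.single 0 c * (u * v) \<in> uea_ideal"
    by (simp add: uea_ideal_zero)
qed

lemma uea_scale_add_right: "c \<cdot> (u + v) = c \<cdot> u + c \<cdot> v"
  by transfer (simp add: distrib_left uea_ideal_zero)

lemma uea_scale_diff_right: "c \<cdot> (u - v) = c \<cdot> u - c \<cdot> v"
  by transfer (simp add: right_diff_distrib uea_ideal_zero)

lemma uea_scale_add_left: "(c + d) \<cdot> u = c \<cdot> u + d \<cdot> u"
  by transfer (simp add: single_add distrib_right uea_ideal_zero)

lemma uea_scale_scale [simp]: "c \<cdot> d \<cdot> u = (c * d) \<cdot> u"
  by transfer (simp add: mult.assoc [symmetric] mult_single uea_ideal_zero)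

lemma uea_scale_one [simp]: "1 \<cdot> u = u"
  by transfer (simp add: uea_ideal_zero)

lemma uea_scale_zero [simp]: "0 \<cdot> u = 0"
  by transfer (simp add: uea_ideal_zero)

lemma uea_scale_zero_right [simp]: "c \<cdot> (0 :: uea) = 0"
  by transfer (simp add: uea_ideal_zero)

lemma uea_scale_minus [simp]: "(- c) \<cdot> u = - (c \<cdot> u)"
  using uea_scale_add_left[of c "- c" u] by (simp add: add_eq_0_iff)

lemma uea_scale_sum: "c \<cdot> sum f S = (\<Sum>i\<in>S. c \<cdot> f i)"
  by (induction S rule: infinite_finite_induct) (simp_all add: uea_scale_add_right)

lemma uea_scale_eq_mult: "c \<cdot> u = (c \<cdot> 1) * u"
  by simp

definition uea_ext :: "('a \<Rightarrow> uea) \<Rightarrow> ('a \<Rightarrow>\<^sub>0 complex) \<Rightarrow> uea" where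
  "uea_ext F p = (\<Sum>g\<in>Poly_Mapping.keys p. Poly_Mapping.lookup p g \<cdot> F g)"

lemma uea_ext_superset:
  "finite S \<Longrightarrow> Poly_Mapping.keys p \<subseteq> S \<Longrightarrow> uea_ext F p = (\<Sum>g\<in>S. Poly_Mapping.lookup p g \<cdot> F g)"
  unfolding uea_ext_def by (rule sum.mono_neutral_left) (auto simp: in_keys_iff)

lemma uea_ext_add: "uea_ext F (p + q) = uea_ext F p + uea_ext F q"
proof -
  let ?S = "Poly_Mapping.keys p \<union> Poly_Mapping.keys q"
  have "Poly_Mapping.keys (p + q) \<subseteq> ?S"
    by (rule Poly_Mapping.keys_add)
  then show ?thesis
    by (simp add: uea_ext_superset[of ?S] Poly_Mapping.lookup_add uea_scale_add_left sum.distrib)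
qed

lemma uea_ext_single [simp]: "uea_ext F (Poly_Mapping.single g c) = c \<cdot> F g"
  by (cases "c = 0") (simp_all add: uea_ext_def)

lemma uea_ext_0 [simp]: "uea_ext F 0 = 0"
  by (simp add: uea_ext_def)

definition uword :: "gen list \<Rightarrow> uea" where
  "uword w = prod_list (map uea_gen w)"

lemma uword_simps [simp]:
  "uword [] = 1" "uword (g # w) = uea_gen g * uword w" "uword (u @ w) = uword u * uword w"
  by (simp_all add: uword_def)

lemma abs_uea_plus: "abs_uea (s + t) = abs_uea s + abs_uea t"
  by (simp add: plus_uea.abs_eq)

lemma abs_uea_zero: "abs_uea 0 = 0"
  by (simp add: zero_uea.abs_eq)

lemma abs_uea_sum: "abs_uea (sum f S) = (\<Sum>i\<in>S. abs_uea (f i))"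
  by (induction S rule: infinite_finite_induct) (simp_all add: abs_uea_plus abs_uea_zero)

lemma abs_uea_single: "abs_uea (Poly_Mapping.single (Word w) c) = c \<cdot> uword w"
proof -
  have "abs_uea (Poly_Mapping.single (Word w) 1) = uword w"
  proof (induction w)
    case Nil
    show ?case
      by (simp add: one_uea.abs_eq zero_word_def[symmetric])
  next
    case (Cons g w)
    have "Poly_Mapping.single (Word (g # w)) (1 :: complex) =
        tensor_gen g * Poly_Mapping.single (Word w) 1"
      by (simp add: tensor_gen_def mult_single plus_word_def)
    with Cons show ?case
      by (simp add: times_uea.abs_eq[symmetric] uea_gen.abs_eq)
  qed
  moreover have "Poly_Mapping.single (Word w) c = Poly_Mapping.single 0 c * Poly_Mapping.single (Word w) 1"
    by (simp add: mult_single)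
  ultimately show ?thesis
    by (metis uea_scale.abs_eq)
qed

lemma uea_induct [case_names add word]:
  assumes add: "\<And>u v. P u \<Longrightarrow> P v \<Longrightarrow> P (u + v)"
    and word: "\<And>c w. P (c \<cdot> uword w)"
  shows "P u"
proof -
  obtain t where u: "u = abs_uea t"
    by (metis Quotient_abs_rep Quotient_uea)
  have "P (abs_uea (\<Sum>w\<in>S. Poly_Mapping.single w (Poly_Mapping.lookup t w)))" if "finite S" for S
    using that
  proof (induction S)
    case empty
    show ?case using word[of 0 "[]"] by (simp add: abs_uea_zero)
  next
    case (insert w S)
    then show ?case
      by (cases w) (simp add: abs_uea_plus abs_uea_single add word)
  qed
  from this[of "Poly_Mapping.keys t"] show ?thesis
    by (simp add: u flip: sum_singles)
qed

lemma uea_bracket: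
  "uea_gen x * uea_gen y = uea_gen y * uea_gen x + uea_ext uea_gen (w22_bracket x y)"
proof -
  have "uea_lin p = uea_ext uea_gen p" for p
  proof -
    have "uea_lin p = abs_uea (tensor_lin p)"
      by (simp add: uea_lin.abs_eq)
    also have "\<dots> = uea_ext uea_gen p"
      by (simp add: tensor_lin_def abs_uea_sum abs_uea_single uea_ext_def)
    finally show ?thesis .
  qed
  with uea_commutator[of x y] show ?thesis
    by (simp add: algebra_simps)
qed

lemma uea_LL: "U_L m * U_L n = U_L n * U_L m + of_int (m - n) \<cdot> U_L (m + n) +
    (if m + n = 0 then (of_int (m ^ 3 - m) / 12) \<cdot> U_CL else 0)"
  and uea_LM: "U_L m * U_M n = U_M n * U_L m + of_int (m - n) \<cdot> U_M (m + n) +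
    (if m + n = 0 then (of_int (m ^ 3 - m) / 12) \<cdot> U_CM else 0)"
  and uea_ML: "U_M m * U_L n = U_L n * U_M m + of_int (m - n) \<cdot> U_M (m + n) +
    (if m + n = 0 then (of_int (m ^ 3 - m) / 12) \<cdot> U_CM else 0)"
  and uea_MM: "U_M m * U_M n = U_M n * U_M m"
  by (subst uea_bracket, simp add: uea_ext_add del: of_int_diff)+

lemma uea_CM_central: "U_CM * u = u * U_CM"
  and uea_CL_central: "U_CL * u = u * U_CL"
proof -
  have "U_CM * uword w = uword w * U_CM \<and> U_CL * uword w = uword w * U_CL" for w
  proof (induction w)
    case (Cons g w)
    have "U_CM * uea_gen g = uea_gen g * U_CM" "U_CL * uea_gen g = uea_gen g * U_CL"
      by (simp_all add: uea_bracket[of genCM g] uea_bracket[of genCL g])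
    with Cons show ?case
      by simp (metis mult.assoc)
  qed simp
  then show "U_CM * u = u * U_CM" "U_CL * u = u * U_CL"
    by (induction u rule: uea_induct) (simp_all add: algebra_simps)
qed

subsection \<open>Linear maps given by normal forms\<close>

text \<open>
  It suffices to evaluate a generator of the ideal between two words, where the rule for \<open>N\<close> is
  exactly the vanishing of the result.
\<close>

lemma lin_ext_uea_ideal:
  fixes N :: "gen list \<Rightarrow> 'v pol"
  assumes "\<And>u x y v. N (u @ [x, y] @ v) = N (u @ [y, x] @ v) + bracket_sum (\<lambda>g. N (u @ [g] @ v)) x y"
    and "a \<in> uea_ideal"
  shows "lin_ext (\<lambda>w. N (letters w)) a = 0"
proof -
  let ?L = "lin_ext (\<lambda>w. N (letters w))"
  let ?I = "{a. \<forall>s t. ?L (s * a * t) = 0}"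
  have gens: "?L (s * (tensor_gen x * tensor_gen y - tensor_gen y * tensor_gen x
        - tensor_lin (w22_bracket x y)) * t) = 0" for s t x y
  proof (induction s rule: single_induct)
    case (single w c)
    show ?case
    proof (induction t rule: single_induct)
      case (single w' d)
      obtain u v where uv: "w = Word u" "w' = Word v"
        by (metis word.exhaust)
      have *: "?L (Poly_Mapping.single w c * Poly_Mapping.single (Word l) k * Poly_Mapping.single w' d) =
          Const (c * d) * Const k * N (u @ l @ v)" for l k
        by (simp add: uv mult_single plus_word_def Const_mult mult_ac)
      have "?L (Poly_Mapping.single w c * tensor_lin p * Poly_Mapping.single w' d) =
          Const (c * d) * lin_ext (\<lambda>g. N (u @ [g] @ v)) p" for p
        by (simp only: tensor_lin_def sum_distrib_left sum_distrib_right lin_ext_sum *)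
           (simp add: lin_ext_def sum_distrib_left mult.assoc)
      moreover have "tensor_gen a * tensor_gen b = Poly_Mapping.single (Word [a, b]) 1" for a b
        by (simp add: tensor_gen_def mult_single plus_word_def)
      ultimately show ?case
        using assms(1)[of u x y v]
        by (simp add: right_diff_distrib left_diff_distrib lin_ext_diff * del: append.simps append_Cons)
           (simp add: algebra_simps)
    qed (simp add: distrib_left lin_ext_add)
  qed (simp add: distrib_right lin_ext_add)
  have "?L (s * (u * a) * t) = 0" "?L (s * (a * u) * t) = 0" if "a \<in> ?I" for s t u a
  proof -
    have "s * (u * a) * t = (s * u) * a * t" "s * (a * u) * t = s * a * (u * t)"
      by (simp_all add: mult.assoc)
    with that show "?L (s * (u * a) * t) = 0" "?L (s * (a * u) * t) = 0"
      by (auto simp only: mem_Collect_eq)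
  qed
  then have "two_sided_ideal ?I"
    unfolding two_sided_ideal_def left_ideal_def
    by (auto simp: distrib_left distrib_right lin_ext_add)
  then have "uea_ideal \<subseteq> ?I"
    unfolding uea_ideal_def using gens by (intro hull_minimal) auto
  with assms(2) have "?L (1 * a * 1) = 0" by blast
  then show ?thesis by simp
qed

lift_definition pbw_map :: "(gen list \<Rightarrow> 'v pol) \<Rightarrow> uea \<Rightarrow> 'v pol" is
  "\<lambda>e t. lin_ext (\<lambda>w. normal_form e (letters w)) t"
proof -
  fix e :: "gen list \<Rightarrow> 'v pol" and s t :: tensor_alg
  assume "s - t \<in> uea_ideal"
  from lin_ext_uea_ideal[OF normal_form_swap[of e] this]
  show "lin_ext (\<lambda>w. normal_form e (letters w)) s = lin_ext (\<lambda>w. normal_form e (letters w)) t"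
    by (simp add: lin_ext_diff)
qed

lemma pbw_map_add: "pbw_map e (u + v) = pbw_map e u + pbw_map e v"
  by transfer (rule lin_ext_add)

lemma pbw_map_diff: "pbw_map e (u - v) = pbw_map e u - pbw_map e v"
  by transfer (rule lin_ext_diff)

lemma pbw_map_scale: "pbw_map e (c \<cdot> u) = Const c * pbw_map e u"
proof transfer
  fix e :: "gen list \<Rightarrow> 'a pol" and c and u :: tensor_alg
  show "lin_ext (\<lambda>w. normal_form e (letters w)) (Poly_Mapping.single 0 c * u) =
      Const c * lin_ext (\<lambda>w. normal_form e (letters w)) u"
    by (induction u rule: single_induct)
       (simp_all add: mult_single distrib_left lin_ext_add Const_mult mult.assoc)
qed

lemma pbw_map_word: "pbw_map e (uword w) = normal_form e w"
proof -
  have "uword w = abs_uea (Poly_Mapping.single (Word w) 1)"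
    by (simp add: abs_uea_single)
  then show ?thesis
    by (simp add: pbw_map.abs_eq)
qed

lemma pbw_map_sum: "pbw_map e (sum f S) = (\<Sum>i\<in>S. pbw_map e (f i))"
proof (induction S rule: infinite_finite_induct)
  case empty
  show ?case using pbw_map_scale[of e 0 0] by simp
next
  case infinite
  then show ?case using pbw_map_scale[of e 0 0] by simp
qed (simp_all add: pbw_map_add)

subsection \<open>Left ideals\<close>

lemma left_ideal_0: "left_ideal I \<Longrightarrow> 0 \<in> I"
  and left_ideal_add: "left_ideal I \<Longrightarrow> a \<in> I \<Longrightarrow> b \<in> I \<Longrightarrow> a + b \<in> I"
  and left_ideal_mult: "left_ideal I \<Longrightarrow> a \<in> I \<Longrightarrow> u * a \<in> I"
  by (simp_all add: left_ideal_def)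

lemma left_ideal_minus: "left_ideal I \<Longrightarrow> a \<in> I \<Longrightarrow> - a \<in> I"
  using left_ideal_mult[of I a "- 1"] by simp

lemma left_ideal_diff: "left_ideal I \<Longrightarrow> a \<in> I \<Longrightarrow> b \<in> I \<Longrightarrow> a - b \<in> I"
  using left_ideal_add[of I a "- b"] by (simp add: left_ideal_minus)

lemma left_ideal_scale: "left_ideal I \<Longrightarrow> a \<in> I \<Longrightarrow> c \<cdot> (a :: uea) \<in> I"
  by (subst uea_scale_eq_mult) (rule left_ideal_mult)

lemma left_ideal_sum: "left_ideal I \<Longrightarrow> (\<And>i. i \<in> S \<Longrightarrow> f i \<in> I) \<Longrightarrow> sum f S \<in> I"
  by (induction S rule: infinite_finite_induct) (auto intro: left_ideal_0 left_ideal_add)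

lemma left_ideal_scale_iff: "left_ideal I \<Longrightarrow> c \<noteq> 0 \<Longrightarrow> c \<cdot> (a :: uea) \<in> I \<longleftrightarrow> a \<in> I"
  using left_ideal_scale[of I "c \<cdot> a" "inverse c"] by (auto intro: left_ideal_scale)

lemma left_ideal_diff_iff: "left_ideal I \<Longrightarrow> a - b \<in> I \<Longrightarrow> a \<in> I \<longleftrightarrow> b \<in> I"
  using left_ideal_add[of I "a - b" b] left_ideal_diff[of I a "a - b"] by auto

lemma left_ideal_hull_is: "left_ideal (left_ideal hull S)"
  by (rule hull_in) (auto simp: left_ideal_def)

section \<open>The Verma module as a space of polynomials\<close>

text \<open>
  The variables \<open>VL k\<close> and \<open>VM k\<close> stand for \<open>L\<^bsub>-(k+1)\<^esub>\<close> and \<open>M\<^bsub>-(k+1)\<^esub>\<close>. With this shift every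
  natural number is a valid index.
\<close>

datatype nvar = VL nat | VM nat

locale verma =
  fixes hL hM cL cM :: complex
begin

text \<open>
  The character by which the subalgebra of nonnegative modes acts on the highest weight vector.
\<close>

fun weight :: "gen \<Rightarrow> complex" where
  "weight (genL n) = (if n = 0 then hL else 0)"
| "weight (genM n) = (if n = 0 then hM else 0)"
| "weight genCL = cL"
| "weight genCM = cM"

fun val :: "gen \<Rightarrow> nvar pol" where
  "val (genL n) = (if n < 0 then Var (VL (nat (- n - 1))) else Const (weight (genL n)))"
| "val (genM n) = (if n < 0 then Var (VM (nat (- n - 1))) else Const (weight (genM n)))"
| "val genCL = Const cL"
| "val genCM = Const cM"

definition word_val :: "gen list \<Rightarrow> nvar pol" where
  "word_val w = prod_list (map val w)"

abbreviation nf :: "gen list \<Rightarrow> nvar pol" where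
  "nf \<equiv> normal_form word_val"

text \<open>
  The coordinates of a vector of the Verma module: the class of a monomial in Poincare-Birkhoff-Witt
  order is sent to the corresponding commutative monomial.
\<close>

definition \<Phi> :: "uea \<Rightarrow> nvar pol" where
  "\<Phi> = pbw_map word_val"

definition nonneg :: "gen \<Rightarrow> bool" where
  "nonneg g \<longleftrightarrow> gen_class g \<ge> 2"

abbreviation K :: "uea set" where
  "K \<equiv> verma_ideal hL hM cL cM"

lemma \<Phi>_add: "\<Phi> (u + v) = \<Phi> u + \<Phi> v"
  and \<Phi>_diff: "\<Phi> (u - v) = \<Phi> u - \<Phi> v"
  and \<Phi>_scale: "\<Phi> (c \<cdot> u) = Const c * \<Phi> u"
  and \<Phi>_sum: "\<Phi> (sum f S) = (\<Sum>i\<in>S. \<Phi> (f i))"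
  and \<Phi>_word: "\<Phi> (uword w) = nf w"
  by (simp_all add: \<Phi>_def pbw_map_add pbw_map_diff pbw_map_scale pbw_map_sum pbw_map_word)

lemma \<Phi>_0 [simp]: "\<Phi> 0 = 0"
  using \<Phi>_scale[of 0 0] by simp

lemma word_val_simps [simp]:
  "word_val [] = 1" "word_val (g # w) = val g * word_val w" "word_val (u @ w) = word_val u * word_val w"
  by (simp_all add: word_val_def)

lemma \<Phi>_1 [simp]: "\<Phi> 1 = 1"
  using \<Phi>_word[of "[]"] by (simp add: normal_form_sorted)

lemma val_nonneg: "nonneg b \<Longrightarrow> val b = Const (weight b)"
  by (cases b) (auto simp: nonneg_def split: if_splits)

lemma nonneg_mono: "nonneg b \<Longrightarrow> b < x \<Longrightarrow> nonneg x"
  by (auto simp: nonneg_def less_gen_def)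

lemma keys_bracket_nonneg:
  assumes "nonneg x" "nonneg y" "g \<in> Poly_Mapping.keys (w22_bracket x y)"
  shows "nonneg g"
  using assms
  by (cases x; cases y)
     (auto simp: nonneg_def split: if_splits dest!: subsetD[OF Poly_Mapping.keys_add])

lemma bracket_val_nonneg: "nonneg x \<Longrightarrow> nonneg y \<Longrightarrow> bracket_sum val x y = 0"
proof -
  have [simp]: "m + n = 0 \<longleftrightarrow> m = 0 \<and> n = 0" if "\<not> m < 0" "\<not> n < 0" for m n :: int
    using that by auto
  show "nonneg x \<Longrightarrow> nonneg y \<Longrightarrow> bracket_sum val x y = 0"
    by (cases x; cases y) (auto simp: nonneg_def lin_ext_add split: if_splits)
qed

text \<open>
  While a word is being sorted, a nonnegative letter at its right end either stays there or is
  exchanged and merged with other nonnegative letters; the merged terms vanish because the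
  weight is zero on brackets.
\<close>

lemma nf_snoc_nonneg: "nonneg b \<Longrightarrow> nf (w @ [b]) = val b * nf w"
proof -
  have "\<forall>w b. w' = w @ [b] \<longrightarrow> nonneg b \<longrightarrow> nf w' = val b * nf w" for w'
  proof (induction w' rule: word_induct)
    case (sorted w')
    then show ?case
      by (auto simp: normal_form_sorted sorted_append)
  next
    case (descent u x y v)
    show ?case
    proof (intro allI impI)
      fix w b
      assume w: "u @ [x, y] @ v = w @ [b]" and b: "nonneg b"
      show "nf (u @ [x, y] @ v) = val b * nf w"
      proof (cases v rule: rev_cases)
        case (snoc v' b')
        with w have w: "w = u @ [x, y] @ v'" and [simp]: "b' = b" by auto
        have "bracket_sum (\<lambda>g. nf (u @ [g] @ v)) x y = bracket_sum (\<lambda>g. val b * nf (u @ [g] @ v')) x y"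
          using descent(3)[of "u @ [_] @ v"] snoc b
          by (intro arg_cong[where f = "\<lambda>F. bracket_sum F x y"] ext) simp
        moreover have "nf (u @ [y, x] @ v) = val b * nf (u @ [y, x] @ v')"
          using descent(2) snoc b by simp
        ultimately show ?thesis
          using normal_form_swap[of word_val u x y v] normal_form_swap[of word_val u x y v']
          by (simp add: w bracket_sum_mult distrib_left)
      next
        case Nil
        with w have w: "w = u @ [x]" and [simp]: "y = b" by auto
        have x: "nonneg x"
          using nonneg_mono[OF b] descent(1) by simp
        have "bracket_sum (\<lambda>g. nf (u @ [g])) x y = bracket_sum (\<lambda>g. nf u * val g) x y"
          using descent(3)[of "u @ [_]"] keys_bracket_nonneg[OF x b]
          by (intro bracket_sum_cong) (simp add: mult.commute)
        also have "\<dots> = 0"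
          using bracket_val_nonneg[OF x b] by (simp add: bracket_sum_mult)
        finally have "nf (u @ [x, y]) = nf (u @ [y, x])"
          using normal_form_swap[of word_val u x y "[]"] by simp
        also have "\<dots> = val x * nf (u @ [y])"
          using descent(2) x Nil by simp
        also have "\<dots> = val b * nf (u @ [x])"
          using descent(3)[of "u @ [y]"] descent(3)[of "u @ [x]"] x b by (simp add: mult_ac)
        finally show ?thesis by (simp add: w Nil)
      qed
    qed
  qed
  then show "nonneg b \<Longrightarrow> nf (w @ [b]) = val b * nf w"
    by blast
qed

lemma \<Phi>_mult_nonneg: "nonneg b \<Longrightarrow> \<Phi> (u * uea_gen b) = val b * \<Phi> u"
proof (induction u rule: uea_induct)
  case (word c w)
  have "uword w * uea_gen b = uword (w @ [b])" by simp
  with word show ?case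
    by (simp add: \<Phi>_scale \<Phi>_word nf_snoc_nonneg mult_ac del: uword_simps)
qed (simp add: distrib_left distrib_right \<Phi>_add)

lemma left_ideal_K: "left_ideal K"
  unfolding verma_ideal_def by (rule left_ideal_hull_is)

lemma K_generators:
  "n > 0 \<Longrightarrow> U_L n \<in> K" "n > 0 \<Longrightarrow> U_M n \<in> K"
  "U_L 0 - hL \<cdot> 1 \<in> K" "U_M 0 - hM \<cdot> 1 \<in> K" "U_CL - cL \<cdot> 1 \<in> K" "U_CM - cM \<cdot> 1 \<in> K"
  unfolding verma_ideal_def by (rule hull_inc, auto)+

lemma K_least:
  assumes I: "left_ideal I" and gens: "\<And>b. nonneg b \<Longrightarrow> uea_gen b - weight b \<cdot> 1 \<in> I"
  shows "K \<subseteq> I"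
proof -
  have "U_L n \<in> I" "U_M n \<in> I" if "n > 0" for n
    using gens[of "genL n"] gens[of "genM n"] that by (simp_all add: nonneg_def)
  moreover have "U_L 0 - hL \<cdot> 1 \<in> I" "U_M 0 - hM \<cdot> 1 \<in> I" "U_CL - cL \<cdot> 1 \<in> I" "U_CM - cM \<cdot> 1 \<in> I"
    using gens[of "genL 0"] gens[of "genM 0"] gens[of genCL] gens[of genCM] by (simp_all add: nonneg_def)
  ultimately show ?thesis
    unfolding verma_ideal_def using I by (intro hull_minimal) auto
qed

lemma K_nonneg: "nonneg b \<Longrightarrow> uea_gen b - weight b \<cdot> 1 \<in> K"
  by (cases b) (auto simp: nonneg_def K_generators split: if_splits)

lemma \<Phi>_K:
  assumes "u \<in> K"
  shows "\<Phi> u = 0"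
proof -
  let ?I = "{u. \<forall>t. \<Phi> (t * u) = 0}"
  have "left_ideal ?I"
    by (auto simp: left_ideal_def distrib_left \<Phi>_add mult.assoc [symmetric])
  moreover have "uea_gen b - weight b \<cdot> 1 \<in> ?I" if "nonneg b" for b
    using that by (simp add: right_diff_distrib \<Phi>_diff \<Phi>_mult_nonneg \<Phi>_scale val_nonneg)
  ultimately have "K \<subseteq> ?I"
    by (rule K_least)
  with assms have "\<Phi> (1 * u) = 0" by blast
  then show ?thesis by simp
qed

subsection \<open>The inverse of the coordinate map\<close>

fun var_gen :: "nvar \<Rightarrow> gen" where
  "var_gen (VL k) = genL (- int k - 1)"
| "var_gen (VM k) = genM (- int k - 1)"

definition mono_word :: "nvar multiset \<Rightarrow> gen list" where
  "mono_word \<mu> = sorted_list_of_multiset (image_mset var_gen \<mu>)"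

text \<open>
  The section of \<open>\<Phi>\<close> that writes the monomials back in Poincare-Birkhoff-Witt order.
\<close>

definition lift :: "nvar pol \<Rightarrow> uea" where
  "lift = uea_ext (\<lambda>\<mu>. uword (mono_word \<mu>))"

lemma lift_add: "lift (f + g) = lift f + lift g"
  and lift_single [simp]: "lift (Poly_Mapping.single \<mu> c) = c \<cdot> uword (mono_word \<mu>)"
  and lift_0 [simp]: "lift 0 = 0"
  by (simp_all add: lift_def uea_ext_add)

lemma lift_sum: "lift (sum f S) = (\<Sum>i\<in>S. lift (f i))"
  by (induction S rule: infinite_finite_induct) (simp_all add: lift_add)

lemma lift_Const [simp]: "lift (Const c) = c \<cdot> 1"
  by (simp add: Const_def mono_word_def)

lemma lift_1 [simp]: "lift 1 = 1"
  using lift_Const[of 1] by (simp del: lift_Const)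

lemma lift_Const_mult: "lift (Const c * f) = c \<cdot> lift f"
proof (induction f rule: single_induct)
  case (single \<mu> d)
  then show ?case by (simp add: Const_def mult_single)
qed (simp add: distrib_left lift_add uea_scale_add_right)

lemma val_var_gen [simp]: "val (var_gen v) = Var v"
  by (cases v) simp_all

lemma not_nonneg_var_gen [simp]: "\<not> nonneg (var_gen v)"
  by (cases v) (simp_all add: nonneg_def)

lemma neg_var_gen: "\<not> nonneg g \<Longrightarrow> \<exists>v. g = var_gen v"
proof (cases g)
  case (genL n)
  then show "\<not> nonneg g \<Longrightarrow> \<exists>v. g = var_gen v"
    by (intro exI[of _ "VL (nat (- n - 1))"]) (auto simp: nonneg_def split: if_splits)
next
  case (genM n)
  then show "\<not> nonneg g \<Longrightarrow> \<exists>v. g = var_gen v"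
    by (intro exI[of _ "VM (nat (- n - 1))"]) (auto simp: nonneg_def split: if_splits)
qed (auto simp: nonneg_def)

lemma image_mset_exists: "(\<And>g. g \<in># M \<Longrightarrow> \<exists>v. g = f v) \<Longrightarrow> \<exists>\<mu>. M = image_mset f \<mu>"
proof (induction M)
  case (add g M)
  then obtain \<mu> v where "M = image_mset f \<mu>" "g = f v" by (metis union_single_eq_member insert_iff set_mset_add_mset_insert)
  then have "add_mset g M = image_mset f (add_mset v \<mu>)" by simp
  then show ?case ..
qed simp

lemma word_val_mset: "word_val w = prod_mset (image_mset val (mset w))"
  by (induction w) (simp_all add: mult.commute)

lemma prod_mset_Var: "prod_mset (image_mset Var \<mu>) = Poly_Mapping.single \<mu> 1"
  by (induction \<mu>) (simp_all add: Var_mult_single)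

lemma word_val_mono_word: "word_val (mono_word \<mu>) = Poly_Mapping.single \<mu> 1"
  by (simp add: word_val_mset mono_word_def image_mset.compositionality comp_def prod_mset_Var)

lemma \<Phi>_lift [simp]: "\<Phi> (lift f) = f"
proof (induction f rule: single_induct)
  case (single \<mu> c)
  have "sorted (mono_word \<mu>)" by (simp add: mono_word_def)
  then show ?case
    by (simp add: \<Phi>_scale \<Phi>_word normal_form_sorted word_val_mono_word Const_def mult_single)
qed (simp add: lift_add \<Phi>_add)

text \<open>
  In a sorted word the nonnegative letters come last, so they can be replaced by their weights one
  after the other.
\<close>

lemma lift_\<Phi>_sorted:
  assumes "sorted w"
  shows "uword w - lift (\<Phi> (uword w)) \<in> K"
  using assms
proof (induction w rule: rev_induct)
  case Nil
  show ?case by (simp add: left_ideal_0[OF left_ideal_K])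
next
  case (snoc b w)
  show ?case
  proof (cases "nonneg b")
    case True
    have "uword w * (uea_gen b - weight b \<cdot> 1) \<in> K"
      using K_nonneg[OF True] left_ideal_K by (rule left_ideal_mult[rotated])
    moreover have "weight b \<cdot> (uword w - lift (\<Phi> (uword w))) \<in> K"
      using snoc by (intro left_ideal_scale left_ideal_K) (simp add: sorted_append)
    ultimately have "uword w * (uea_gen b - weight b \<cdot> 1) + weight b \<cdot> (uword w - lift (\<Phi> (uword w))) \<in> K"
      by (rule left_ideal_add[OF left_ideal_K])
    moreover have "lift (\<Phi> (uword (w @ [b]))) = weight b \<cdot> lift (\<Phi> (uword w))"
      using \<Phi>_mult_nonneg[OF True, of "uword w"] True by (simp add: val_nonneg lift_Const_mult)
    ultimately show ?thesis
      by (simp add: algebra_simps uea_scale_diff_right)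
  next
    case False
    have "\<not> nonneg g" if "g \<in> set (w @ [b])" for g
    proof -
      have "g \<le> b"
        using that snoc(2) by (auto simp: sorted_append)
      then show ?thesis
        using False nonneg_mono[of g b] by (auto simp: order_le_less[of g b])
    qed
    then have "\<exists>\<mu>. mset (w @ [b]) = image_mset var_gen \<mu>"
      using image_mset_exists by (metis neg_var_gen set_mset_mset)
    then obtain \<mu> where \<mu>: "mset (w @ [b]) = image_mset var_gen \<mu>" ..
    then have "mono_word \<mu> = w @ [b]"
      using snoc(2) by (metis mono_word_def sorted_list_of_multiset_mset sorted_sort_id)
    then have "uword (w @ [b]) = lift (Poly_Mapping.single \<mu> 1)"
      by simp
    then show ?thesis
      by (simp only: \<Phi>_lift diff_self left_ideal_0[OF left_ideal_K])
  qed
qed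

lemma lift_\<Phi>: "u - lift (\<Phi> u) \<in> K"
proof (induction u rule: uea_induct)
  case (add u v)
  from left_ideal_add[OF left_ideal_K this] show ?case
    by (simp add: \<Phi>_add lift_add algebra_simps)
next
  case (word c w)
  have "uword w - lift (\<Phi> (uword w)) \<in> K"
  proof (induction w rule: word_induct)
    case (descent u x y v)
    have ext: "uword (u @ [x, y] @ v) = uword (u @ [y, x] @ v) +
        (\<Sum>g\<in>Poly_Mapping.keys (w22_bracket x y). Poly_Mapping.lookup (w22_bracket x y) g \<cdot> uword (u @ [g] @ v))"
    proof -
      have "uword (u @ [x, y] @ v) = uword u * (uea_gen x * uea_gen y) * uword v"
        by (simp add: mult.assoc)
      then show ?thesis
        by (simp add: uea_bracket[of x y] uea_ext_def distrib_left distrib_right sum_distrib_left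
            sum_distrib_right mult.assoc)
    qed
    have "uword (u @ [g] @ v) - lift (\<Phi> (uword (u @ [g] @ v))) \<in> K" for g
      by (rule descent(3)) simp
    then have "(\<Sum>g\<in>Poly_Mapping.keys (w22_bracket x y). Poly_Mapping.lookup (w22_bracket x y) g \<cdot>
        (uword (u @ [g] @ v) - lift (\<Phi> (uword (u @ [g] @ v))))) \<in> K"
      by (intro left_ideal_sum left_ideal_scale left_ideal_K)
    from left_ideal_add[OF left_ideal_K descent(2) this] show ?case
      unfolding ext \<Phi>_add lift_add \<Phi>_sum lift_sum \<Phi>_scale lift_Const_mult
      by (simp only: uea_scale_diff_right sum_subtractf) (simp only: algebra_simps)
  qed (rule lift_\<Phi>_sorted)
  from left_ideal_scale[OF left_ideal_K this, of c] show ?case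
    by (simp add: \<Phi>_scale lift_Const_mult uea_scale_diff_right)
qed

text \<open>
  Hence \<open>\<Phi>\<close> identifies the Verma module with the polynomial ring.
\<close>

theorem mem_K_iff: "u \<in> K \<longleftrightarrow> \<Phi> u = 0"
  using lift_\<Phi>[of u] \<Phi>_K[of u] by auto

end

section \<open>Level and degree in the L-variables\<close>

text \<open>
  The level is the \<open>L\<^sub>0\<close>-weight relative to \<open>h\<^sub>L\<close>. The degree \<open>ldeg\<close> counts the factors \<open>L\<close>; it
  defines the filtration \<open>filt\<close>, for which the operators of the enveloping algebra have
  commutative symbols. The polynomials of \<open>ldeg\<close> zero are those in the \<open>M\<close>-variables only.
\<close>

fun level :: "nvar \<Rightarrow> nat" where
  "level (VL k) = Suc k"
| "level (VM k) = Suc k"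

fun ldeg :: "nvar \<Rightarrow> nat" where
  "ldeg (VL k) = 1"
| "ldeg (VM k) = 0"

abbreviation filt :: "nat \<Rightarrow> nvar pol set" where
  "filt \<equiv> wdeg_lt ldeg"

abbreviation M_pol :: "nvar pol \<Rightarrow> bool" where
  "M_pol f \<equiv> homog ldeg 0 f"

fun num_L :: "gen list \<Rightarrow> nat" where
  "num_L [] = 0"
| "num_L (genL n # w) = Suc (num_L w)"
| "num_L (g # w) = num_L w"

lemma num_L_append [simp]: "num_L (u @ w) = num_L u + num_L w"
  by (induction u rule: num_L.induct) simp_all

lemma num_L_mset: "num_L w = size (filter_mset (\<lambda>g. num_L [g] = 1) (mset w))"
  by (induction w rule: num_L.induct) simp_all

lemma num_L_swap: "num_L (u @ [x, y] @ v) = num_L (u @ [y, x] @ v)"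
  by (cases x; cases y) simp_all

text \<open>
  This is why letters commute up to lower filtration: a bracket contains fewer \<open>L\<close>'s than its two
  arguments together.
\<close>

lemma keys_bracket_num_L:
  "g \<in> Poly_Mapping.keys (w22_bracket x y) \<Longrightarrow> Suc (num_L [g]) \<le> num_L [x, y]"
  by (cases x; cases y) (auto split: if_splits dest!: subsetD[OF Poly_Mapping.keys_add])

lemma lin_ext_wdeg_lt:
  "(\<And>g. g \<in> Poly_Mapping.keys p \<Longrightarrow> F g \<in> wdeg_lt w k) \<Longrightarrow> lin_ext F p \<in> wdeg_lt w k"
  unfolding lin_ext_def by (intro wdeg_lt_sum wdeg_lt_Const_mult)

lemma M_pol_induct [consumes 1, case_names Const add Var]:
  assumes "M_pol f"
    and Const: "\<And>c. P (Const c)"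
    and add: "\<And>f g. M_pol f \<Longrightarrow> M_pol g \<Longrightarrow> P f \<Longrightarrow> P g \<Longrightarrow> P (f + g)"
    and Var: "\<And>k f. M_pol f \<Longrightarrow> P f \<Longrightarrow> P (Var (VM k) * f)"
  shows "P f"
proof -
  have single: "M_pol (Poly_Mapping.single \<mu> c) \<and> P (Poly_Mapping.single \<mu> c)"
    if "wdeg ldeg \<mu> = 0" for \<mu> c
    using that
  proof (induction \<mu>)
    case empty
    show ?case using Const[of c] homog_Const[of ldeg c] by (simp add: Const_def)
  next
    case (add v \<mu>)
    then obtain k where v: "v = VM k"
      by (cases v) simp_all
    with add Var[of "Poly_Mapping.single \<mu> c" k] show ?case
      using homog_mult[OF homog_Var[of ldeg "VM k"], of 0 "Poly_Mapping.single \<mu> c"]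
      by (simp add: Var_mult_single)
  qed
  have "M_pol (\<Sum>\<mu>\<in>S. Poly_Mapping.single \<mu> (Poly_Mapping.lookup f \<mu>)) \<and>
      P (\<Sum>\<mu>\<in>S. Poly_Mapping.single \<mu> (Poly_Mapping.lookup f \<mu>))"
    if "S \<subseteq> Poly_Mapping.keys f" for S
    using finite_subset[OF that finite_keys] that
  proof (induction S)
    case empty
    show ?case using Const[of 0] by simp
  next
    case (insert \<mu> S)
    then show ?case
      using single[of \<mu> "Poly_Mapping.lookup f \<mu>"] assms(1)
      by (auto simp: homog_def[of _ _ f] intro: homog_add add)
  qed
  from this[of "Poly_Mapping.keys f"] show ?thesis
    by (simp flip: sum_singles)
qed

lemma M_pol_Var [simp]: "M_pol (Var (VM k))"
  using homog_Var[of ldeg "VM k"] by simp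

lemma M_pol_mult: "M_pol f \<Longrightarrow> M_pol g \<Longrightarrow> M_pol (f * g)"
  using homog_mult[of ldeg 0 f 0 g] by simp

lemma M_pol_of_int [simp]: "M_pol (of_int n)"
  by (metis Const_of_int homog_Const)

lemma M_pol_1 [simp]: "M_pol 1"
  by (metis Const_1 homog_Const)

lemma filt_M_pol_mult: "M_pol a \<Longrightarrow> f \<in> filt k \<Longrightarrow> a * f \<in> filt k"
  by (rule wdeg_lt_mult0) (simp_all flip: homog_0_iff_wdeg_lt)

context verma
begin

lemma filt_word_val: "word_val w \<in> filt (Suc (num_L w))"
proof (induction w)
  case (Cons g w)
  have "val g \<in> filt (Suc (num_L [g]))"
    by (cases g) (auto intro: wdeg_lt_Var)
  from wdeg_lt_mult[OF this Cons] show ?case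
    using num_L_append[of "[g]" w] by simp
qed (use wdeg_lt_Const[of 1] in simp)

text \<open>
  The symbol of a word is the product of the values of its letters: each swap made while sorting
  leaves this product unchanged and costs only a bracket, with fewer \<open>L\<close>'s.
\<close>

lemma nf_leading: "nf w - word_val w \<in> filt (num_L w)"
proof (induction w rule: word_induct)
  case (sorted w)
  then show ?case by (simp add: normal_form_sorted)
next
  case (descent u x y v)
  have "bracket_sum (\<lambda>g. nf (u @ [g] @ v)) x y \<in> filt (num_L (u @ [x, y] @ v))"
  proof (rule lin_ext_wdeg_lt)
    fix g
    assume g: "g \<in> Poly_Mapping.keys (w22_bracket x y)"
    let ?w = "u @ [g] @ v"
    have "nf ?w - word_val ?w \<in> filt (Suc (num_L ?w))"
      by (rule wdeg_lt_mono[OF descent(3)]) simp_all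
    from wdeg_lt_add[OF this filt_word_val] have "nf ?w \<in> filt (Suc (num_L ?w))"
      by simp
    moreover have "Suc (num_L ?w) \<le> num_L (u @ [x, y] @ v)"
      using keys_bracket_num_L[OF g] num_L_append[of "[g]" v] num_L_append[of "[x, y]" v] by simp
    ultimately show "nf ?w \<in> filt (num_L (u @ [x, y] @ v))"
      by (rule wdeg_lt_mono)
  qed
  moreover have "nf (u @ [y, x] @ v) - word_val (u @ [y, x] @ v) \<in> filt (num_L (u @ [x, y] @ v))"
    using descent(2) num_L_swap[of u x y v] by simp
  moreover have "word_val (u @ [y, x] @ v) = word_val (u @ [x, y] @ v)"
    by (simp add: mult_ac)
  ultimately have "nf (u @ [y, x] @ v) - word_val (u @ [x, y] @ v) +
      bracket_sum (\<lambda>g. nf (u @ [g] @ v)) x y \<in> filt (num_L (u @ [x, y] @ v))"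
    by (metis wdeg_lt_add)
  then show ?case
    by (simp only: normal_form_swap[of word_val u x y v] diff_add_eq)
qed

text \<open>
  The value of \<open>[M\<^sub>n, L\<^bsub>-(k+1)\<^esub>]\<close>, and of \<open>[L\<^sub>n, M\<^bsub>-(k+1)\<^esub>]\<close>, when \<open>M\<^sub>0\<close> acts as \<open>h\<^sub>M\<close>, the centre as
  \<open>c\<^sub>M\<close> and the positive modes as \<open>0\<close>. Both brackets give the same element, which is why \<open>D\<close> and
  \<open>E\<close> below have the same coefficients.
\<close>

definition coef :: "int \<Rightarrow> nat \<Rightarrow> nvar pol" where
  "coef n k = of_int (n + int k + 1) * val (genM (n - int k - 1)) +
     (if n = int k + 1 then of_int (n ^ 3 - n) * (Const (1/12) * Const cM) else 0)"

lemma bracket_val_M_L: "bracket_sum val (genM n) (genL (- int k - 1)) = coef n k"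
proof -
  have *: "n + (- int k - 1) = 0 \<longleftrightarrow> n = int k + 1" "n - (- int k - 1) = n + int k + 1"
    "n + (- int k - 1) = n - int k - 1"
    by auto
  show ?thesis
    unfolding bracket_sum_simps coef_def * val.simps by simp_all
qed

lemma M_pol_val_M: "M_pol (val (genM n))"
  by simp

lemma M_pol_coef: "M_pol (coef n k)"
proof -
  have "M_pol (of_int (n ^ 3 - n) * (Const (1/12) * Const cM))"
    by (intro M_pol_mult M_pol_of_int homog_Const)
  moreover have "M_pol (of_int (n + int k + 1) * val (genM (n - int k - 1)))"
    by (intro M_pol_mult M_pol_of_int M_pol_val_M)
  ultimately show ?thesis
    unfolding coef_def by (intro homog_add) (simp_all only: homog_0 split: if_split, blast?)
qed

fun D_coef :: "int \<Rightarrow> nvar \<Rightarrow> nvar pol" where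
  "D_coef n (VL k) = coef n k"
| "D_coef n (VM k) = 0"

fun E_coef :: "int \<Rightarrow> nvar \<Rightarrow> nvar pol" where
  "E_coef n (VL k) = 0"
| "E_coef n (VM k) = coef n k"

abbreviation D :: "int \<Rightarrow> nvar pol \<Rightarrow> nvar pol" where
  "D n \<equiv> der (D_coef n)"

abbreviation E :: "int \<Rightarrow> nvar pol \<Rightarrow> nvar pol" where
  "E n \<equiv> der (E_coef n)"

text \<open>
  Move \<open>M\<^sub>n\<close> to the right end, where it acts by its weight. Each commutator with an \<open>L\<close> on the way
  replaces that letter by an \<open>M\<close>, which lowers the filtration by one and contributes one term of the
  derivation \<open>D n\<close>; all corrections to the resulting symbols are lower by two.
\<close>

lemma nf_M:
  assumes "n \<ge> 0" "\<forall>g\<in>set w. \<not> nonneg g"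
  shows "nf (u @ genM n # w) - (Const (weight (genM n)) * nf (u @ w) + word_val u * D n (word_val w))
    \<in> filt (num_L (u @ w) - 1)"
  using assms(2)
proof (induction w arbitrary: u)
  case Nil
  have "nonneg (genM n)"
    using assms(1) by (simp add: nonneg_def)
  then show ?case
    using nf_snoc_nonneg[of "genM n" u] assms(1) by simp
next
  case (Cons g w)
  let ?x = "genM n" and ?k = "num_L (u @ g # w) - 1"
  have swap: "nf (u @ ?x # g # w) = nf (u @ g # ?x # w) + bracket_sum (\<lambda>h. nf (u @ [h] @ w)) ?x g"
    using normal_form_swap[of word_val u ?x g w] by simp
  have IH: "nf (u @ g # ?x # w) - (Const (weight ?x) * nf (u @ g # w) +
      word_val u * val g * D n (word_val w)) \<in> filt ?k"
    using Cons.IH[of "u @ [g]"] Cons.prems by simp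
  have M_bracket: "bracket_sum (\<lambda>h. nf (u @ [h] @ w)) ?x g - word_val u * D n (val g) * word_val w \<in> filt ?k"
  proof -
    obtain v where g: "g = var_gen v"
      using neg_var_gen Cons.prems by auto
    show ?thesis
    proof (cases v)
      case (VL k)
      have "bracket_sum (\<lambda>h. nf (u @ [h] @ w)) ?x g - word_val u * D n (val g) * word_val w =
          bracket_sum (\<lambda>h. nf (u @ [h] @ w) - word_val (u @ [h] @ w)) ?x g"
      proof -
        have "bracket_sum (\<lambda>h. word_val (u @ [h] @ w)) ?x g = word_val u * word_val w * bracket_sum val ?x g"
          by (simp add: bracket_sum_mult[symmetric] mult_ac del: bracket_sum_simps w22_bracket.simps)
        also have "bracket_sum val ?x g = D n (val g)"
          using bracket_val_M_L[of n k] VL g by (simp del: val.simps w22_bracket.simps var_gen.simps add: val_var_gen var_gen.simps[symmetric])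
        finally show ?thesis
          by (simp add: bracket_sum_diff mult_ac del: w22_bracket.simps)
      qed
      also have "\<dots> \<in> filt ?k"
      proof (rule lin_ext_wdeg_lt)
        fix h
        assume "h \<in> Poly_Mapping.keys (w22_bracket ?x g)"
        from keys_bracket_num_L[OF this] have "num_L (u @ [h] @ w) \<le> ?k"
          using VL g num_L_append[of "[h]" w] by simp
        with nf_leading show "nf (u @ [h] @ w) - word_val (u @ [h] @ w) \<in> filt ?k"
          by (rule wdeg_lt_mono)
      qed
      finally show ?thesis .
    next
      case (VM k)
      then show ?thesis
        using g by simp
    qed
  qed
  have "D n (word_val (g # w)) = D n (val g) * word_val w + val g * D n (word_val w)"
    by (simp add: der_mult)
  then have eq: "nf (u @ ?x # g # w) - (Const (weight ?x) * nf (u @ g # w) + word_val u * D n (word_val (g # w))) =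
      (nf (u @ g # ?x # w) - (Const (weight ?x) * nf (u @ g # w) + word_val u * val g * D n (word_val w))) +
      (bracket_sum (\<lambda>h. nf (u @ [h] @ w)) ?x g - word_val u * D n (val g) * word_val w)"
    by (simp only: swap distrib_left mult.assoc) (simp add: algebra_simps del: w22_bracket.simps)
  from wdeg_lt_add[OF IH M_bracket] show ?case
    by (simp only: eq)
qed

lemma num_L_mono_word: "num_L (mono_word \<mu>) = wdeg ldeg \<mu>"
proof -
  have "num_L [var_gen v] = ldeg v" for v
    by (cases v) simp_all
  then have "size (filter_mset (\<lambda>g. num_L [g] = 1) (image_mset var_gen \<mu>)) = wdeg ldeg \<mu>"
    by (induction \<mu>) (auto, (metis One_nat_def ldeg.simps nvar.exhaust)+)
  then show ?thesis
    by (subst num_L_mset) (simp add: mono_word_def)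
qed

lemma mono_word_neg: "g \<in> set (mono_word \<mu>) \<Longrightarrow> \<not> nonneg g"
  by (auto simp: mono_word_def)

lemma \<Phi>_cong_K: "u - v \<in> K \<Longrightarrow> \<Phi> (x * u) = \<Phi> (x * v)"
  using left_ideal_mult[OF left_ideal_K, of "u - v" x] by (simp add: mem_K_iff right_diff_distrib \<Phi>_diff)

lemma \<Phi>_mult_lift: "\<Phi> (x * u) = \<Phi> (x * lift (\<Phi> u))"
  by (rule \<Phi>_cong_K) (rule lift_\<Phi>)

lemma \<Phi>_mult_expand:
  "\<Phi> (x * u) = (\<Sum>\<mu>\<in>Poly_Mapping.keys (\<Phi> u).
      Const (Poly_Mapping.lookup (\<Phi> u) \<mu>) * \<Phi> (x * uword (mono_word \<mu>)))"
  by (subst \<Phi>_mult_lift) (simp add: lift_def uea_ext_def sum_distrib_left \<Phi>_sum \<Phi>_scale)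

lemma sum_singles_Const:
  "(f :: nvar pol) = (\<Sum>\<mu>\<in>Poly_Mapping.keys f. Const (Poly_Mapping.lookup f \<mu>) * Poly_Mapping.single \<mu> 1)"
proof -
  have "Const c * Poly_Mapping.single \<mu> 1 = Poly_Mapping.single \<mu> c" for c and \<mu> :: "nvar multiset"
    by (simp add: Const_def mult_single)
  then show ?thesis by (simp flip: sum_singles)
qed

lemma \<Phi>_mult_leading:
  assumes "\<Phi> u \<in> filt k"
    and "\<And>\<mu>. wdeg ldeg \<mu> < k \<Longrightarrow> \<Phi> (x * uword (mono_word \<mu>)) - T (Poly_Mapping.single \<mu> 1) \<in> filt l"
    and "\<And>f g. T (f + g) = T f + T g" and "\<And>c f. T (Const c * f) = Const c * T f"
  shows "\<Phi> (x * u) - T (\<Phi> u) \<in> filt l"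
proof -
  have T_0: "T 0 = 0"
    using assms(4)[of 0 0] by simp
  have T_sum: "T (sum F S) = (\<Sum>i\<in>S. T (F i))" for F and S :: "nvar multiset set"
    by (induction S rule: infinite_finite_induct) (simp_all add: assms(3) T_0)
  have "\<Phi> (x * u) - T (\<Phi> u) = (\<Sum>\<mu>\<in>Poly_Mapping.keys (\<Phi> u). Const (Poly_Mapping.lookup (\<Phi> u) \<mu>) *
      (\<Phi> (x * uword (mono_word \<mu>)) - T (Poly_Mapping.single \<mu> 1)))"
    by (subst (2) sum_singles_Const, subst \<Phi>_mult_expand)
       (simp add: T_sum assms(4) right_diff_distrib sum_subtractf)
  also have "\<dots> \<in> filt l"
    using assms(1) by (intro wdeg_lt_sum wdeg_lt_Const_mult assms(2)) (simp add: wdeg_lt_def)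
  finally show ?thesis .
qed

lemma \<Phi>_M_leading:
  assumes "n \<ge> 0" "\<Phi> u \<in> filt (Suc k)"
  shows "\<Phi> (U_M n * u) - (Const (weight (genM n)) * \<Phi> u + D n (\<Phi> u)) \<in> filt (k - 1)"
proof (rule \<Phi>_mult_leading[OF assms(2), where T = "\<lambda>f. Const (weight (genM n)) * f + D n f"])
  fix \<mu> :: "nvar multiset"
  assume "wdeg ldeg \<mu> < Suc k"
  then have le: "num_L ([] @ mono_word \<mu>) - 1 \<le> k - 1"
    by (simp add: num_L_mono_word)
  have "nf (mono_word \<mu>) = Poly_Mapping.single \<mu> 1"
    by (simp add: normal_form_sorted mono_word_def flip: word_val_mono_word)
  then show "\<Phi> (U_M n * uword (mono_word \<mu>)) - (Const (weight (genM n)) * Poly_Mapping.single \<mu> 1 +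
      D n (Poly_Mapping.single \<mu> 1)) \<in> filt (k - 1)"
    using wdeg_lt_mono[OF nf_M[OF assms(1), of "mono_word \<mu>" "[]"] le] mono_word_neg
      \<Phi>_word[of "genM n # mono_word \<mu>"]
    by (simp add: word_val_mono_word del: weight.simps)
qed (simp_all add: der_add der_mult distrib_left mult_ac)

lemma \<Phi>_var_leading:
  assumes "\<Phi> u \<in> filt (Suc k)"
  shows "\<Phi> (uea_gen (var_gen v) * u) - Var v * \<Phi> u \<in> filt (ldeg v + k)"
proof (rule \<Phi>_mult_leading[OF assms, where T = "\<lambda>f. Var v * f"])
  fix \<mu> :: "nvar multiset"
  assume "wdeg ldeg \<mu> < Suc k"
  moreover have "num_L [var_gen v] = ldeg v"
    by (cases v) simp_all
  ultimately have le: "num_L (var_gen v # mono_word \<mu>) \<le> ldeg v + k"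
    using num_L_append[of "[var_gen v]" "mono_word \<mu>"] by (simp add: num_L_mono_word)
  show "\<Phi> (uea_gen (var_gen v) * uword (mono_word \<mu>)) - Var v * Poly_Mapping.single \<mu> 1 \<in> filt (ldeg v + k)"
    using wdeg_lt_mono[OF nf_leading le] \<Phi>_word[of "var_gen v # mono_word \<mu>"]
    by (simp add: word_val_mono_word)
qed (simp_all add: distrib_left mult_ac)

subsection \<open>The action of L0\<close>

text \<open>
  \<open>y\<close> has weight \<open>t\<close> under the adjoint action of \<open>L\<^sub>0\<close> (raising the level by \<open>t\<close>).
\<close>

definition ad_level :: "int \<Rightarrow> uea \<Rightarrow> bool" where
  "ad_level t y \<longleftrightarrow> U_L 0 * y = y * U_L 0 + of_int t \<cdot> y"

lemma ad_level_1 [simp]: "ad_level 0 1"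
  by (simp add: ad_level_def)

lemma ad_level_mult:
  assumes "ad_level s x" "ad_level t y"
  shows "ad_level (s + t) (x * y)"
proof -
  have "U_L 0 * (x * y) = (x * U_L 0 + of_int s \<cdot> x) * y"
    using assms(1) by (simp add: ad_level_def mult.assoc [symmetric])
  also have "\<dots> = x * (y * U_L 0 + of_int t \<cdot> y) + of_int s \<cdot> (x * y)"
    using assms(2) by (simp add: ad_level_def distrib_right mult.assoc)
  finally show ?thesis
    by (simp add: ad_level_def distrib_left uea_scale_add_left mult.assoc add_ac)
qed

lemma ad_level_add: "ad_level t x \<Longrightarrow> ad_level t y \<Longrightarrow> ad_level t (x + y)"
  by (simp add: ad_level_def distrib_left distrib_right uea_scale_add_right add_ac)

lemma ad_level_scale: "ad_level t x \<Longrightarrow> ad_level t (c \<cdot> x)"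
  by (simp add: ad_level_def uea_scale_add_right mult.commute)

lemma ad_level_0 [simp]: "ad_level t 0"
  by (simp add: ad_level_def)

lemma ad_level_sum: "(\<And>i. i \<in> S \<Longrightarrow> ad_level t (f i)) \<Longrightarrow> ad_level t (sum f S)"
  by (induction S rule: infinite_finite_induct) (auto intro: ad_level_add)

lemma ad_level_L: "ad_level (- n) (U_L n)"
  and ad_level_M: "ad_level (- n) (U_M n)"
  by (simp_all add: ad_level_def uea_LL[of 0 n] uea_LM[of 0 n])

lemma ad_level_word:
  "mset w = image_mset var_gen \<mu> \<Longrightarrow> ad_level (int (wdeg level \<mu>)) (uword w)"
proof (induction w arbitrary: \<mu>)
  case (Cons g w)
  then obtain v \<nu> where \<nu>: "\<mu> = add_mset v \<nu>" "g = var_gen v" "mset w = image_mset var_gen \<nu>"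
    using msed_map_invR[of var_gen \<mu> g "mset w"] by auto
  have "ad_level (int (level v)) (uea_gen g)"
  proof (cases v)
    case (VL k)
    then show ?thesis
      using ad_level_L[of "- int k - 1"] by (simp add: \<nu>(2) add.commute)
  next
    case (VM k)
    then show ?thesis
      using ad_level_M[of "- int k - 1"] by (simp add: \<nu>(2) add.commute)
  qed
  from ad_level_mult[OF this Cons.IH[OF \<nu>(3)]] show ?case
    by (simp add: \<nu>(1))
qed simp

lemma ad_level_lift:
  assumes "homog level d f"
  shows "ad_level d (lift f)"
  unfolding lift_def uea_ext_def
proof (intro ad_level_sum ad_level_scale)
  fix \<mu>
  assume "\<mu> \<in> Poly_Mapping.keys f"
  then show "ad_level d (uword (mono_word \<mu>))"
    using ad_level_word[of "mono_word \<mu>" \<mu>] assms by (simp add: mono_word_def homog_def)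
qed

lemma lookup_\<Phi>_L0:
  "Poly_Mapping.lookup (\<Phi> (U_L 0 * u)) \<mu> = (hL + of_nat (wdeg level \<mu>)) * Poly_Mapping.lookup (\<Phi> u) \<mu>"
proof -
  have *: "\<Phi> (U_L 0 * uword (mono_word \<nu>)) = Const (hL + of_nat (wdeg level \<nu>)) * Poly_Mapping.single \<nu> 1" for \<nu>
  proof -
    have "ad_level (int (wdeg level \<nu>)) (uword (mono_word \<nu>))"
      by (rule ad_level_word) (simp add: mono_word_def)
    moreover have "\<Phi> (uword (mono_word \<nu>)) = Poly_Mapping.single \<nu> 1"
      using \<Phi>_lift[of "Poly_Mapping.single \<nu> 1"] by simp
    moreover have "nonneg (genL 0)"
      by (simp add: nonneg_def)
    ultimately show ?thesis
      by (simp add: ad_level_def \<Phi>_add \<Phi>_scale \<Phi>_mult_nonneg Const_add distrib_right)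
  qed
  have "Poly_Mapping.lookup (\<Phi> (U_L 0 * u)) \<mu> = (\<Sum>\<nu>\<in>Poly_Mapping.keys (\<Phi> u).
      Poly_Mapping.lookup (\<Phi> u) \<nu> * ((hL + of_nat (wdeg level \<nu>)) * Poly_Mapping.lookup (Poly_Mapping.single \<nu> 1) \<mu>))"
    by (subst \<Phi>_mult_expand) (simp add: Poly_Mapping.lookup_sum *)
  also have "\<dots> = (\<Sum>\<nu>\<in>Poly_Mapping.keys (\<Phi> u). if \<nu> = \<mu> then
      (hL + of_nat (wdeg level \<mu>)) * Poly_Mapping.lookup (\<Phi> u) \<mu> else 0)"
    by (rule sum.cong) (auto simp: Poly_Mapping.lookup_single when_def)
  also have "\<dots> = (hL + of_nat (wdeg level \<mu>)) * Poly_Mapping.lookup (\<Phi> u) \<mu>"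
    by (simp add: in_keys_iff)
  finally show ?thesis .
qed

lemma L0_homog:
  assumes "homog level d (\<Phi> u)"
  shows "U_L 0 * u - (hL + of_int d) \<cdot> u \<in> K"
proof -
  have "\<Phi> (U_L 0 * u - (hL + of_int d) \<cdot> u) = 0"
  proof (rule poly_mapping_eqI)
    fix \<mu>
    show "Poly_Mapping.lookup (\<Phi> (U_L 0 * u - (hL + of_int d) \<cdot> u)) \<mu> = Poly_Mapping.lookup 0 \<mu>"
      using homog_lookup[OF assms, of \<mu>]
      by (cases "int (wdeg level \<mu>) = d")
         (auto simp: \<Phi>_diff \<Phi>_scale Poly_Mapping.lookup_minus lookup_\<Phi>_L0)
  qed
  then show ?thesis by (simp add: mem_K_iff)
qed

lemma homog_mult_ad_level:
  assumes "ad_level t y" "homog level d (\<Phi> u)"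
  shows "homog level (d + t) (\<Phi> (y * u))"
proof -
  have "y * (U_L 0 * u) = U_L 0 * (y * u) - of_int t \<cdot> (y * u)"
    using assms(1) by (simp add: ad_level_def mult.assoc [symmetric] distrib_right)
  moreover have "y * (U_L 0 * u - (hL + of_int d) \<cdot> u) \<in> K"
    by (intro left_ideal_mult left_ideal_K L0_homog assms(2))
  ultimately have "\<Phi> (U_L 0 * (y * u)) - Const (of_int t) * \<Phi> (y * u) - Const (hL + of_int d) * \<Phi> (y * u) = 0"
    by (simp add: mem_K_iff right_diff_distrib \<Phi>_diff \<Phi>_scale)
  then have "Poly_Mapping.lookup (\<Phi> (U_L 0 * (y * u)) - Const (of_int t) * \<Phi> (y * u) -
      Const (hL + of_int d) * \<Phi> (y * u)) \<mu> = 0" for \<mu>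
    by simp
  then have "(of_int (int (wdeg level \<mu>)) - of_int (d + t)) * Poly_Mapping.lookup (\<Phi> (y * u)) \<mu> = 0" for \<mu>
    by (simp only: Poly_Mapping.lookup_minus lookup_\<Phi>_L0 lookup_Const_mult)
       (simp add: algebra_simps)
  then show ?thesis
    by (simp only: homog_def in_keys_iff mult_eq_0_iff right_minus_eq of_int_eq_iff) blast
qed

text \<open>
  Different levels have different \<open>L\<^sub>0\<close>-eigenvalues, so an eigenvector lives in one level.
\<close>

lemma homog_\<Phi>_eigenvector:
  assumes "U_L 0 * u - a \<cdot> u \<in> K"
  shows "\<exists>d::nat. homog level (int d) (\<Phi> u)"
proof -
  have eq: "(hL + of_nat (wdeg level \<mu>) - a) * Poly_Mapping.lookup (\<Phi> u) \<mu> = 0" for \<mu>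
  proof -
    have "Poly_Mapping.lookup (\<Phi> (U_L 0 * u - a \<cdot> u)) \<mu> = 0"
      using assms by (simp add: mem_K_iff)
    then show ?thesis
      by (simp only: \<Phi>_diff \<Phi>_scale Poly_Mapping.lookup_minus lookup_\<Phi>_L0 lookup_Const_mult left_diff_distrib)
  qed
  show ?thesis
  proof (cases "\<Phi> u = 0")
    case False
    then obtain \<nu> where \<nu>: "\<nu> \<in> Poly_Mapping.keys (\<Phi> u)"
      by fastforce
    have "wdeg level \<mu> = wdeg level \<nu>" if "\<mu> \<in> Poly_Mapping.keys (\<Phi> u)" for \<mu>
    proof -
      have "hL + of_nat (wdeg level \<mu>) - a = 0" "hL + of_nat (wdeg level \<nu>) - a = 0"
        using eq[of \<mu>] eq[of \<nu>] \<nu> that by (auto simp: in_keys_iff)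
      then have "(of_nat (wdeg level \<mu>) :: complex) = of_nat (wdeg level \<nu>)"
        by (metis add_left_imp_eq right_minus_eq)
      then show ?thesis by simp
    qed
    then show ?thesis
      by (intro exI[of _ "wdeg level \<nu>"]) (simp add: homog_def)
  qed simp
qed

lemma homog_coef: "homog level (int k + 1 - n) (coef n k)"
proof -
  have "homog level (- j) (val (genM j))" for j
    using homog_Var[of level "VM (nat (- j - 1))"] by (cases "j < 0") auto
  from homog_mult'[OF _ this, of 0 "of_int (n + int k + 1)" "n - int k - 1"]
  have "homog level (int k + 1 - n) (of_int (n + int k + 1) * val (genM (n - int k - 1)))"
    by (metis Const_of_int add_0 diff_diff_eq homog_Const minus_diff_eq)
  moreover have "homog level (int k + 1 - n) (if n = int k + 1 then of_int (n ^ 3 - n) * (Const (1/12) * Const cM) else 0)"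
    by (simp flip: Const_of_int Const_mult del: of_int_diff of_int_power)
  ultimately show ?thesis
    unfolding coef_def by (rule homog_add)
qed

lemma homog_E: "homog level d f \<Longrightarrow> homog level (d - n) (E n f)"
proof -
  assume f: "homog level d f"
  have "homog level (int (level v) + (- n)) (E_coef n v)" for v
    using homog_coef[of _ n] by (cases v; simp add: add.commute add_diff_eq)+
  from homog_der[OF f this] show ?thesis
    by simp
qed

end

section \<open>Triangular systems\<close>

context verma
begin

lemma commute_M_words:
  "(\<And>g. g \<in> set w \<Longrightarrow> \<exists>n. g = genM n) \<Longrightarrow> U_M m * uword w = uword w * U_M m"
proof (induction w)
  case (Cons g w)
  obtain n where g: "g = genM n"
    using Cons.prems by auto
  have "U_M m * (U_M n * uword w) = U_M n * (U_M m * uword w)"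
    by (metis mult.assoc uea_MM)
  with Cons g show ?case
    by (simp add: mult.assoc)
qed simp

text \<open>
  The letters behind the insertion point are \<open>M\<close>'s, and these commute.
\<close>

lemma uword_insort_M:
  assumes "sorted w" "\<And>h. h \<in> set w \<Longrightarrow> \<not> nonneg h" "m < 0"
  shows "uword (insort (genM m) w) = uword w * U_M m"
  using assms(1,2)
proof (induction w)
  case (Cons h w)
  show ?case
  proof (cases "genM m \<le> h")
    case True
    have "\<exists>n. g = genM n" if "g \<in> set (h # w)" for g
    proof -
      have "genM m \<le> g" "\<not> nonneg g"
        using that True Cons.prems by auto
      then show ?thesis
        using assms(3) by (cases g) (auto simp: less_eq_gen_def nonneg_def split: if_splits)
    qed
    from commute_M_words[of "h # w" m, OF this] show ?thesis
      using True by simp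
  next
    case False
    with Cons show ?thesis
      by (simp add: mult.assoc)
  qed
qed simp

lemma lift_mult_Var: "lift (Var (VM k) * f) = lift f * U_M (- int k - 1)"
proof (induction f rule: single_induct)
  case (single \<mu> c)
  have "mono_word (add_mset (VM k) \<mu>) = insort (genM (- int k - 1)) (mono_word \<mu>)"
    by (simp add: mono_word_def)
  then have "uword (mono_word (add_mset (VM k) \<mu>)) = uword (mono_word \<mu>) * U_M (- int k - 1)"
    using uword_insort_M[of "mono_word \<mu>" "- int k - 1"] mono_word_neg by (simp add: mono_word_def)
  then show ?case
    by (simp add: Var_mult_single)
qed (simp add: distrib_left distrib_right lift_add)

lemma lift_mult: "M_pol g \<Longrightarrow> lift (f * g) = lift f * lift g"
proof (induction g rule: M_pol_induct)
  case (Const c)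
  then show ?case by (simp add: mult.commute[of f] lift_Const_mult)
next
  case (add g h)
  then show ?case by (simp add: distrib_left lift_add)
next
  case (Var k g)
  have "lift (f * (Var (VM k) * g)) = lift (Var (VM k) * (f * g))"
    by (simp add: mult_ac)
  with Var show ?case
    by (simp add: lift_mult_Var mult.assoc)
qed

lemma lift_commute: "M_pol f \<Longrightarrow> M_pol g \<Longrightarrow> lift f * lift g = lift g * lift f"
  by (metis lift_mult mult.commute)

lemma lift_commute_M: "M_pol f \<Longrightarrow> U_M n * lift f = lift f * U_M n"
proof (induction f rule: M_pol_induct)
  case (Var k f)
  then show ?case
    by (simp add: lift_mult_Var) (metis mult.assoc uea_MM)
qed (simp_all add: lift_add distrib_left distrib_right)

lemma lift_Var_M: "lift (Var (VM k)) = U_M (- int k - 1)"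
  using lift_mult_Var[of k 1] by simp

text \<open>
  The common value in the enveloping algebra of \<open>[L\<^sub>n, M\<^bsub>-(k+1)\<^esub>]\<close> and \<open>[M\<^sub>n, L\<^bsub>-(k+1)\<^esub>]\<close>.
\<close>

definition M_bracket :: "int \<Rightarrow> nat \<Rightarrow> uea" where
  "M_bracket n k = of_int (n + int k + 1) \<cdot> U_M (n - int k - 1) +
     (if n = int k + 1 then (of_int (n ^ 3 - n) / 12) \<cdot> U_CM else 0)"

lemma L_M_bracket: "U_L n * U_M (- int k - 1) = U_M (- int k - 1) * U_L n + M_bracket n k"
  and M_L_bracket: "U_M n * U_L (- int k - 1) = U_L (- int k - 1) * U_M n + M_bracket n k"
proof -
  have *: "n - int k - 1 = 0 \<longleftrightarrow> n = int k + 1" "n - (- int k - 1) = n + int k + 1"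
    "n + (- int k - 1) = n - int k - 1"
    by auto
  show "U_L n * U_M (- int k - 1) = U_M (- int k - 1) * U_L n + M_bracket n k"
    "U_M n * U_L (- int k - 1) = U_L (- int k - 1) * U_M n + M_bracket n k"
    unfolding uea_LM[of n] uea_ML[of n] M_bracket_def * by (simp_all only: add.assoc)
qed

lemma M_bracket_commute: "M_pol f \<Longrightarrow> M_bracket n k * lift f = lift f * M_bracket n k"
  by (simp add: M_bracket_def distrib_left distrib_right lift_commute_M uea_CM_central)

lemma M_pol_E: "M_pol f \<Longrightarrow> M_pol (E n f)"
proof -
  assume f: "M_pol f"
  have "homog ldeg (0 + 0) (E n f)"
  proof (rule homog_der[OF f])
    fix v
    show "homog ldeg (int (ldeg v) + 0) (E_coef n v)"
      by (cases v) (simp_all add: M_pol_coef)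
  qed
  then show ?thesis by simp
qed

text \<open>
  \<open>v\<close> behaves like the highest weight vector with respect to the nonnegative \<open>M\<close>-modes, modulo the
  submodule given by \<open>I\<close>. On such vectors \<open>M_bracket\<close> acts as \<open>coef\<close>.
\<close>

definition hw_M :: "uea set \<Rightarrow> uea \<Rightarrow> bool" where
  "hw_M I v \<longleftrightarrow> (\<forall>n>0. U_M n * v \<in> I) \<and> U_M 0 * v - hM \<cdot> v \<in> I"

lemma hw_M_1: "K \<subseteq> I \<Longrightarrow> hw_M I 1"
  using K_generators by (auto simp: hw_M_def)

context
  fixes I :: "uea set"
  assumes I: "left_ideal I" and KI: "K \<subseteq> I"
begin

lemma CM_I: "U_CM * v - cM \<cdot> v \<in> I"
proof -
  have "v * (U_CM - cM \<cdot> 1) \<in> K"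
    by (intro left_ideal_mult left_ideal_K K_generators)
  then show ?thesis
    using KI by (auto simp: right_diff_distrib uea_CM_central)
qed

lemma hw_M_act: "hw_M I v \<Longrightarrow> U_M n * v - lift (val (genM n)) * v \<in> I"
proof -
  assume v: "hw_M I v"
  consider "n < 0" | "n = 0" | "n > 0" by linarith
  then show ?thesis
  proof cases
    case 1
    then have "- int (nat (- n - 1)) - 1 = n" by simp
    then have "lift (val (genM n)) = U_M n"
      using 1 lift_Var_M[of "nat (- n - 1)"] by simp
    then show ?thesis
      by (simp add: left_ideal_0[OF I] del: val.simps)
  qed (use v in \<open>simp_all add: hw_M_def\<close>)
qed

lemma hw_M_bracket:
  assumes v: "hw_M I v"
  shows "M_bracket n k * v - lift (coef n k) * v \<in> I"
proof -
  have lift_of_int: "lift (of_int m * f) = of_int m \<cdot> lift f" for m f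
    by (metis Const_of_int lift_Const_mult)
  have "lift (Const (1 / 12) * Const cM) = (cM / 12) \<cdot> 1"
    by (simp flip: Const_mult)
  then have coef: "lift (coef n k) = of_int (n + int k + 1) \<cdot> lift (val (genM (n - int k - 1))) +
      (if n = int k + 1 then (of_int (n ^ 3 - n) / 12 * cM) \<cdot> 1 else 0)"
    unfolding coef_def lift_add lift_of_int if_distrib[of lift] by (simp only: lift_0 uea_scale_scale) simp
  have split: "(a \<cdot> x + y) * v - (a \<cdot> x' + y') * v = a \<cdot> (x * v - x' * v) + (y * v - y' * v)" for a x x' y y'
    by (simp add: distrib_right uea_scale_diff_right algebra_simps)
  have "M_bracket n k * v - lift (coef n k) * v =
      of_int (n + int k + 1) \<cdot> (U_M (n - int k - 1) * v - lift (val (genM (n - int k - 1))) * v) +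
      (if n = int k + 1 then (of_int (n ^ 3 - n) / 12) \<cdot> (U_CM * v - cM \<cdot> v) else 0)"
    unfolding M_bracket_def coef split by (simp add: uea_scale_diff_right)
  also have "\<dots> \<in> I"
  proof (rule left_ideal_add[OF I])
    show "of_int (n + int k + 1) \<cdot> (U_M (n - int k - 1) * v - lift (val (genM (n - int k - 1))) * v) \<in> I"
      by (intro left_ideal_scale I hw_M_act v)
    show "(if n = int k + 1 then (of_int (n ^ 3 - n) / 12) \<cdot> (U_CM * v - cM \<cdot> v) else 0) \<in> I"
      using left_ideal_scale[OF I CM_I] left_ideal_0[OF I] by simp
  qed
  finally show ?thesis .
qed

text \<open>
  Commuting \<open>L\<^sub>n\<close> past the factors of \<open>a\<close> produces brackets that commute with the remaining
  factors and then act on \<open>v\<close> by \<open>coef\<close>; so \<open>L\<^sub>n\<close> acts on the coefficient \<open>a\<close> as \<open>E n\<close>.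
\<close>

lemma L_lift:
  assumes v: "hw_M I v" and a: "M_pol a"
  shows "U_L n * (lift a * v) - lift a * (U_L n * v) - lift (E n a) * v \<in> I"
  using a
proof (induction a rule: M_pol_induct)
  case (Const c)
  show ?case by (simp add: left_ideal_0[OF I])
next
  case (add f g)
  from left_ideal_add[OF I add(3,4)] show ?case
    by (simp add: lift_add der_add distrib_left distrib_right algebra_simps)
next
  case (Var k f)
  let ?M = "U_M (- int k - 1)"
  have f: "M_pol f" by (rule Var)
  have comm: "lift f * ?M = ?M * lift f"
    using lift_commute_M[OF f] by simp
  have "?M * (U_L n * (lift f * v) - lift f * (U_L n * v) - lift (E n f) * v) +
      lift f * (M_bracket n k * v - lift (coef n k) * v) \<in> I"
    by (intro left_ideal_add left_ideal_mult I hw_M_bracket v Var.IH)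
  moreover have "U_L n * (lift (Var (VM k) * f) * v) =
      ?M * (U_L n * (lift f * v)) + lift f * (M_bracket n k * v)"
  proof -
    have "U_L n * (lift (Var (VM k) * f) * v) = (U_L n * ?M) * (lift f * v)"
      by (simp add: lift_mult_Var comm mult.assoc)
    also have "\<dots> = ?M * (U_L n * (lift f * v)) + (M_bracket n k * lift f) * v"
      by (simp add: L_M_bracket distrib_right mult.assoc)
    finally show ?thesis
      by (simp add: M_bracket_commute[OF f] mult.assoc)
  qed
  moreover have "lift (Var (VM k) * f) * (U_L n * v) = ?M * (lift f * (U_L n * v))"
    by (simp add: lift_mult_Var comm mult.assoc)
  moreover have "lift (E n (Var (VM k) * f)) * v = lift f * (lift (coef n k) * v) + ?M * (lift (E n f) * v)"
  proof -
    have "M_pol (E n f)"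
      by (rule M_pol_E[OF f])
    then have "lift (Var (VM k) * E n f) = ?M * lift (E n f)"
      by (simp add: lift_mult_Var lift_commute_M)
    moreover have "lift (coef n k * f) = lift f * lift (coef n k)"
      by (metis M_pol_coef lift_mult mult.commute)
    ultimately show ?thesis
      by (simp add: der_Var_mult lift_add distrib_right mult.assoc)
  qed
  ultimately show ?case
    by (simp add: right_diff_distrib algebra_simps)
qed

end

lemma lift_leading:
  assumes "M_pol a" "\<Phi> u \<in> filt (Suc k)"
  shows "\<Phi> (lift a * u) - a * \<Phi> u \<in> filt k"
  using assms(1)
proof (induction a rule: M_pol_induct)
  case (add f g)
  from wdeg_lt_add[OF add(3,4)] show ?case
    by (simp add: lift_add \<Phi>_add distrib_right algebra_simps)
next
  case (Var i f)
  have "f * \<Phi> u \<in> filt (Suc k)"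
    by (intro filt_M_pol_mult Var assms)
  moreover have "\<Phi> (lift f * u) - f * \<Phi> u \<in> filt (Suc k)"
    by (rule wdeg_lt_mono[OF Var.IH]) simp
  ultimately have "\<Phi> (lift f * u) \<in> filt (Suc k)"
    using wdeg_lt_add by fastforce
  from \<Phi>_var_leading[OF this, of "VM i"]
  have 1: "\<Phi> (U_M (- int i - 1) * (lift f * u)) - Var (VM i) * \<Phi> (lift f * u) \<in> filt k"
    by simp
  have "Var (VM i) * (\<Phi> (lift f * u) - f * \<Phi> u) \<in> filt k"
    by (intro filt_M_pol_mult M_pol_Var Var.IH)
  from wdeg_lt_add[OF 1 this]
  have "\<Phi> (U_M (- int i - 1) * (lift f * u)) - Var (VM i) * (f * \<Phi> u) \<in> filt k"
    by (simp add: right_diff_distrib)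
  moreover have "lift (Var (VM i) * f) * u = U_M (- int i - 1) * (lift f * u)"
    by (simp add: lift_mult_Var lift_commute_M[OF Var(1), symmetric] mult.assoc [symmetric])
  ultimately show ?case
    by (simp add: mult.assoc)
qed (simp add: \<Phi>_scale)

lemma coef_eq_0: "n > int k + 1 \<Longrightarrow> coef n k = 0"
  by (simp add: coef_def)

lemma coef_0: "coef 0 k = of_nat (Suc k) * Var (VM k)"
  by (simp add: coef_def add.commute)

definition \<phi> :: "nat \<Rightarrow> complex" where
  "\<phi> n = 2 * hM + (of_nat n ^ 2 - 1) / 12 * cM"

lemma coef_diag: "coef (int k + 1) k = Const (of_nat (Suc k) * \<phi> (Suc k))"
proof -
  have "coef (int k + 1) k = Const (of_int (2 * (int k + 1)) * hM +
      of_int ((int k + 1) ^ 3 - (int k + 1)) * (1/12 * cM))"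
    unfolding coef_def Const_add Const_mult Const_of_int by (simp add: add.commute)
  also have "of_int (2 * (int k + 1)) * hM + of_int ((int k + 1) ^ 3 - (int k + 1)) * (1/12 * cM) =
      of_nat (Suc k) * \<phi> (Suc k)"
    by (simp add: \<phi>_def power2_eq_square power3_eq_cube field_simps)
  finally show ?thesis .
qed

lemma coef_Var: "1 \<le> n \<Longrightarrow> n \<le> k \<Longrightarrow> coef (int n) k = of_nat (n + k + 1) * Var (VM (k - n))"
proof -
  assume n: "1 \<le> n" "n \<le> k"
  then have "nat (- (int n - int k - 1) - 1) = k - n" by simp
  with n show ?thesis
    by (simp add: coef_def) (simp add: add_ac)
qed

definition vars_below :: "nat \<Rightarrow> nvar pol \<Rightarrow> bool" where
  "vars_below N f \<longleftrightarrow> vars f \<subseteq> VL ` {..<N} \<union> VM ` {..<N}"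

lemma vars_below_exists: "\<exists>N\<ge>M. vars_below N f \<and> vars_below N g"
proof -
  have "\<exists>N. \<forall>v\<in>S. v \<in> VL ` {..<N} \<union> VM ` {..<N}" if "finite S" for S
    using that
  proof (induction S)
    case (insert v S)
    then obtain N where N: "\<forall>v\<in>S. v \<in> VL ` {..<N} \<union> VM ` {..<N}" by blast
    have "\<forall>u\<in>insert v S. u \<in> VL ` {..<max N (level v)} \<union> VM ` {..<max N (level v)}"
      using N by (cases v) auto
    then show ?case ..
  qed simp
  from this[of "vars f \<union> vars g"] obtain N
    where "\<forall>v\<in>vars f \<union> vars g. v \<in> VL ` {..<N} \<union> VM ` {..<N}"
    by auto
  then have "vars f \<union> vars g \<subseteq> VL ` {..<N} \<union> VM ` {..<N}"
    by blast
  also have "\<dots> \<subseteq> VL ` {..<max M N} \<union> VM ` {..<max M N}"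
    by auto
  finally show ?thesis
    by (intro exI[of _ "max M N"]) (simp add: vars_below_def)
qed

lemma der_sum_below:
  assumes "vars_below N f"
  shows "der c f = (\<Sum>k<N. c (VL k) * pd (VL k) f) + (\<Sum>k<N. c (VM k) * pd (VM k) f)"
proof -
  have "der c f = (\<Sum>v\<in>VL ` {..<N} \<union> VM ` {..<N}. c v * pd v f)"
    using assms by (intro der_superset) (auto simp: vars_below_def)
  also have "\<dots> = (\<Sum>v\<in>VL ` {..<N}. c v * pd v f) + (\<Sum>v\<in>VM ` {..<N}. c v * pd v f)"
    by (rule sum.union_disjoint) auto
  also have "\<dots> = (\<Sum>k<N. c (VL k) * pd (VL k) f) + (\<Sum>k<N. c (VM k) * pd (VM k) f)"
    by (simp add: sum.reindex inj_on_def)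
  finally show ?thesis .
qed

lemma D_sum: "vars_below N f \<Longrightarrow> D n f = (\<Sum>k<N. coef n k * pd (VL k) f)"
  and E_sum: "vars_below N f \<Longrightarrow> E n f = (\<Sum>k<N. coef n k * pd (VM k) f)"
  by (simp_all add: der_sum_below)

lemma pd_VL_M_pol: "M_pol f \<Longrightarrow> pd (VL k) f = 0"
  using homog_pd[of ldeg 0 f "VL k"] homog_neg by fastforce

lemma D_M_pol: "M_pol f \<Longrightarrow> D n f = 0"
  using vars_below_exists[of 0 f f] by (auto simp: D_sum pd_VL_M_pol)

lemma pd_D: "pd (VL i) (D n f) = D n (pd (VL i) f)"
proof -
  obtain N where "vars_below N f" "vars_below N (pd (VL i) f)"
    using vars_below_exists by blast
  then show ?thesis
    by (simp add: D_sum pd_sum pd_mult pd_VL_M_pol[OF M_pol_coef] pd_commute[of "VL i"])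
qed

lemma hcomp_sum: "hcomp w k (sum f S) = (\<Sum>i\<in>S. hcomp w k (f i))"
proof -
  have "hcomp w k 0 = 0"
    by (rule hcomp_eq_0) simp
  then show ?thesis
    by (induction S rule: infinite_finite_induct) (simp_all add: hcomp_add)
qed

lemma hcomp_D: "hcomp ldeg k (D n f) = D n (hcomp ldeg (Suc k) f)"
proof -
  obtain N where "vars_below N f" "vars_below N (hcomp ldeg (Suc k) f)"
    using vars_below_exists by blast
  then show ?thesis
    by (simp add: D_sum hcomp_sum hcomp_mult_homog0[OF M_pol_coef] hcomp_pd)
qed

lemma hcomp_dvd: "M_pol q \<Longrightarrow> q dvd f \<Longrightarrow> q dvd hcomp ldeg k f"
  by (auto simp: hcomp_mult_homog0 elim!: dvdE)

text \<open>
  Compare the parts of degree \<open>k\<close>: the symbol of \<open>M\<^sub>n u\<close> is \<open>D n\<close> of the symbol of \<open>u\<close>.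
\<close>

lemma symbol_killed:
  assumes "\<Phi> u \<in> filt (Suc (Suc k))" "M_pol q" "n \<ge> 1" "q dvd \<Phi> (U_M n * u)"
  shows "q dvd D n (hcomp ldeg (Suc k) (\<Phi> u))"
proof -
  have "\<Phi> (U_M n * u) - D n (\<Phi> u) \<in> filt k"
    using \<Phi>_M_leading[of n u "Suc k"] assms by simp
  from hcomp_eq_0[OF this] have "hcomp ldeg k (\<Phi> (U_M n * u)) = D n (hcomp ldeg (Suc k) (\<Phi> u))"
    by (simp add: hcomp_diff hcomp_D)
  with hcomp_dvd[OF assms(2,4)] show ?thesis by metis
qed

end

text \<open>
  \<open>p\<close> is the only \<open>n \<ge> 1\<close> with \<open>\<phi> n = 0\<close>, and \<open>p = 0\<close> stands for the case that there is none.
\<close>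

locale verma_level = verma +
  fixes p :: nat
  assumes \<phi>_nonzero: "n \<ge> 1 \<Longrightarrow> n \<noteq> p \<Longrightarrow> \<phi> n \<noteq> 0"
    and \<phi>_p: "p \<ge> 1 \<Longrightarrow> \<phi> p = 0"
begin

text \<open>
  Solve from the last unknown downwards: the equation with \<open>n = k + 1\<close> starts at \<open>h k\<close>, whose
  coefficient is the nonzero constant \<open>n \<phi> n\<close> unless \<open>n = p\<close>.
\<close>

lemma triangular_dvd:
  assumes "\<And>n. n \<ge> 1 \<Longrightarrow> q dvd (\<Sum>k<N. coef (int n) k * h k)"
    and "p \<ge> 1 \<Longrightarrow> q dvd h (p - 1)"
    and "k < N"
  shows "q dvd h k"
  using assms(3)
proof (induction "N - k" arbitrary: k rule: less_induct)
  case (less k)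
  show ?case
  proof (cases "Suc k = p")
    case False
    have split: "(\<Sum>i<N. coef (int (Suc k)) i * h i) =
        coef (int (Suc k)) k * h k + (\<Sum>i\<in>{..<N} - {k}. coef (int (Suc k)) i * h i)"
      using less.prems by (subst sum.remove[of _ k]) auto
    have rest: "q dvd (\<Sum>i\<in>{..<N} - {k}. coef (int (Suc k)) i * h i)"
    proof (rule dvd_sum)
      fix i
      assume i: "i \<in> {..<N} - {k}"
      show "q dvd coef (int (Suc k)) i * h i"
      proof (cases "i < k")
        case True
        then show ?thesis by (simp add: coef_eq_0)
      next
        case False
        with i less.prems have "q dvd h i"
          by (intro less.hyps) auto
        then show ?thesis by simp
      qed
    qed
    have "q dvd (\<Sum>i<N. coef (int (Suc k)) i * h i)"
      by (rule assms(1)) simp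
    then have "q dvd coef (int (Suc k)) k * h k"
      unfolding split dvd_add_left_iff[OF rest] .
    moreover have "coef (int (Suc k)) k = Const (of_nat (Suc k) * \<phi> (Suc k))"
      using coef_diag[of k] by (simp add: add.commute)
    moreover have "of_nat (Suc k) * \<phi> (Suc k) \<noteq> 0"
      using \<phi>_nonzero[of "Suc k"] False by (simp del: of_nat_Suc)
    ultimately show ?thesis
      using Const_mult_dvd_cancel by (metis (no_types))
  qed (use assms(2) in auto)
qed

text \<open>
  The solution of the triangular system with the free unknown set to \<open>1\<close>, numbered from the pivot
  \<open>p\<close> downwards: \<open>b i\<close> is the unknown with index \<open>p - i\<close>. See \<open>b_relation\<close>.
\<close>

function b :: "nat \<Rightarrow> nvar pol" where
  "b j = (if j = 0 then 1 else
     - Const (inverse (of_nat (p - j) * \<phi> (p - j))) * (\<Sum>i<j. coef (int (p - j)) (p - 1 - i) * b i))"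
  by auto
termination by (relation "measure id") auto

declare b.simps [simp del]

lemma b_0 [simp]: "b 0 = 1"
  by (simp add: b.simps)

lemma b_step:
  assumes "0 < j" "j < p"
  shows "Const (of_nat (p - j) * \<phi> (p - j)) * b j = - (\<Sum>i<j. coef (int (p - j)) (p - 1 - i) * b i)"
proof -
  have "of_nat (p - j) * \<phi> (p - j) \<noteq> 0"
    using \<phi>_nonzero[of "p - j"] assms by simp
  from right_inverse[OF this] have "Const (of_nat (p - j) * \<phi> (p - j)) * (Const (inverse (of_nat (p - j) * \<phi> (p - j))) * f) = f" for f :: "nvar pol"
    by (simp only: mult.assoc [symmetric] Const_mult [symmetric] Const_1 mult_1_left)
  from this[of "- (\<Sum>i<j. coef (int (p - j)) (p - 1 - i) * b i)"] show ?thesis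
    by (subst b.simps) (use assms in simp)
qed

lemma b_relation:
  assumes "n \<ge> 1"
  shows "(\<Sum>i<p. coef (int n) (p - 1 - i) * b i) = 0"
proof (cases "n < p")
  case True
  define j where "j = p - n"
  have j: "0 < j" "j < p" "n = p - j"
    using True assms by (auto simp: j_def)
  have "(\<Sum>i<p. coef (int n) (p - 1 - i) * b i) = (\<Sum>i<Suc j. coef (int n) (p - 1 - i) * b i)"
    using j by (intro sum.mono_neutral_right) (auto simp: coef_eq_0)
  also have "\<dots> = (\<Sum>i<j. coef (int n) (p - 1 - i) * b i) + coef (int n) (p - 1 - j) * b j"
    by simp
  also have "coef (int n) (p - 1 - j) = Const (of_nat (p - j) * \<phi> (p - j))"
  proof -
    have "int n = int (p - 1 - j) + 1" "Suc (p - 1 - j) = p - j"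
      using j by auto
    then show ?thesis
      using coef_diag[of "p - 1 - j"] by simp
  qed
  finally show ?thesis
    using b_step[OF j(1,2)] j(3) by simp
next
  case False
  have "coef (int n) (p - 1 - i) * b i = 0" if "i < p" for i
  proof (cases "i = 0 \<and> n = p")
    case True
    then have "coef (int n) (p - 1 - i) = Const (of_nat p * \<phi> p)"
      using coef_diag[of "p - 1"] that by (simp add: of_nat_diff)
    then show ?thesis using \<phi>_p that by simp
  next
    case i: False
    then have "coef (int n) (p - 1 - i) = 0"
      using that False by (intro coef_eq_0) auto
    then show ?thesis by simp
  qed
  then show ?thesis by simp
qed

lemma M_pol_b: "M_pol (b j)"
proof (induction j rule: less_induct)
  case (less j)
  show ?case
  proof (cases "j = 0")
    case False
    have "M_pol (\<Sum>i<j. coef (int (p - j)) (p - 1 - i) * b i)"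
      by (intro homog_sum M_pol_mult M_pol_coef less) simp
    then show ?thesis
      by (subst b.simps) (use False in \<open>auto intro!: homog_minus homog_Const_mult\<close>)
  qed simp
qed

lemma homog_b: "j < p \<Longrightarrow> homog level (int j) (b j)"
proof (induction j rule: less_induct)
  case (less j)
  show ?case
  proof (cases "j = 0")
    case True
    then show ?thesis using homog_Const[of level 1] by simp
  next
    case False
    have "homog level (int j) (\<Sum>i<j. coef (int (p - j)) (p - 1 - i) * b i)"
    proof (rule homog_sum)
      fix i
      assume i: "i \<in> {..<j}"
      show "homog level (int j) (coef (int (p - j)) (p - 1 - i) * b i)"
        using i less by (intro homog_mult'[OF homog_coef less.IH]) auto
    qed
    then show ?thesis
      by (subst b.simps) (use False in \<open>auto intro!: homog_minus homog_Const_mult\<close>)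
  qed
qed

text \<open>
  Modulo \<open>q\<close> a solution is determined by its value \<open>g (p - 1)\<close> at the vanishing pivot: subtracting
  that multiple of \<open>b\<close> leaves a solution which is zero at the pivot, hence zero everywhere.
\<close>

lemma elimination:
  assumes "\<And>n. n \<ge> 1 \<Longrightarrow> q dvd (\<Sum>k<N. coef (int n) k * g k)" and "p \<le> N"
  shows "k < N \<Longrightarrow> p \<le> k \<Longrightarrow> q dvd g k"
    and "i < p \<Longrightarrow> q dvd g (p - 1 - i) - b i * g (p - 1)"
proof -
  \<comment> \<open>The part of \<open>g\<close> that is not accounted for by the multiple \<open>g (p - 1)\<close> of \<open>b\<close>.\<close>
  define h where "h k = g k - (if k < p then b (p - 1 - k) * g (p - 1) else 0)" for k
  have *: "q dvd h k" if "k < N" for k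
  proof (rule triangular_dvd[OF _ _ that])
    fix n :: nat
    assume n: "n \<ge> 1"
    have "(\<Sum>k<N. coef (int n) k * (if k < p then b (p - 1 - k) * g (p - 1) else 0)) =
        (\<Sum>k<p. coef (int n) k * (b (p - 1 - k) * g (p - 1)))"
      using assms(2) by (intro sum.mono_neutral_cong_right) auto
    also have "\<dots> = (\<Sum>i<p. coef (int n) (p - 1 - i) * b i) * g (p - 1)"
      by (subst sum.nat_diff_reindex [symmetric]) (simp add: sum_distrib_right mult.assoc Suc_diff_Suc)
    also have "\<dots> = 0"
      using b_relation[OF n] by simp
    finally show "q dvd (\<Sum>k<N. coef (int n) k * h k)"
      using assms(1)[OF n] by (simp add: h_def right_diff_distrib sum_subtractf)
  next
    assume "p \<ge> 1"
    then show "q dvd h (p - 1)" by (simp add: h_def)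
  qed
  show "k < N \<Longrightarrow> p \<le> k \<Longrightarrow> q dvd g k"
    using *[of k] by (simp add: h_def)
  show "i < p \<Longrightarrow> q dvd g (p - 1 - i) - b i * g (p - 1)"
    using *[of "p - 1 - i"] assms(2) by (simp add: h_def)
qed

end

section \<open>The polynomials Q and z and the operator Z\<close>

context verma_level
begin

text \<open>
  \<open>z\<close> is the symbol of \<open>Z\<close>. By \<open>b_relation\<close> it is killed by all \<open>D n\<close> with \<open>n \<ge> 1\<close>, and
  \<open>Q\<close> is \<open>D 0 z\<close>, that is, \<open>[M\<^sub>0, Z]\<close>.
\<close>

definition Q :: "nvar pol" where
  "Q = (\<Sum>i<p. coef 0 (p - 1 - i) * b i)"

definition z :: "nvar pol" where
  "z = (\<Sum>i<p. Var (VL (p - 1 - i)) * b i)"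

definition Z :: uea where
  "Z = (\<Sum>i<p. lift (b i) * U_L (- int (p - 1 - i) - 1))"

lemma weighted_elimination:
  assumes "\<And>n. n \<ge> 1 \<Longrightarrow> q dvd (\<Sum>k<N. coef (int n) k * g k)" and "p \<le> N"
  shows "q dvd (\<Sum>k<N. c k * g k) - (\<Sum>i<p. c (p - 1 - i) * b i) * g (p - 1)"
proof -
  have "(\<Sum>k<N. c k * g k) = (\<Sum>k<p. c k * g k) + (\<Sum>k\<in>{p..<N}. c k * g k)"
    using assms(2) by (simp add: sum.union_disjoint[symmetric] ivl_disj_un ivl_disj_int lessThan_atLeast0)
  also have "(\<Sum>k<p. c k * g k) = (\<Sum>i<p. c (p - 1 - i) * g (p - 1 - i))"
    by (subst sum.nat_diff_reindex [symmetric]) simp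
  finally have "(\<Sum>k<N. c k * g k) - (\<Sum>i<p. c (p - 1 - i) * b i) * g (p - 1) =
      (\<Sum>i<p. c (p - 1 - i) * (g (p - 1 - i) - b i * g (p - 1))) + (\<Sum>k\<in>{p..<N}. c k * g k)"
    by (simp add: right_diff_distrib sum_subtractf sum_distrib_right mult.assoc)
  also have "q dvd \<dots>"
    using elimination[OF assms] by (intro dvd_add dvd_sum dvd_mult) auto
  finally show ?thesis .
qed

text \<open>
  Put \<open>g\<^sub>m = \<partial>a/\<partial>x\<^sub>m\<close>. By elimination \<open>g\<^bsub>p-i\<^esub>\<close> is congruent to \<open>b i\<close> times \<open>g\<^sub>p\<close> modulo \<open>Q\<close>, and Euler's
  identity gives \<open>d a = \<Sum>\<^sub>m m x\<^sub>m g\<^sub>m\<close>, which is congruent to \<open>Q g\<^sub>p\<close>. The definition of \<open>Q\<close> is thus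
  exactly what makes \<open>a\<close> divisible by it.
\<close>

lemma kernel_E:
  assumes a: "M_pol a" "homog level (int d) a" "d > 0" and E: "\<And>n. n \<ge> 1 \<Longrightarrow> Q dvd E (int n) a"
  shows "Q dvd a"
proof -
  obtain N where N: "p \<le> N" "vars_below N a"
    using vars_below_exists by blast
  have "Const (of_nat d) * a = der (\<lambda>v. of_nat (level v) * Var v) a"
    using euler[OF a(2)] by (simp add: Const_of_nat)
  also have "\<dots> = (\<Sum>k<N. coef 0 k * pd (VM k) a)"
    by (simp add: der_sum_below[OF N(2)] pd_VL_M_pol[OF a(1)] coef_0)
  finally have "Const (of_nat d) * a = \<dots>" .
  moreover have "Q dvd (\<Sum>k<N. coef 0 k * pd (VM k) a) - Q * pd (VM (p - 1)) a"
    using weighted_elimination[where q = Q and N = N and g = "\<lambda>k. pd (VM k) a" and c = "coef 0"] E N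
    by (simp add: E_sum Q_def)
  ultimately have "Q dvd Const (of_nat d) * a"
    by (metis dvd_diffD dvd_triv_left diff_add_cancel dvd_add)
  with a(3) show ?thesis
    using Const_mult_dvd_cancel[of "of_nat d" Q a] by simp
qed

text \<open>
  The same elimination for \<open>g\<^sub>m = \<partial>s/\<partial>l\<^sub>m\<close>, inserted into Euler's identity for \<open>ldeg\<close> and into \<open>D 0\<close>.
\<close>

lemma euler_ldeg:
  assumes "homog ldeg (int k) s" "\<And>n. n \<ge> 1 \<Longrightarrow> q dvd D (int n) s"
  shows "q dvd of_nat k * s - z * pd (VL (p - 1)) s"
    and "q dvd D 0 s - Q * pd (VL (p - 1)) s"
proof -
  obtain N where N: "p \<le> N" "vars_below N s"
    using vars_below_exists by blast
  have "of_nat k * s = der (\<lambda>v. of_nat (ldeg v) * Var v) s"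
    using euler[OF assms(1)] by simp
  also have "\<dots> = (\<Sum>k<N. Var (VL k) * pd (VL k) s)"
    by (simp add: der_sum_below[OF N(2)])
  finally show "q dvd of_nat k * s - z * pd (VL (p - 1)) s"
    using weighted_elimination[where q = q and N = N and g = "\<lambda>k. pd (VL k) s" and c = "\<lambda>k. Var (VL k)"] assms(2) N
    by (simp add: D_sum z_def)
  show "q dvd D 0 s - Q * pd (VL (p - 1)) s"
    using weighted_elimination[where q = q and N = N and g = "\<lambda>k. pd (VL k) s" and c = "coef 0"] assms(2) N
    by (simp add: D_sum Q_def)
qed

lemma of_nat_mult_cancel_pol: "of_nat (Suc k) * s = 0 \<Longrightarrow> (s :: nvar pol) = 0"
proof -
  assume *: "of_nat (Suc k) * s = 0"
  have "0 dvd Const (of_nat (Suc k)) * s"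
    using * by (simp only: Const_of_nat dvd_0_right)
  then have "0 dvd s"
    by (rule Const_mult_dvd_cancel[rotated]) (simp del: of_nat_Suc)
  then show "s = 0" by simp
qed

lemma symbol_eq_0:
  assumes "homog ldeg (int (Suc k)) s" "\<And>n. n \<ge> 1 \<Longrightarrow> D (int n) s = 0" "p \<ge> 1 \<Longrightarrow> pd (VL (p - 1)) s = 0"
  shows "s = 0"
proof -
  have "z * pd (VL (p - 1)) s = 0"
  proof (cases "p \<ge> 1")
    case False
    then have "{..<p} = {}"
      by auto
    then have "z = 0"
      by (simp only: z_def sum.empty)
    then show ?thesis by simp
  next
    case True
    from assms(3)[OF this] show ?thesis by simp
  qed
  then have "of_nat (Suc k) * s = 0"
    using euler_ldeg(1)[OF assms(1), of 0] assms(2) by simp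
  then show ?thesis by (rule of_nat_mult_cancel_pol)
qed

text \<open>
  By Euler's identity \<open>s\<close> is, up to a constant factor, \<open>z\<close> times \<open>\<partial>s/\<partial>l\<^sub>p\<close> modulo \<open>q\<close>. That derivative
  satisfies the same equations in degree one less, because the coefficients of \<open>D n\<close> are free of
  \<open>L\<close>-variables.
\<close>

lemma symbol_power:
  assumes "M_pol q"
  shows "homog ldeg (int k) s \<Longrightarrow> homog level d s \<Longrightarrow> (\<And>n. n \<ge> 1 \<Longrightarrow> q dvd D (int n) s) \<Longrightarrow> p \<ge> 1 \<Longrightarrow>
    \<exists>a. M_pol a \<and> homog level (d - int (p * k)) a \<and> q dvd s - a * z ^ k"
proof (induction k arbitrary: s d)
  case 0
  then show ?case by (intro exI[of _ s]) simp
next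
  case (Suc k)
  let ?t = "pd (VL (p - 1)) s"
  have "homog ldeg (int k) ?t"
    using homog_pd[OF Suc.prems(1), of "VL (p - 1)"] by simp
  moreover have "homog level (d - int p) ?t"
    using homog_pd[OF Suc.prems(2), of "VL (p - 1)"] Suc.prems(4) by (simp add: of_nat_diff)
  moreover have "q dvd D (int n) ?t" if n: "n \<ge> 1" for n
  proof -
    obtain r where "D (int n) s = q * r"
      using Suc.prems(3)[OF n] by (auto elim: dvdE)
    then have "D (int n) ?t = pd (VL (p - 1)) (q * r)"
      by (simp flip: pd_D)
    then show ?thesis
      by (simp add: pd_mult pd_VL_M_pol[OF assms])
  qed
  ultimately obtain a where a: "M_pol a" "homog level (d - int p - int (p * k)) a" "q dvd ?t - a * z ^ k"
    using Suc.IH[OF _ _ _ Suc.prems(4)] by blast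
  define a' where "a' = Const (inverse (of_nat (Suc k))) * a"
  have "q dvd of_nat (Suc k) * s - z * ?t"
    using euler_ldeg(1)[OF Suc.prems(1)] Suc.prems(3) by simp
  moreover have "q dvd z * (?t - a * z ^ k)"
    using a(3) by simp
  ultimately have "q dvd (of_nat (Suc k) * s - z * ?t) + z * (?t - a * z ^ k)"
    by (rule dvd_add)
  moreover have "Const (of_nat (Suc k)) * (s - a' * z ^ Suc k) =
      (of_nat (Suc k) * s - z * ?t) + z * (?t - a * z ^ k)"
  proof -
    have "Const (of_nat (Suc k)) * a' = a"
      unfolding a'_def mult.assoc [symmetric] Const_mult [symmetric]
      by (subst right_inverse) (simp_all del: of_nat_Suc)
    then have "Const (of_nat (Suc k)) * (s - a' * z ^ Suc k) = of_nat (Suc k) * s - a * z ^ Suc k"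
      by (simp only: right_diff_distrib mult.assoc [symmetric] Const_of_nat)
    then show ?thesis by (simp add: algebra_simps del: of_nat_Suc)
  qed
  ultimately have "q dvd Const (of_nat (Suc k)) * (s - a' * z ^ Suc k)"
    by metis
  then have "q dvd s - a' * z ^ Suc k"
    by (rule Const_mult_dvd_cancel[rotated]) (simp del: of_nat_Suc)
  moreover have "M_pol a'" "homog level (d - int (p * Suc k)) a'"
    using homog_Const_mult[OF a(1)] homog_Const_mult[OF a(2)]
    by (simp_all add: a'_def diff_diff_eq del: of_nat_Suc)
  ultimately show ?case by blast
qed

lemma M_pol_Q: "M_pol Q"
  unfolding Q_def by (intro homog_sum M_pol_mult M_pol_coef M_pol_b)

lemma homog_Q: "homog level (int p) Q"
  unfolding Q_def
proof (rule homog_sum)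
  fix i
  assume "i \<in> {..<p}"
  then show "homog level (int p) (coef 0 (p - 1 - i) * b i)"
    by (intro homog_mult'[OF homog_coef homog_b]) auto
qed

lemma homog_z: "homog level (int p) z"
  unfolding z_def
proof (rule homog_sum)
  fix i
  assume "i \<in> {..<p}"
  then show "homog level (int p) (Var (VL (p - 1 - i)) * b i)"
    by (intro homog_mult'[OF homog_Var homog_b]) auto
qed

lemma ldeg_z: "homog ldeg 1 z"
  unfolding z_def
proof (rule homog_sum)
  fix i
  show "homog ldeg 1 (Var (VL (p - 1 - i)) * b i)"
    by (rule homog_mult'[OF homog_Var M_pol_b]) simp
qed

lemma homog_power:
  "homog w d f \<Longrightarrow> homog w (int k * d) (f ^ k)"
proof (induction k)
  case 0
  then show ?case using homog_Const[of w 1] by simp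
next
  case (Suc k)
  then show ?case
    using homog_mult[of w d f "int k * d" "f ^ k"] by (simp add: algebra_simps)
qed

lemma pd_b:
  assumes "i < p"
  shows "pd (VM (p - 1)) (b i) = 0"
  using homog_pd[OF homog_b[OF assms], of "VM (p - 1)"] assms by (intro homog_neg) auto

lemma pd_Q: 
  assumes "p \<ge> 1"
  shows "pd (VM (p - 1)) Q = of_nat p"
proof -
  have "pd (VM (p - 1)) (coef 0 (p - 1 - i) * b i) = (if i = 0 then of_nat p else 0)" if "i < p" for i
  proof -
    have "Suc (p - 1 - i) = p - i" "p - 1 - i = p - 1 \<longleftrightarrow> i = 0"
      using that assms by auto
    then show ?thesis
      using that pd_b[OF that]
      by (simp add: pd_mult coef_0 pd_Var Const_of_nat[symmetric] del: of_nat_Suc)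
  qed
  then have "pd (VM (p - 1)) Q = (\<Sum>i<p. if i = 0 then of_nat p else 0)"
    unfolding Q_def pd_sum by (intro sum.cong) auto
  then show ?thesis using assms by simp
qed

lemma pd_power_0: "\<exists>m. (pd v ^^ m) f = 0"
proof -
  define w where "w u = (if u = v then 1 else 0 :: nat)" for u
  have "f \<in> wdeg_lt w k \<Longrightarrow> (pd v ^^ m) f \<in> wdeg_lt w (k - m)" for k m
  proof (induction m)
    case (Suc m)
    have "w v = 1"
      by (simp add: w_def)
    with wdeg_lt_pd'[OF Suc.IH[OF Suc.prems]] have "pd v ((pd v ^^ m) f) \<in> wdeg_lt w (k - m - 1)" .
    moreover have "k - m - 1 = k - Suc m" by simp
    ultimately show ?case
      by (simp only: funpow.simps comp_apply)
  qed simp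
  then show ?thesis
    using wdeg_lt_exists[of f w] by (metis diff_self_eq_0 singletonD wdeg_lt_0)
qed

text \<open>
  \<open>Q\<close> is \<open>p x\<^sub>p\<close> plus terms free of \<open>x\<^sub>p\<close>, so a nonzero multiple of \<open>Q\<close> cannot be free of \<open>x\<^sub>p\<close>: by the
  Leibniz rule the highest nonzero derivative of the cofactor with respect to \<open>x\<^sub>p\<close> would vanish.
\<close>

lemma Q_mult_pd_0:
  assumes "p \<ge> 1" "pd (VM (p - 1)) (Q * f) = 0"
  shows "f = 0"
proof -
  let ?d = "pd (VM (p - 1))"
  \<comment> \<open>Here \<open>\<partial>Q/\<partial>x\<^sub>p = p\<close> is used.\<close>
  have leibniz: "(?d ^^ Suc n) (Q * f) = Q * (?d ^^ Suc n) f + of_nat (Suc n * p) * (?d ^^ n) f" for n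
  proof (induction n)
    case 0
    show ?case by (simp add: pd_mult pd_Q[OF assms(1), unfolded One_nat_def] add.commute)
  next
    case (Suc n)
    have "?d (of_nat (Suc n * p) * g) = of_nat (Suc n * p) * ?d g" for g
      by (metis Const_of_nat pd_Const_mult)
    then have "(?d ^^ Suc (Suc n)) (Q * f) = (of_nat p * (?d ^^ Suc n) f + Q * (?d ^^ Suc (Suc n)) f) +
        of_nat (Suc n * p) * (?d ^^ Suc n) f"
      using Suc by (simp add: pd_add pd_mult pd_Q[OF assms(1), unfolded One_nat_def])
    then show ?case
      by (simp add: algebra_simps)
  qed
  have "(?d ^^ Suc n) (Q * f) = 0" for n
    by (induction n) (use assms(2) in simp_all)
  with leibniz have *: "Q * (?d ^^ Suc n) f + of_nat (Suc n * p) * (?d ^^ n) f = 0" for n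
    by metis
  obtain m where "(?d ^^ m) f = 0"
    using pd_power_0[of "VM (p - 1)" f] by (elim exE)
  then show "f = 0"
  proof (induction m)
    case (Suc m)
    obtain j where "Suc m * p = Suc j"
      using assms(1) by (metis Suc_le_D mult_le_mono nat_mult_1 One_nat_def Suc_le_mono zero_le)
    then have "of_nat (Suc j) * (?d ^^ m) f = 0"
      using *[of m] Suc.prems by simp
    then have "(?d ^^ m) f = 0"
      by (rule of_nat_mult_cancel_pol)
    then show ?case by (rule Suc.IH)
  qed simp
qed

lemma Q_mult_eq_0: "p \<ge> 1 \<Longrightarrow> Q * f = 0 \<Longrightarrow> f = 0"
  using Q_mult_pd_0[of f] by simp

lemma Q_dvd_pd_0: "p \<ge> 1 \<Longrightarrow> Q dvd f \<Longrightarrow> pd (VM (p - 1)) f = 0 \<Longrightarrow> f = 0"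
  by (metis Q_mult_pd_0 dvdE mult_zero_right)

lemma Q_dvd_Const: "Q dvd Const c \<Longrightarrow> c = 0"
proof (cases "p \<ge> 1")
  case True
  then show "Q dvd Const c \<Longrightarrow> c = 0"
    using Q_dvd_pd_0[of "Const c"] by simp
next
  case False
  then have "{..<p} = {}"
    by auto
  then show "Q dvd Const c \<Longrightarrow> c = 0"
    by (simp add: Q_def)
qed

text \<open>
  Differentiate \<open>k\<close> times with respect to \<open>l\<^sub>p\<close>, in which \<open>z\<close> is linear with coefficient \<open>1\<close>.
\<close>

lemma Q_dvd_symbol: 
  assumes "p \<ge> 1" "M_pol a" "Q dvd a * z ^ k"
  shows "Q dvd a"
  using assms(2,3)
proof (induction k arbitrary: a)
  case (Suc k)
  have pd_z: "pd (VL (p - 1)) z = 1"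
  proof -
    have "pd (VL (p - 1)) (Var (VL (p - 1 - i)) * b i) = (if i = 0 then 1 else 0)" if "i < p" for i
    proof -
      have "p - 1 - i = p - 1 \<longleftrightarrow> i = 0"
        using that by auto
      then show ?thesis
        by (simp add: pd_mult pd_Var pd_VL_M_pol[OF M_pol_b])
    qed
    then have "pd (VL (p - 1)) z = (\<Sum>i<p. if i = 0 then 1 else 0)"
      unfolding z_def pd_sum by (intro sum.cong) auto
    then show ?thesis using assms(1) by simp
  qed
  have pd_power: "pd (VL (p - 1)) (z ^ n) = of_nat n * z ^ (n - 1)" for n
  proof (induction n)
    case (Suc n)
    then show ?case
      by (cases n) (simp_all add: pd_mult pd_z[unfolded One_nat_def] algebra_simps)
  qed simp
  obtain r where "a * z ^ Suc k = Q * r"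
    using Suc.prems(2) by (auto elim: dvdE)
  then have "pd (VL (p - 1)) (a * z ^ Suc k) = Q * pd (VL (p - 1)) r"
    by (simp only: pd_mult pd_VL_M_pol[OF M_pol_Q] mult_zero_left add_0_left)
  then have "Q dvd Const (of_nat (Suc k)) * (a * z ^ k)"
    by (simp only: pd_mult pd_VL_M_pol[OF Suc.prems(1)] pd_power mult_zero_left add_0_left diff_Suc_1 Const_of_nat)
       (metis dvd_triv_left mult.left_commute)
  then have "Q dvd a * z ^ k"
    by (rule Const_mult_dvd_cancel[rotated]) (simp del: of_nat_Suc)
  with Suc.prems(1) show ?case by (rule Suc.IH)
qed simp

text \<open>
  Below level \<open>p\<close> the derivative of the symbol with respect to \<open>l\<^sub>p\<close> has negative level, so it is \<open>0\<close>,
  and then so is the symbol, unless it has degree \<open>0\<close>.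
\<close>

lemma low_level_M_pol:
  assumes "homog level d (\<Phi> u)" "d < int p" "\<And>n. n > 0 \<Longrightarrow> U_M n * u \<in> K"
  shows "M_pol (\<Phi> u)"
proof -
  have "\<Phi> u \<in> filt (Suc k) \<Longrightarrow> M_pol (\<Phi> u)" for k
  proof (induction k)
    case (Suc k)
    let ?s = "hcomp ldeg (Suc k) (\<Phi> u)"
    have "?s = 0"
    proof (rule symbol_eq_0)
      show "homog ldeg (int (Suc k)) ?s" by (rule homog_hcomp)
      show "D (int n) ?s = 0" if "n \<ge> 1" for n
        using symbol_killed[OF Suc.prems, of 0 "int n"] assms(3)[of "int n"] that by (simp add: mem_K_iff)
      show "pd (VL (p - 1)) ?s = 0" if "p \<ge> 1"
        using homog_pd[OF homog_hcomp_other[OF assms(1)], of "VL (p - 1)"] assms(2) that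
        by (intro homog_neg) (auto simp: of_nat_diff)
    qed
    with diff_hcomp_wdeg_lt[OF Suc.prems] show ?case
      by (intro Suc.IH) simp
  qed (simp add: homog_0_iff_wdeg_lt)
  then show ?thesis
    using wdeg_lt_exists[of "\<Phi> u" ldeg] wdeg_lt_mono[of "\<Phi> u" ldeg _ "Suc _"] by (meson le_SucI order_refl)
qed

lemma ad_level_Z: "ad_level (int p) Z"
  unfolding Z_def
proof (rule ad_level_sum)
  fix i
  assume i: "i \<in> {..<p}"
  then have "int p = int i + - (- int (p - 1 - i) - 1)"
    by auto
  with ad_level_mult[OF ad_level_lift[OF homog_b] ad_level_L, of i] i
  show "ad_level (int p) (lift (b i) * U_L (- int (p - 1 - i) - 1))"
    by (metis lessThan_iff)
qed

lemma M_Z: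
  assumes I: "left_ideal I" "K \<subseteq> I" and v: "hw_M I v"
  shows "U_M n * (Z * v) - Z * (U_M n * v) - lift (\<Sum>i<p. coef n (p - 1 - i) * b i) * v \<in> I"
proof -
  have "U_M n * (lift (b i) * U_L (- int k - 1) * v) - lift (b i) * U_L (- int k - 1) * (U_M n * v) -
      lift (coef n k * b i) * v = lift (b i) * (M_bracket n k * v - lift (coef n k) * v)" for i k
  proof -
    have "U_M n * (lift (b i) * U_L (- int k - 1) * v) = lift (b i) * (U_M n * U_L (- int k - 1)) * v"
      by (simp add: lift_commute_M[OF M_pol_b] mult.assoc [symmetric])
    moreover have "lift (coef n k * b i) = lift (b i) * lift (coef n k)"
      by (metis M_pol_coef lift_mult mult.commute)
    ultimately show ?thesis
      by (simp add: M_L_bracket distrib_left distrib_right right_diff_distrib mult.assoc)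
  qed
  then have "U_M n * (Z * v) - Z * (U_M n * v) - lift (\<Sum>i<p. coef n (p - 1 - i) * b i) * v =
      (\<Sum>i<p. lift (b i) * (M_bracket n (p - 1 - i) * v - lift (coef n (p - 1 - i)) * v))"
    unfolding Z_def lift_sum sum_distrib_left sum_distrib_right sum_subtractf [symmetric]
    by (intro sum.cong refl) (simp only:)
  also have "\<dots> \<in> I"
    by (intro left_ideal_sum left_ideal_mult hw_M_bracket I v)
  finally show ?thesis .
qed

lemma M_pos_Z:
  assumes I: "left_ideal I" "K \<subseteq> I" and v: "hw_M I v" and n: "n > 0"
  shows "U_M n * (Z * v) \<in> I"
proof -
  have "(\<Sum>i<p. coef n (p - 1 - i) * b i) = 0"
    using b_relation[of "nat n"] n by simp
  with M_Z[OF I v, of n] have "U_M n * (Z * v) - Z * (U_M n * v) \<in> I"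
    by simp
  moreover have "Z * (U_M n * v) \<in> I"
    by (rule left_ideal_mult[OF I(1)]) (use v n in \<open>simp add: hw_M_def\<close>)
  ultimately show ?thesis
    using left_ideal_diff_iff[OF I(1)] by blast
qed

lemma M_0_Z:
  assumes I: "left_ideal I" "K \<subseteq> I" and v: "hw_M I v"
  shows "U_M 0 * (Z * v) - hM \<cdot> (Z * v) - lift Q * v \<in> I"
proof -
  have "Z * (U_M 0 * v - hM \<cdot> v) \<in> I"
    by (rule left_ideal_mult[OF I(1)]) (use v in \<open>simp add: hw_M_def\<close>)
  from left_ideal_add[OF I(1) M_Z[OF I v, of 0] this] show ?thesis
    by (simp add: Q_def right_diff_distrib algebra_simps)
qed

end

section \<open>The submodule generated by the singular vectors\<close>

context verma
begin

lemma M_pos_L: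
  assumes I: "left_ideal I" and v: "\<And>n. n > 0 \<Longrightarrow> U_M n * v \<in> I" and "m > 0" "n > 0"
  shows "U_M n * (U_L m * v) \<in> I"
proof -
  have "U_M n * (U_L m * v) = U_L m * (U_M n * v) + of_int (n - m) \<cdot> (U_M (n + m) * v)"
    using assms(3,4) uea_ML[of n m] by (simp add: mult.assoc [symmetric] distrib_right del: of_int_diff)
  also have "\<dots> \<in> I"
    using assms(3,4) by (intro left_ideal_add left_ideal_mult left_ideal_scale I v) auto
  finally show ?thesis .
qed

lemma level_0_multiple_of_one:
  assumes "homog level 0 (\<Phi> u)"
  shows "\<exists>a. u - a \<cdot> 1 \<in> K"
proof -
  have "\<Phi> u = Const (Poly_Mapping.lookup (\<Phi> u) {#})"
  proof (rule poly_mapping_eqI)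
    fix \<mu> :: "nvar multiset"
    have "int (wdeg level \<mu>) \<noteq> 0" if nonempty: "\<mu> \<noteq> {#}"
    proof -
      obtain v \<nu> where "\<mu> = add_mset v \<nu>"
        using nonempty by (meson multiset_cases)
      then show ?thesis by (cases v) auto
    qed
    then show "Poly_Mapping.lookup (\<Phi> u) \<mu> = Poly_Mapping.lookup (Const (Poly_Mapping.lookup (\<Phi> u) {#})) \<mu>"
      using homog_lookup[OF assms, of \<mu>] by (auto simp: lookup_Const)
  qed
  then have "\<Phi> (u - Poly_Mapping.lookup (\<Phi> u) {#} \<cdot> 1) = 0"
    by (simp add: \<Phi>_diff \<Phi>_scale)
  then show ?thesis
    by (auto simp: mem_K_iff)
qed

end

context verma_level
begin

lemma M_pos_Z_K: "n > 0 \<Longrightarrow> U_M n * Z \<in> K"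
  using M_pos_Z[OF left_ideal_K subset_refl hw_M_1[OF subset_refl], of n] by simp

lemma L_Z_M_pol:
  assumes "n > 0"
  shows "M_pol (\<Phi> (U_L n * Z))"
proof (rule low_level_M_pol)
  have "homog level (int p) (\<Phi> Z)"
    using homog_mult_ad_level[OF ad_level_Z, of 0 1] homog_Const[of level 1] by simp
  from homog_mult_ad_level[OF ad_level_L this]
  show "homog level (int p - n) (\<Phi> (U_L n * Z))"
    by simp
  show "int p - n < int p" using assms by simp
  show "U_M m * (U_L n * Z) \<in> K" if "m > 0" for m
    using M_pos_L[OF left_ideal_K M_pos_Z_K assms that] by simp
qed

text \<open>
  On the highest weight vector \<open>Q\<close> is \<open>(M\<^sub>0 - h\<^sub>M) Z\<close>. Moving \<open>L\<^sub>n\<close> to the right, the commutator with \<open>M\<^sub>0\<close>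
  is a multiple of \<open>M\<^sub>n\<close>, which kills \<open>Z\<close>; and \<open>L\<^sub>n Z\<close> has level below \<open>p\<close>, hence is a polynomial in
  the \<open>M\<close>'s, on which \<open>M\<^sub>0 - h\<^sub>M\<close> vanishes.
\<close>

lemma L_lift_Q:
  assumes n: "n > 0"
  shows "U_L n * lift Q \<in> K"
proof -
  note K = left_ideal_K
  define a where "a = \<Phi> (U_L n * Z)"
  have a: "M_pol a" "U_L n * Z - lift a \<in> K"
    using L_Z_M_pol[OF n] lift_\<Phi> by (auto simp: a_def)
  have "(U_M 0 - hM \<cdot> 1) * (U_L n * Z - lift a) \<in> K"
    by (rule left_ideal_mult[OF K a(2)])
  moreover have "lift a * (U_M 0 - hM \<cdot> 1) \<in> K"
    by (rule left_ideal_mult[OF K K_generators(4)])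
  moreover have "of_int n \<cdot> (U_M n * Z) \<in> K"
    by (rule left_ideal_scale[OF K M_pos_Z_K[OF n]])
  moreover have "U_L n * (U_M 0 * Z - hM \<cdot> Z - lift Q) \<in> K"
    using M_0_Z[OF K subset_refl hw_M_1[OF subset_refl]] by (intro left_ideal_mult[OF K]) simp
  ultimately have "(U_M 0 - hM \<cdot> 1) * (U_L n * Z - lift a) + lift a * (U_M 0 - hM \<cdot> 1) + of_int n \<cdot> (U_M n * Z)
      - U_L n * (U_M 0 * Z - hM \<cdot> Z - lift Q) \<in> K"
    using K by (meson left_ideal_add left_ideal_diff)
  moreover have "U_L n * (U_M 0 * Z) = U_M 0 * (U_L n * Z) + of_int n \<cdot> (U_M n * Z)"
    using n uea_LM[of n 0] by (simp add: mult.assoc [symmetric] distrib_right)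
  ultimately show ?thesis
    by (simp add: left_diff_distrib right_diff_distrib lift_commute_M[OF a(1)] algebra_simps)
qed

text \<open>
  The singular vector given by \<open>Q\<close> generates a copy of the Verma module with \<open>h\<^sub>L\<close> replaced by
  \<open>h\<^sub>L + p\<close>; in coordinates the embedding is multiplication by \<open>Q\<close>, as the \<open>M\<close>'s come last in the
  Poincare-Birkhoff-Witt order.
\<close>

lemma \<Phi>_mult_lift_Q: "\<Phi> (u * lift Q) = verma.\<Phi> (hL + of_nat p) hM cL cM u * Q"
proof -
  interpret S: verma "hL + of_nat p" hM cL cM .
  let ?I = "{u. u * lift Q \<in> K}"
  have "left_ideal ?I"
    using left_ideal_K by (auto simp: left_ideal_def distrib_right mult.assoc)
  moreover have "uea_gen g - S.weight g \<cdot> 1 \<in> ?I" if g: "nonneg g" for g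
  proof (cases g)
    case (genL n)
    then show ?thesis
      using L_lift_Q[of n] L0_homog[of "int p" "lift Q"] homog_Q g
      by (auto simp: left_diff_distrib nonneg_def split: if_splits)
  next
    case (genM n)
    have "lift Q * (uea_gen g - weight g \<cdot> 1) \<in> K"
      by (intro left_ideal_mult left_ideal_K K_nonneg g)
    then show ?thesis
      using genM by (simp add: left_diff_distrib right_diff_distrib lift_commute_M[OF M_pol_Q])
  next
    case genCL
    have "lift Q * (uea_gen g - weight g \<cdot> 1) \<in> K"
      by (intro left_ideal_mult left_ideal_K K_nonneg g)
    then show ?thesis
      using genCL by (simp add: left_diff_distrib right_diff_distrib uea_CL_central)
  next
    case genCM
    have "lift Q * (uea_gen g - weight g \<cdot> 1) \<in> K"
      by (intro left_ideal_mult left_ideal_K K_nonneg g)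
    then show ?thesis
      using genCM by (simp add: left_diff_distrib right_diff_distrib uea_CM_central)
  qed
  ultimately have "S.K \<subseteq> ?I"
    by (rule S.K_least)
  with S.lift_\<Phi>[of u] have "(u - lift (S.\<Phi> u)) * lift Q \<in> K"
    by blast
  then have "\<Phi> (u * lift Q) = \<Phi> (lift (S.\<Phi> u * Q))"
    by (simp add: mem_K_iff left_diff_distrib \<Phi>_diff lift_mult[OF M_pol_Q])
  then show ?thesis by simp
qed

definition J :: "uea set" where
  "J = {u. Q dvd \<Phi> u}"

lemma K_subset_J: "K \<subseteq> J"
  by (auto simp: J_def mem_K_iff)

lemma J_representative:
  assumes "u \<in> J"
  obtains f where "u - lift f * lift Q \<in> K"
proof -
  from assms obtain f where "\<Phi> u = Q * f"
    by (auto simp: J_def elim: dvdE)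
  then have "u - lift (f * Q) \<in> K"
    by (simp add: mem_K_iff \<Phi>_diff mult.commute)
  then show ?thesis
    using that by (simp add: lift_mult[OF M_pol_Q])
qed

lemma left_ideal_J: "left_ideal J"
  unfolding left_ideal_def
proof (intro conjI ballI allI)
  show "0 \<in> J" by (simp add: J_def)
  show "u + v \<in> J" if "u \<in> J" "v \<in> J" for u v
    using that by (simp add: J_def \<Phi>_add)
  show "y * u \<in> J" if u: "u \<in> J" for y u
  proof -
    obtain f where "u - lift f * lift Q \<in> K"
      using J_representative[OF u] .
    from \<Phi>_cong_K[OF this, of y] show ?thesis
      using \<Phi>_mult_lift_Q[of "y * lift f"] by (simp add: J_def mult.assoc)
  qed
qed

lemma lift_Q_J: "lift Q \<in> J"
  by (simp add: J_def)

lemma lift_J_iff: "lift f \<in> J \<longleftrightarrow> Q dvd f"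
  by (simp add: J_def)

lemma J_least: "left_ideal I \<Longrightarrow> K \<subseteq> I \<Longrightarrow> lift Q \<in> I \<Longrightarrow> J \<subseteq> I"
proof
  fix u
  assume I: "left_ideal I" "K \<subseteq> I" "lift Q \<in> I" and "u \<in> J"
  then obtain f where "u - lift f * lift Q \<in> K"
    using J_representative by blast
  then show "u \<in> I"
    using I left_ideal_diff_iff left_ideal_mult by blast
qed

lemma one_notin_J: "1 \<notin> J"
  using Q_dvd_Const[of 1] by (auto simp: J_def)

lemma E_Q: "n > 0 \<Longrightarrow> E n Q = 0"
proof -
  assume n: "n > 0"
  have "U_L n * lift Q - lift Q * U_L n - lift (E n Q) \<in> K"
    using L_lift[OF left_ideal_K subset_refl hw_M_1[OF subset_refl] M_pol_Q, of n] by simp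
  moreover have "U_L n * lift Q \<in> K" "lift Q * U_L n \<in> K"
    using L_lift_Q n by (auto intro: left_ideal_mult left_ideal_K K_generators)
  ultimately have "lift (E n Q) \<in> K"
    by (metis left_ideal_K left_ideal_diff left_ideal_diff_iff)
  then show "E n Q = 0"
    by (simp add: mem_K_iff)
qed

text \<open>
  The derivation of the \<open>M\<close>-polynomials induced by the commutator with \<open>Z\<close> (see \<open>Z_lift\<close>).
\<close>

definition EZ :: "nvar pol \<Rightarrow> nvar pol" where
  "EZ a = (\<Sum>i<p. b i * E (- int (p - 1 - i) - 1) a)"

lemma M_pol_EZ: "M_pol a \<Longrightarrow> M_pol (EZ a)"
  unfolding EZ_def by (intro homog_sum M_pol_mult M_pol_b M_pol_E)

lemma homog_EZ: "homog level d a \<Longrightarrow> homog level (d + int p) (EZ a)"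
  unfolding EZ_def
proof (rule homog_sum)
  fix i
  assume "homog level d a" "i \<in> {..<p}"
  then show "homog level (d + int p) (b i * E (- int (p - 1 - i) - 1) a)"
    by (intro homog_mult'[OF homog_b homog_E]) auto
qed

lemma Z_lift:
  assumes I: "left_ideal I" "K \<subseteq> I" and v: "hw_M I v" and a: "M_pol a"
  shows "Z * (lift a * v) - lift a * (Z * v) - lift (EZ a) * v \<in> I"
proof -
  have "lift (b i) * U_L m * (lift a * v) - lift a * (lift (b i) * U_L m * v) - lift (b i * E m a) * v =
      lift (b i) * (U_L m * (lift a * v) - lift a * (U_L m * v) - lift (E m a) * v)" for i m
  proof -
    have "lift a * (lift (b i) * U_L m * v) = lift (b i) * (lift a * (U_L m * v))"
      by (simp add: mult.assoc [symmetric] lift_commute[OF a M_pol_b])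
    moreover have "lift (b i * E m a) = lift (b i) * lift (E m a)"
      by (rule lift_mult) (rule M_pol_E[OF a])
    ultimately show ?thesis
      by (simp add: right_diff_distrib mult.assoc)
  qed
  then have "Z * (lift a * v) - lift a * (Z * v) - lift (EZ a) * v =
      (\<Sum>i<p. lift (b i) * (U_L (- int (p - 1 - i) - 1) * (lift a * v) -
        lift a * (U_L (- int (p - 1 - i) - 1) * v) - lift (E (- int (p - 1 - i) - 1) a) * v))"
    unfolding Z_def EZ_def lift_sum sum_distrib_left sum_distrib_right sum_subtractf [symmetric]
    by (intro sum.cong refl) (simp only:)
  also have "\<dots> \<in> I"
    by (intro left_ideal_sum left_ideal_mult L_lift I v a)
  finally show ?thesis .
qed

lemma hw_M_Z: "left_ideal I \<Longrightarrow> K \<subseteq> I \<Longrightarrow> hw_M I v \<Longrightarrow> lift Q * v \<in> I \<Longrightarrow> hw_M I (Z * v)"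
  using M_pos_Z[of I v] M_0_Z[of I v] left_ideal_diff_iff[of I "U_M 0 * (Z * v) - hM \<cdot> (Z * v)" "lift Q * v"]
  by (simp add: hw_M_def)

text \<open>
  \<open>[Z, Q]\<close> has level \<open>2 p > 0\<close>, so by \<open>kernel_E\<close> it is enough that the \<open>L\<^sub>n\<close> kill it modulo \<open>J\<close>. As
  \<open>Z Q\<close> lies in \<open>J\<close>, this concerns \<open>Q Z\<close>; there \<open>L\<^sub>n\<close> commutes with \<open>Q\<close> by \<open>E_Q\<close>, and \<open>Q L\<^sub>n Z\<close> is in \<open>J\<close>
  because \<open>L\<^sub>n Z\<close> is a polynomial in the \<open>M\<close>'s.
\<close>

lemma Q_dvd_EZ_Q: "Q dvd EZ Q"
proof (cases "p \<ge> 1")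
  case False
  then have "{..<p} = {}" by auto
  then show ?thesis by (simp add: EZ_def)
next
  case True
  note J = left_ideal_J K_subset_J
  have one: "hw_M J 1"
    by (rule hw_M_1[OF K_subset_J])
  have hw_Z: "hw_M J Z"
    using hw_M_Z[OF J one] lift_Q_J by simp
  show ?thesis
  proof (rule kernel_E)
    show "M_pol (EZ Q)" by (rule M_pol_EZ[OF M_pol_Q])
    show "homog level (int (2 * p)) (EZ Q)"
      using homog_EZ[OF homog_Q] by simp
    show "0 < 2 * p" using True by simp
    fix n :: nat
    assume "n \<ge> 1"
    then have n: "int n > 0" by simp
    define a where "a = \<Phi> (U_L (int n) * Z)"
    have a: "M_pol a" "U_L (int n) * Z - lift a \<in> K"
      using L_Z_M_pol[OF n] lift_\<Phi> by (auto simp: a_def)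
    have "lift Q * (U_L (int n) * Z - lift a) + lift a * lift Q \<in> J"
      using a(2) K_subset_J by (intro left_ideal_add left_ideal_mult J lift_Q_J) auto
    then have "lift Q * (U_L (int n) * Z) \<in> J"
      by (simp add: right_diff_distrib lift_commute[OF a(1) M_pol_Q])
    moreover have "U_L (int n) * (lift Q * Z) - lift Q * (U_L (int n) * Z) \<in> J"
      using L_lift[OF J hw_Z M_pol_Q, of "int n"] E_Q[OF n] by simp
    ultimately have 1: "U_L (int n) * (lift Q * Z) \<in> J"
      using left_ideal_diff_iff[OF J(1)] by blast
    have "Z * lift Q - lift Q * Z - lift (EZ Q) \<in> J"
      using Z_lift[OF J one M_pol_Q] by simp
    from left_ideal_mult[OF J(1) this, of "U_L (int n)"]
    have "U_L (int n) * Z * lift Q - U_L (int n) * (lift Q * Z) - U_L (int n) * lift (EZ Q) \<in> J"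
      by (simp add: right_diff_distrib mult.assoc)
    moreover have "U_L (int n) * Z * lift Q - U_L (int n) * (lift Q * Z) \<in> J"
      by (intro left_ideal_diff left_ideal_mult J lift_Q_J 1)
    ultimately have "U_L (int n) * lift (EZ Q) \<in> J"
      using left_ideal_diff_iff[OF J(1)] by blast
    moreover have "U_L (int n) * lift (EZ Q) - lift (EZ Q) * U_L (int n) - lift (E (int n) (EZ Q)) \<in> J"
      using L_lift[OF J one M_pol_EZ[OF M_pol_Q], of "int n"] by simp
    moreover have "lift (EZ Q) * U_L (int n) \<in> J"
      using K_subset_J K_generators(1)[OF n] by (intro left_ideal_mult J) auto
    ultimately have "lift (E (int n) (EZ Q)) \<in> J"
      using left_ideal_diff_iff[OF J(1)] left_ideal_diff[OF J(1)] by blast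
    then show "Q dvd E (int n) (EZ Q)"
      by (simp add: lift_J_iff)
  qed
qed

lemma lift_Q_Z:
  assumes v: "hw_M J v" "lift Q * v \<in> J"
  shows "lift Q * (Z * v) \<in> J"
proof -
  note J = left_ideal_J K_subset_J
  obtain r where "EZ Q = r * Q"
    using Q_dvd_EZ_Q by (metis dvdE mult.commute)
  then have "lift (EZ Q) * v = lift r * (lift Q * v)"
    by (simp add: lift_mult[OF M_pol_Q] mult.assoc)
  then have "lift (EZ Q) * v \<in> J" "Z * (lift Q * v) \<in> J"
    using v(2) by (simp_all add: left_ideal_mult[OF J(1)])
  with Z_lift[OF J v(1) M_pol_Q] show ?thesis
    by (metis J(1) left_ideal_diff left_ideal_diff_iff)
qed

text \<open>
  Modulo \<open>J\<close> the commutators of \<open>Z\<close> with \<open>M\<^sub>0\<close> and with \<open>Q\<close> are multiples of \<open>Q\<close>, which is why the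
  two statements are proved together.
\<close>

lemma Z_power_killed: "hw_M J (Z ^ k) \<and> lift Q * Z ^ k \<in> J"
proof (induction k)
  case 0
  show ?case using hw_M_1[OF K_subset_J] lift_Q_J by simp
next
  case (Suc k)
  then show ?case
    using hw_M_Z[OF left_ideal_J K_subset_J] lift_Q_Z by simp
qed

text \<open>
  If the symbol \<open>s\<close> had positive degree, then \<open>M\<^sub>0\<close> would act as \<open>h\<^sub>M\<close> (look at the top degree), so \<open>D 0 s\<close>
  would vanish as well as all \<open>D n s\<close>; but \<open>D 0 s = Q \<partial>s/\<partial>l\<^sub>p\<close>, so the whole gradient of \<open>s\<close> would
  be \<open>0\<close>. Hence \<open>u\<close> is an \<open>M\<close>-polynomial killed by all \<open>E n\<close>, and \<open>kernel_E\<close> applies.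
\<close>

lemma singular_in_J:
  assumes hom: "homog level (int d) (\<Phi> u)" and d: "d > 0"
    and L: "\<And>n. n > 0 \<Longrightarrow> U_L n * u \<in> K" and M: "\<And>n. n > 0 \<Longrightarrow> U_M n * u \<in> K"
    and M0: "U_M 0 * u - a \<cdot> u \<in> K"
  shows "u \<in> J"
proof -
  have "\<Phi> u \<in> filt (Suc k) \<Longrightarrow> M_pol (\<Phi> u)" for k
  proof (induction k)
    case (Suc k)
    let ?s = "hcomp ldeg (Suc k) (\<Phi> u)"
    have D: "D (int n) ?s = 0" if "n \<ge> 1" for n
      using symbol_killed[OF Suc.prems, of 0 "int n"] M[of "int n"] that by (simp add: mem_K_iff)
    have "\<Phi> (U_M 0 * u) = Const a * \<Phi> u"
      using M0 by (simp add: mem_K_iff \<Phi>_diff \<Phi>_scale)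
    with \<Phi>_M_leading[of 0 u "Suc k"] Suc.prems
    have lead: "Const (a - hM) * \<Phi> u - D 0 (\<Phi> u) \<in> filt k"
      by (simp add: Const_diff left_diff_distrib diff_diff_eq)
    have "?s = 0"
    proof (rule ccontr)
      assume s: "?s \<noteq> 0"
      have "hcomp ldeg (Suc k) (Const (a - hM) * \<Phi> u - D 0 (\<Phi> u)) = 0"
        by (rule hcomp_eq_0[OF wdeg_lt_mono[OF lead]]) simp
      moreover have "hcomp ldeg (Suc (Suc k)) (\<Phi> u) = 0"
        by (rule hcomp_eq_0[OF Suc.prems])
      ultimately have "Const (a - hM) * ?s = 0"
        by (simp add: hcomp_diff hcomp_D hcomp_mult_homog0)
      then have "a = hM"
        using s Const_mult_dvd_cancel[of "a - hM" 0 ?s] by auto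
      then have "D 0 (\<Phi> u) \<in> filt k"
        using wdeg_lt_minus[OF lead] by simp
      from hcomp_eq_0[OF this] have "D 0 ?s = 0"
        by (simp flip: hcomp_D)
      then have "Q * pd (VL (p - 1)) ?s = 0"
        using euler_ldeg(2)[of "Suc k" ?s 0] D homog_hcomp[of ldeg "Suc k"] by simp
      then have pd: "pd (VL (p - 1)) ?s = 0" if "p \<ge> 1"
        using Q_mult_eq_0[OF that] by simp
      have "?s = 0"
        by (rule symbol_eq_0[OF homog_hcomp D pd])
      with s show False ..
    qed
    with diff_hcomp_wdeg_lt[OF Suc.prems] show ?case
      by (intro Suc.IH) simp
  qed (simp add: homog_0_iff_wdeg_lt)
  then have M_pol: "M_pol (\<Phi> u)"
    using wdeg_lt_exists[of "\<Phi> u" ldeg] wdeg_lt_mono[of "\<Phi> u" ldeg _ "Suc _"] by (meson le_SucI order_refl)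
  have "Q dvd \<Phi> u"
  proof (rule kernel_E[OF M_pol hom d])
    fix n :: nat
    assume "n \<ge> 1"
    then have n: "int n > 0" by simp
    have "U_L (int n) * lift (\<Phi> u) - lift (\<Phi> u) * U_L (int n) - lift (E (int n) (\<Phi> u)) \<in> K"
      using L_lift[OF left_ideal_K subset_refl hw_M_1[OF subset_refl] M_pol, of "int n"] by simp
    moreover have "U_L (int n) * lift (\<Phi> u) \<in> K"
      using L[OF n] \<Phi>_mult_lift[of "U_L (int n)" u] by (simp add: mem_K_iff)
    moreover have "lift (\<Phi> u) * U_L (int n) \<in> K"
      by (intro left_ideal_mult left_ideal_K K_generators n)
    ultimately have "lift (E (int n) (\<Phi> u)) \<in> K"
      by (metis left_ideal_K left_ideal_diff left_ideal_diff_iff)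
    then show "Q dvd E (int n) (\<Phi> u)"
      by (simp add: mem_K_iff)
  qed
  then show ?thesis by (simp add: J_def)
qed

theorem singular_ideal_eq_J: "singular_ideal hL hM cL cM = J"
proof
  show "singular_ideal hL hM cL cM \<subseteq> J"
    unfolding singular_ideal_def Let_def
  proof (intro hull_minimal left_ideal_J Un_least K_subset_J subsetI)
    fix u
    assume "u \<in> {u. singular_mod K u \<and> \<not> multiple_of_one_mod K u}"
    then have u: "singular_mod K u" "\<not> multiple_of_one_mod K u" by auto
    then obtain a where "U_L 0 * u - a \<cdot> u \<in> K"
      by (auto simp: singular_mod_def eigenvector_mod_def)
    then obtain d where d: "homog level (int d) (\<Phi> u)"
      using homog_\<Phi>_eigenvector by blast
    have "d > 0"
      using level_0_multiple_of_one[of u] d u(2) by (cases "d = 0") (auto simp: multiple_of_one_mod_def)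
    moreover obtain c where "U_M 0 * u - c \<cdot> u \<in> K"
      using u(1) by (auto simp: singular_mod_def eigenvector_mod_def)
    ultimately show "u \<in> J"
      using singular_in_J[OF d] u(1) by (auto simp: singular_mod_def)
  qed
  show "J \<subseteq> singular_ideal hL hM cL cM"
    unfolding singular_ideal_def Let_def
  proof (rule J_least)
    let ?I = "left_ideal hull (K \<union> {u. singular_mod K u \<and> \<not> multiple_of_one_mod K u})"
    show "left_ideal ?I" by (rule left_ideal_hull_is)
    show "K \<subseteq> ?I"
      by (rule subset_trans[OF Un_upper1 hull_subset])
    show "lift Q \<in> ?I"
    proof (cases "p \<ge> 1")
      case False
      then have "{..<p} = {}" by auto
      then have "lift Q = 0" by (simp add: Q_def)
      then show ?thesis
        using left_ideal_0[OF \<open>left_ideal ?I\<close>] by simp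
    next
      case True
      have "Q \<noteq> 0"
        using Q_mult_eq_0[OF True, of 1] by auto
      then have notin: "lift Q \<notin> K"
        by (simp add: mem_K_iff)
      have "U_L 0 * lift Q - (hL + of_int (int p)) \<cdot> lift Q \<in> K"
        by (rule L0_homog) (simp add: homog_Q)
      moreover have g: "lift Q * (uea_gen g - weight g \<cdot> 1) \<in> K" if "nonneg g" for g
        by (intro left_ideal_mult left_ideal_K K_nonneg that)
      have "U_CL * lift Q - cL \<cdot> lift Q \<in> K" "U_CM * lift Q - cM \<cdot> lift Q \<in> K"
        "U_M 0 * lift Q - hM \<cdot> lift Q \<in> K"
        using g[of genCL] g[of genCM] g[of "genM 0"]
        by (simp_all add: right_diff_distrib lift_commute_M[OF M_pol_Q] uea_CL_central uea_CM_central nonneg_def)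
      moreover have "U_M n * lift Q \<in> K" if "n > 0" for n
        using g[of "genM n"] that by (simp add: right_diff_distrib lift_commute_M[OF M_pol_Q] nonneg_def)
      ultimately have "singular_mod K (lift Q)"
        using notin L_lift_Q by (auto simp: singular_mod_def eigenvector_mod_def)
      moreover have "\<not> multiple_of_one_mod K (lift Q)"
      proof
        assume "multiple_of_one_mod K (lift Q)"
        then obtain a where "Q = Const a"
          by (auto simp: multiple_of_one_mod_def mem_K_iff \<Phi>_diff \<Phi>_scale)
        then show False
          using Q_dvd_Const[of a] \<open>Q \<noteq> 0\<close> by auto
      qed
      ultimately show ?thesis
        by (intro hull_inc) auto
    qed
  qed
qed

end

section \<open>Vectors killed by the M-modes\<close>

locale resonant = verma_level +
  assumes p_pos: "p \<ge> 1"
begin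

lemma Z_leading:
  assumes "\<Phi> u \<in> filt (Suc k)"
  shows "\<Phi> (Z * u) - z * \<Phi> u \<in> filt (Suc k)"
proof -
  have *: "\<Phi> (lift (b i) * (U_L (- int j - 1) * u)) - Var (VL j) * b i * \<Phi> u \<in> filt (Suc k)" for i j
  proof -
    let ?x = "U_L (- int j - 1) * u"
    have 1: "\<Phi> ?x - Var (VL j) * \<Phi> u \<in> filt (Suc k)"
      using \<Phi>_var_leading[OF assms, of "VL j"] by simp
    have "Var (VL j) * \<Phi> u \<in> filt (Suc (Suc k))"
      using wdeg_lt_mult[of "Var (VL j)" ldeg 1, OF _ assms] by (simp add: wdeg_lt_Var)
    moreover have "\<Phi> ?x - Var (VL j) * \<Phi> u \<in> filt (Suc (Suc k))"
      by (rule wdeg_lt_mono[OF 1]) simp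
    ultimately have "\<Phi> ?x \<in> filt (Suc (Suc k))"
      using wdeg_lt_add by fastforce
    from lift_leading[OF M_pol_b this, of i]
    have "\<Phi> (lift (b i) * ?x) - b i * \<Phi> ?x \<in> filt (Suc k)" .
    moreover have "b i * (\<Phi> ?x - Var (VL j) * \<Phi> u) \<in> filt (Suc k)"
      by (rule filt_M_pol_mult[OF M_pol_b 1])
    ultimately have "(\<Phi> (lift (b i) * ?x) - b i * \<Phi> ?x) + b i * (\<Phi> ?x - Var (VL j) * \<Phi> u) \<in> filt (Suc k)"
      by (rule wdeg_lt_add)
    then show ?thesis
      by (simp add: right_diff_distrib mult_ac)
  qed
  have "\<Phi> (Z * u) - z * \<Phi> u = (\<Sum>i<p. \<Phi> (lift (b i) * (U_L (- int (p - 1 - i) - 1) * u)) -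
      Var (VL (p - 1 - i)) * b i * \<Phi> u)"
    by (simp add: Z_def z_def sum_distrib_right \<Phi>_sum sum_subtractf mult.assoc)
  also have "\<dots> \<in> filt (Suc k)"
    by (intro wdeg_lt_sum *)
  finally show ?thesis .
qed

lemma ldeg_z_power: "homog ldeg (int k) (z ^ k)"
  using homog_power[OF ldeg_z, of k] by simp

lemma Z_power_leading: "\<Phi> (Z ^ k) - z ^ k \<in> filt k"
proof (induction k)
  case (Suc k)
  have "\<Phi> (Z ^ k) - z ^ k \<in> filt (Suc k)"
    by (rule wdeg_lt_mono[OF Suc]) simp
  from wdeg_lt_add[OF this homog_imp_wdeg_lt[OF ldeg_z_power]]
  have "\<Phi> (Z ^ k) \<in> filt (Suc k)" by simp
  from Z_leading[OF this]
  have "\<Phi> (Z * Z ^ k) - z * \<Phi> (Z ^ k) \<in> filt (Suc k)" .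
  moreover have "z * (\<Phi> (Z ^ k) - z ^ k) \<in> filt (Suc k)"
    using wdeg_lt_mult[OF homog_imp_wdeg_lt[of ldeg 1] Suc] ldeg_z by simp
  ultimately have "(\<Phi> (Z * Z ^ k) - z * \<Phi> (Z ^ k)) + z * (\<Phi> (Z ^ k) - z ^ k) \<in> filt (Suc k)"
    by (rule wdeg_lt_add)
  then show ?case
    by (simp add: right_diff_distrib)
qed simp

lemma lift_Z_power_leading:
  assumes "M_pol a"
  shows "\<Phi> (lift a * Z ^ k) - a * z ^ k \<in> filt k"
proof -
  have "\<Phi> (Z ^ k) - z ^ k \<in> filt (Suc k)"
    by (rule wdeg_lt_mono[OF Z_power_leading]) simp
  from wdeg_lt_add[OF this homog_imp_wdeg_lt[OF ldeg_z_power]]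
  have "\<Phi> (Z ^ k) \<in> filt (Suc k)" by simp
  from wdeg_lt_add[OF lift_leading[OF assms this] filt_M_pol_mult[OF assms Z_power_leading]]
  show ?thesis by (simp add: right_diff_distrib)
qed

lemma homog_Z_power: "homog level (int (p * k)) (\<Phi> (Z ^ k))"
proof (induction k)
  case 0
  show ?case using homog_Const[of level 1] by simp
next
  case (Suc k)
  from homog_mult_ad_level[OF ad_level_Z this] show ?case
    by (simp add: algebra_simps)
qed

lemma homog_lift_Z_power:
  assumes "homog level (d - int (p * k)) a"
  shows "homog level d (\<Phi> (lift a * Z ^ k))"
  using homog_mult_ad_level[OF ad_level_lift[OF assms] homog_Z_power[of k]] by simp

lemma M_lift_Z_power:
  assumes "M_pol a" "n > 0"
  shows "U_M n * (lift a * Z ^ k) \<in> J"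
proof -
  have "lift a * (U_M n * Z ^ k) \<in> J"
    by (rule left_ideal_mult[OF left_ideal_J]) (use Z_power_killed[of k] assms(2) in \<open>simp add: hw_M_def\<close>)
  then show ?thesis
    by (simp add: mult.assoc [symmetric] lift_commute_M[OF assms(1)])
qed

text \<open>
  By \<open>symbol_power\<close> the symbol of degree \<open>k\<close> is \<open>a z\<^sup>k\<close> modulo \<open>Q\<close>, which is also the symbol of
  \<open>a Z\<^sup>k\<close>. Subtracting lowers the degree and keeps the hypotheses.
\<close>

lemma Z_expansion_filt:
  assumes "\<Phi> u \<in> filt k" "homog level d (\<Phi> u)" "\<And>n. n > 0 \<Longrightarrow> U_M n * u \<in> J"
  shows "\<exists>c. (\<forall>i. M_pol (c i) \<and> homog level (d - int (p * i)) (c i)) \<and>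
    u - (\<Sum>i<k. lift (c i) * Z ^ i) \<in> J"
  using assms
proof (induction k arbitrary: u)
  case 0
  then have "u \<in> J"
    using K_subset_J by (auto simp: mem_K_iff)
  then show ?case
    by (intro exI[of _ "\<lambda>_. 0"]) simp
next
  case (Suc k)
  let ?s = "hcomp ldeg k (\<Phi> u)"
  have D: "Q dvd D (int n) ?s" if "n \<ge> 1" for n
  proof (cases k)
    case 0
    then have "D (int n) ?s = 0"
      using D_M_pol[of ?s] homog_hcomp[of ldeg 0] by simp
    then show ?thesis by simp
  next
    case (Suc k')
    then show ?thesis
      using symbol_killed[of u k' Q "int n"] Suc.prems M_pol_Q that by (simp add: J_def)
  qed
  have s: "homog level d ?s"
    by (rule homog_hcomp_other[OF Suc.prems(2)])
  from symbol_power[OF M_pol_Q homog_hcomp s D p_pos]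
  obtain a where a: "M_pol a" "homog level (d - int (p * k)) a" "Q dvd ?s - a * z ^ k"
    by blast
  let ?u = "u - lift a * Z ^ k - lift (?s - a * z ^ k)"
  have "\<exists>c. (\<forall>i. M_pol (c i) \<and> homog level (d - int (p * i)) (c i)) \<and>
    ?u - (\<Sum>i<k. lift (c i) * Z ^ i) \<in> J"
  proof (rule Suc.IH)
    have "(\<Phi> u - ?s) - (\<Phi> (lift a * Z ^ k) - a * z ^ k) \<in> filt k"
      by (intro wdeg_lt_diff diff_hcomp_wdeg_lt Suc.prems(1) lift_Z_power_leading a)
    then show "\<Phi> ?u \<in> filt k"
      by (simp only: \<Phi>_diff \<Phi>_lift) (simp add: algebra_simps)
    have "homog level d (a * z ^ k)"
      using homog_mult'[OF a(2) homog_power[OF homog_z, of k]] by (simp add: mult.commute)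
    then show "homog level d (\<Phi> ?u)"
      unfolding \<Phi>_diff \<Phi>_lift by (intro homog_diff Suc.prems(2) homog_lift_Z_power a s)
    show "U_M n * ?u \<in> J" if n: "n > 0" for n
    proof -
      have "U_M n * lift (?s - a * z ^ k) \<in> J"
        by (rule left_ideal_mult[OF left_ideal_J]) (use a(3) in \<open>simp only: lift_J_iff\<close>)
      with Suc.prems(3)[OF n] M_lift_Z_power[OF a(1) n, of k] show ?thesis
        unfolding right_diff_distrib by (intro left_ideal_diff left_ideal_J)
    qed
  qed
  then obtain c where c: "\<forall>i. M_pol (c i) \<and> homog level (d - int (p * i)) (c i)"
    "?u - (\<Sum>i<k. lift (c i) * Z ^ i) \<in> J"
    by blast
  have "lift (?s - a * z ^ k) \<in> J"
    using a(3) by (simp only: lift_J_iff)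
  from left_ideal_add[OF left_ideal_J c(2) this]
  have "u - (\<Sum>i<Suc k. lift ((c(k := a)) i) * Z ^ i) \<in> J"
    by (simp add: algebra_simps)
  with c(1) a(1,2) show ?case
    by (intro exI[of _ "c(k := a)"]) simp
qed

lemma Z_expansion:
  assumes "homog level d (\<Phi> u)" "\<And>n. n > 0 \<Longrightarrow> U_M n * u \<in> J"
  obtains c where "\<And>i. M_pol (c i)" "\<And>i. homog level (d - int (p * i)) (c i)"
    "\<And>k. d < int (p * k) \<Longrightarrow> u - (\<Sum>i<k. lift (c i) * Z ^ i) \<in> J"
proof -
  obtain N where "\<Phi> u \<in> filt N"
    using wdeg_lt_exists by blast
  from Z_expansion_filt[OF this assms] obtain c
    where c: "\<And>i. M_pol (c i)" "\<And>i. homog level (d - int (p * i)) (c i)"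
      "u - (\<Sum>i<N. lift (c i) * Z ^ i) \<in> J"
    by blast
  define c' where "c' i = (if i < N then c i else 0)" for i
  have "u - (\<Sum>i<k. lift (c' i) * Z ^ i) \<in> J" if k: "d < int (p * k)" for k
  proof -
    have zero: "c' i = 0" if "i \<ge> k" for i
    proof -
      have "int (p * k) \<le> int (p * i)"
        using that by (simp only: of_nat_le_iff mult_le_mono)
      then have "c i = 0"
        using k by (intro homog_neg[OF c(2)]) linarith
      then show ?thesis by (simp add: c'_def)
    qed
    have "(\<Sum>i<N. lift (c i) * Z ^ i) = (\<Sum>i<max N k. lift (c' i) * Z ^ i)"
      by (intro sum.mono_neutral_cong_left) (auto simp: c'_def)
    also have "\<dots> = (\<Sum>i<k. lift (c' i) * Z ^ i)"
      by (intro sum.mono_neutral_right) (auto simp: zero)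
    finally show ?thesis
      using c(3) by simp
  qed
  then show ?thesis
    using c(1,2) by (intro that[of c']) (simp_all add: c'_def)
qed

subsection \<open>The filtration by powers of Z\<close>

text \<open>
  \<open>W k\<close> is \<open>J + \<Sum>\<^bsub>i<k\<^esub> A Z\<^sup>i\<close> with \<open>A\<close> the polynomials in the \<open>M\<close>'s. It is used for calculations with
  leading terms.
\<close>

primrec W :: "nat \<Rightarrow> uea set" where
  "W 0 = J"
| "W (Suc k) = {u. \<exists>a. M_pol a \<and> u - lift a * Z ^ k \<in> W k}"

lemma W_add: "u \<in> W k \<Longrightarrow> v \<in> W k \<Longrightarrow> u + v \<in> W k"
proof (induction k arbitrary: u v)
  case (Suc k)
  then obtain a c where "M_pol a" "u - lift a * Z ^ k \<in> W k" "M_pol c" "v - lift c * Z ^ k \<in> W k"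
    by auto
  with Suc.IH[of "u - lift a * Z ^ k" "v - lift c * Z ^ k"] show ?case
    by (auto simp: lift_add algebra_simps intro!: exI[of _ "a + c"] homog_add)
qed (simp add: left_ideal_add[OF left_ideal_J])

lemma W_lift: "M_pol a \<Longrightarrow> u \<in> W k \<Longrightarrow> lift a * u \<in> W k"
proof (induction k arbitrary: u)
  case (Suc k)
  then obtain c where c: "M_pol c" "u - lift c * Z ^ k \<in> W k"
    by auto
  with Suc.IH[of "u - lift c * Z ^ k"] Suc.prems(1) show ?case
    by (auto simp: lift_mult right_diff_distrib mult.assoc intro!: exI[of _ "a * c"] M_pol_mult)
qed (simp add: left_ideal_mult[OF left_ideal_J])

lemma W_scale: "u \<in> W k \<Longrightarrow> c \<cdot> u \<in> W k"
  using W_lift[of "Const c" u k] by simp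

lemma W_diff: "u \<in> W k \<Longrightarrow> v \<in> W k \<Longrightarrow> u - v \<in> W k"
  using W_add[of u k "(- 1) \<cdot> v"] W_scale[of v k "- 1"] by simp

lemma J_subset_W: "J \<subseteq> W k"
proof (induction k)
  case (Suc k)
  then show ?case
    by (auto intro!: exI[of _ 0])
qed simp

lemma W_mono: "k \<le> l \<Longrightarrow> W k \<subseteq> W l"
proof (induction l)
  case (Suc l)
  have "W l \<subseteq> W (Suc l)"
    by (auto intro!: exI[of _ 0])
  with Suc show ?case
    by (cases "k = Suc l") auto
qed simp

lemma W_term: "M_pol a \<Longrightarrow> i < k \<Longrightarrow> lift a * Z ^ i \<in> W k"
proof -
  assume a: "M_pol a" "i < k"
  have "0 \<in> W i"
    using J_subset_W left_ideal_0[OF left_ideal_J] by blast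
  then have "lift a * Z ^ i \<in> W (Suc i)"
    using a(1) by (auto intro!: exI[of _ a])
  then show "lift a * Z ^ i \<in> W k"
    using W_mono[of "Suc i" k] a(2) by auto
qed

lemma W_sum: "(\<And>i. i \<in> S \<Longrightarrow> f i \<in> W k) \<Longrightarrow> sum f S \<in> W k"
  by (induction S rule: infinite_finite_induct)
     (auto intro: W_add subsetD[OF J_subset_W left_ideal_0[OF left_ideal_J]])

lemma W_diff_iff: "u - v \<in> W k \<Longrightarrow> u \<in> W k \<longleftrightarrow> v \<in> W k"
  using W_add[of "u - v" k v] W_diff[of u k "u - v"] by auto

lemma Z_W: "u \<in> W k \<Longrightarrow> Z * u \<in> W (Suc k)"
proof (induction k arbitrary: u)
  case 0
  then show ?case
    using left_ideal_mult[OF left_ideal_J] J_subset_W[of "Suc 0"] by auto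
next
  case (Suc k)
  then obtain a where a: "M_pol a" "u - lift a * Z ^ k \<in> W k"
    by auto
  have "Z * (lift a * Z ^ k) - lift a * (Z * Z ^ k) - lift (EZ a) * Z ^ k \<in> W (Suc (Suc k))"
    using Z_lift[OF left_ideal_J K_subset_J conjunct1[OF Z_power_killed] a(1)] J_subset_W by blast
  moreover have "lift a * (Z * Z ^ k) \<in> W (Suc (Suc k))"
    using W_term[OF a(1), of "Suc k" "Suc (Suc k)"] by simp
  moreover have "lift (EZ a) * Z ^ k \<in> W (Suc (Suc k))"
    by (rule W_term[OF M_pol_EZ[OF a(1)]]) simp
  ultimately have "Z * (lift a * Z ^ k) \<in> W (Suc (Suc k))"
    using W_diff_iff by blast
  moreover have "Z * (u - lift a * Z ^ k) \<in> W (Suc (Suc k))"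
    using Suc.IH[OF a(2)] W_mono[of "Suc k" "Suc (Suc k)"] by auto
  ultimately have "Z * (u - lift a * Z ^ k) + Z * (lift a * Z ^ k) \<in> W (Suc (Suc k))"
    by (intro W_add)
  then show ?case
    by (simp only: right_diff_distrib diff_add_cancel)
qed

lemma low_level_W:
  assumes "homog level d (\<Phi> u)" "\<And>n. n > 0 \<Longrightarrow> U_M n * u \<in> J" "d < int (p * k)"
  shows "u \<in> W k"
proof -
  obtain c where c: "\<And>i. M_pol (c i)" "u - (\<Sum>i<k. lift (c i) * Z ^ i) \<in> J"
    using Z_expansion[OF assms(1,2)] assms(3) by metis
  moreover have "(\<Sum>i<k. lift (c i) * Z ^ i) \<in> W k"
    by (intro W_sum W_term c(1)) simp
  ultimately show ?thesis
    using J_subset_W W_diff_iff by blast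
qed

text \<open>
  The level of \<open>L\<^sub>n Z\<^sup>k\<close> is less than \<open>p k\<close>, which leaves no room for a term with \<open>Z\<^sup>k\<close>.
\<close>

lemma L_Z_power: "n > 0 \<Longrightarrow> U_L n * Z ^ k \<in> W k"
proof (rule low_level_W)
  assume n: "n > 0"
  show "homog level (int (p * k) - n) (\<Phi> (U_L n * Z ^ k))"
    using homog_mult_ad_level[OF ad_level_L[of n] homog_Z_power[of k]] by simp
  show "int (p * k) - n < int (p * k)"
    using n by simp
  show "U_M m * (U_L n * Z ^ k) \<in> J" if "m > 0" for m
    using M_pos_L[OF left_ideal_J _ n that] Z_power_killed[of k] by (simp add: hw_M_def)
qed

lemma L_lift_Z_power:
  assumes "n > 0" "M_pol a"
  shows "U_L n * (lift a * Z ^ k) - lift (E n a) * Z ^ k \<in> W k"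
proof -
  have "U_L n * (lift a * Z ^ k) - lift a * (U_L n * Z ^ k) - lift (E n a) * Z ^ k \<in> W k"
    using L_lift[OF left_ideal_J K_subset_J conjunct1[OF Z_power_killed] assms(2)] J_subset_W by blast
  from W_add[OF this W_lift[OF assms(2) L_Z_power[OF assms(1)]]] show ?thesis
    by (simp add: algebra_simps)
qed

lemma L_W: "n > 0 \<Longrightarrow> u \<in> W k \<Longrightarrow> U_L n * u \<in> W k"
proof (induction k arbitrary: u)
  case 0
  then show ?case by (simp add: left_ideal_mult[OF left_ideal_J])
next
  case (Suc k)
  then obtain a where a: "M_pol a" "u - lift a * Z ^ k \<in> W k"
    by auto
  have "U_L n * (u - lift a * Z ^ k) + (U_L n * (lift a * Z ^ k) - lift (E n a) * Z ^ k) \<in> W k"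
    using Suc a by (intro W_add L_lift_Z_power) auto
  then show ?case
    using M_pol_E[OF a(1)] by (auto simp: right_diff_distrib intro!: exI[of _ "E n a"])
qed

lemma \<Phi>_W: "u \<in> W k \<Longrightarrow> \<exists>f. \<Phi> u - Q * f \<in> filt k"
proof (induction k arbitrary: u)
  case 0
  then obtain f where "\<Phi> u = Q * f"
    by (auto simp: J_def elim: dvdE)
  then show ?case by (intro exI[of _ f]) simp
next
  case (Suc k)
  then obtain a where a: "M_pol a" "u - lift a * Z ^ k \<in> W k"
    by auto
  from Suc.IH[OF a(2)] obtain f where f: "\<Phi> (u - lift a * Z ^ k) - Q * f \<in> filt k" ..
  have "a * z ^ k \<in> filt (Suc k)"
    by (intro filt_M_pol_mult a homog_imp_wdeg_lt ldeg_z_power)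
  moreover have "\<Phi> (lift a * Z ^ k) - a * z ^ k \<in> filt (Suc k)"
    by (rule wdeg_lt_mono[OF lift_Z_power_leading[OF a(1)]]) simp
  ultimately have "\<Phi> (lift a * Z ^ k) \<in> filt (Suc k)"
    using wdeg_lt_add by fastforce
  from wdeg_lt_add[OF wdeg_lt_mono[OF f] this] show ?case
    by (intro exI[of _ f]) (simp add: \<Phi>_diff algebra_simps)
qed

text \<open>
  Independence of the powers of \<open>Z\<close> over \<open>A\<close> modulo \<open>Q\<close>, read off from the symbols \<open>a z\<^sup>k\<close>.
\<close>

lemma W_term_iff:
  assumes "M_pol a"
  shows "lift a * Z ^ k \<in> W k \<longleftrightarrow> Q dvd a"
proof
  assume "lift a * Z ^ k \<in> W k"
  then obtain f where "\<Phi> (lift a * Z ^ k) - Q * f \<in> filt k"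
    using \<Phi>_W by blast
  from wdeg_lt_diff[OF this lift_Z_power_leading[OF assms]]
  have "a * z ^ k - Q * f \<in> filt k"
    by simp
  from hcomp_eq_0[OF this] have "hcomp ldeg k (a * z ^ k) = Q * hcomp ldeg k f"
    by (simp add: hcomp_diff hcomp_mult_homog0[OF M_pol_Q])
  moreover have "homog ldeg (int k) (a * z ^ k)"
    by (rule homog_mult'[OF assms ldeg_z_power]) simp
  ultimately have "a * z ^ k = Q * hcomp ldeg k f"
    by (simp add: hcomp_homog)
  then show "Q dvd a"
    using Q_dvd_symbol[OF p_pos assms, of k] by simp
next
  assume "Q dvd a"
  then obtain f where "a = f * Q"
    by (metis dvdE mult.commute)
  then have "lift a * Z ^ k = lift f * (lift Q * Z ^ k)"
    by (simp add: lift_mult[OF M_pol_Q] mult.assoc)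
  then have "lift a * Z ^ k \<in> J"
    using Z_power_killed[of k] by (simp add: left_ideal_mult[OF left_ideal_J])
  then show "lift a * Z ^ k \<in> W k"
    using J_subset_W by blast
qed

lemma scale_Z_power_W_iff: "c \<cdot> Z ^ k \<in> W k \<longleftrightarrow> c = 0"
proof
  show "c \<cdot> Z ^ k \<in> W k \<Longrightarrow> c = 0"
    using W_term_iff[of "Const c" k] Q_dvd_Const by simp
  show "c = 0 \<Longrightarrow> c \<cdot> Z ^ k \<in> W k"
    using J_subset_W left_ideal_0[OF left_ideal_J] by auto
qed

end

section \<open>The eigenvalue of Lp on powers of Z\<close>

context resonant
begin

lemma M_L_neg:
  assumes "hw_M J v" "n > 0"
  shows "U_M n * (U_L (- int k - 1) * v) - lift (coef n k) * v \<in> J"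
proof -
  have "U_L (- int k - 1) * (U_M n * v) \<in> J"
    by (rule left_ideal_mult[OF left_ideal_J]) (use assms in \<open>simp add: hw_M_def\<close>)
  from left_ideal_add[OF left_ideal_J this hw_M_bracket[OF left_ideal_J K_subset_J assms(1), of n k]]
  have "(U_L (- int k - 1) * U_M n + M_bracket n k) * v - lift (coef n k) * v \<in> J"
    by (simp add: distrib_right mult.assoc add_diff_eq)
  then show ?thesis
    by (simp only: mult.assoc [symmetric] M_L_bracket)
qed

text \<open>
  Commuting \<open>L\<^sub>p\<close> past a factor \<open>M\<^bsub>-(k+1)\<^esub>\<close> leaves \<open>M\<^bsub>p-k-1\<^esub>\<close>, whose index is at least \<open>m\<close> since the monomial
  has level at most \<open>i = p - m\<close>. On \<open>w\<close> this acts nontrivially only if the index equals \<open>m\<close>, that is,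
  if the monomial is the single variable of level \<open>i\<close>.
\<close>

lemma L_p_monomial:
  assumes "m + i = p" "m > 0"
    and gt: "\<And>j. j > int m \<Longrightarrow> U_M j * w \<in> J" and eq: "U_M (int m) * w - c \<cdot> v \<in> J"
  shows "wdeg ldeg \<mu> = 0 \<Longrightarrow> wdeg level \<mu> \<le> i \<Longrightarrow>
    U_L (int p) * (lift (Poly_Mapping.single \<mu> 1) * w) - lift (Poly_Mapping.single \<mu> 1) * (U_L (int p) * w) -
    (if i > 0 \<and> \<mu> = {#VM (i - 1)#} then of_nat (p + i) * c else 0) \<cdot> v \<in> J"
proof (induction \<mu>)
  case empty
  have "lift (Poly_Mapping.single {#} 1) = 1"
    by (simp add: mono_word_def)
  then show ?case
    by (simp add: left_ideal_0[OF left_ideal_J] del: lift_single)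
next
  case (add x \<mu>)
  obtain k where x: "x = VM k"
    using add.prems by (cases x) auto
  let ?f = "Poly_Mapping.single \<mu> (1 :: complex)" and ?M = "U_M (- int k - 1)"
  have f: "M_pol ?f"
    using add.prems by (simp add: homog_def)
  have k: "Suc k + wdeg level \<mu> \<le> i"
    using add.prems x by simp
  have "\<not> (i > 0 \<and> \<mu> = {#VM (i - 1)#})"
    using k by auto
  with add.IH add.prems k have IH: "U_L (int p) * (lift ?f * w) - lift ?f * (U_L (int p) * w) \<in> J"
    by simp
  have lift_x: "lift (Poly_Mapping.single (add_mset x \<mu>) 1) = ?M * lift ?f"
    unfolding x Var_mult_single [symmetric] lift_mult_Var lift_commute_M[OF f] ..
  have ne: "int p \<noteq> int k + 1"
    using k assms(1,2) by auto
  define P where "P \<longleftrightarrow> i > 0 \<and> add_mset x \<mu> = {#VM (i - 1)#}"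
  have rest: "U_M (int p - int k - 1) * w - (if P then c else 0) \<cdot> v \<in> J"
  proof (cases "Suc k = i")
    case True
    then have "\<mu> = {#}"
      using k by (cases \<mu>) (auto, metis level.simps nvar.exhaust zero_neq_one nat.distinct(1))
    moreover have "int p - int k - 1 = int m"
      using True assms(1) by auto
    moreover have P
      using True x \<open>\<mu> = {#}\<close> by (auto simp: P_def)
    ultimately show ?thesis
      using eq by simp
  next
    case False
    then have "int p - int k - 1 > int m"
      using k assms(1) by auto
    moreover have "\<not> P"
      using False k x by (auto simp: P_def)
    ultimately show ?thesis
      using gt by simp
  qed
  have 1: "lift ?f * v' = v'" if "\<mu> = {#}" for v'
    using that by (simp add: mono_word_def)
  have M_bracket: "U_L (int p) * ?M = ?M * U_L (int p) + of_int (int p + int k + 1) \<cdot> U_M (int p - int k - 1)"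
    using L_M_bracket[of "int p" k] ne by (simp add: M_bracket_def)
  have "?M * (U_L (int p) * (lift ?f * w) - lift ?f * (U_L (int p) * w)) +
     of_int (int p + int k + 1) \<cdot> (lift ?f *
       (U_M (int p - int k - 1) * w - (if P then c else 0) \<cdot> v)) \<in> J"
    by (intro left_ideal_add[OF left_ideal_J] left_ideal_scale[OF left_ideal_J]
        left_ideal_mult[OF left_ideal_J IH] left_ideal_mult[OF left_ideal_J rest])
  moreover have "U_L (int p) * (?M * lift ?f * w) = ?M * (U_L (int p) * (lift ?f * w)) +
      of_int (int p + int k + 1) \<cdot> (lift ?f * (U_M (int p - int k - 1) * w))"
  proof -
    have "U_L (int p) * (?M * lift ?f * w) = (U_L (int p) * ?M) * (lift ?f * w)"
      by (simp only: mult.assoc)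
    also have "\<dots> = ?M * (U_L (int p) * (lift ?f * w)) +
        of_int (int p + int k + 1) \<cdot> ((U_M (int p - int k - 1) * lift ?f) * w)"
      unfolding M_bracket by (simp only: distrib_right mult.assoc uea_scale_mult_left)
    finally show ?thesis
      by (simp only: lift_commute_M[OF f] mult.assoc)
  qed
  moreover have "of_int (int p + int k + 1) \<cdot>
      (lift ?f * ((if P then c else 0) \<cdot> v)) =
      (if P then of_nat (p + i) * c else 0) \<cdot> v"
  proof (cases P)
    case True
    then have "\<mu> = {#}" "Suc k = i"
      using x by (auto simp: P_def)
    then have "lift ?f * (c \<cdot> v) = c \<cdot> v" "(of_int (int p + int k + 1) :: complex) = of_nat (p + i)"
      using 1 by auto
    with True show ?thesis
      by (simp only: if_True uea_scale_scale)
  qed simp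
  ultimately show ?case
    unfolding lift_x P_def [symmetric] right_diff_distrib uea_scale_diff_right mult.assoc
    by (simp only: algebra_simps)
qed

lemma L_p_lift:
  assumes "m + i = p" "m > 0" "i > 0"
    and "\<And>j. j > int m \<Longrightarrow> U_M j * w \<in> J" and "U_M (int m) * w - c \<cdot> v \<in> J"
    and a: "M_pol a" "homog level (int i) a"
  shows "U_L (int p) * (lift a * w) - lift a * (U_L (int p) * w) -
    (Poly_Mapping.lookup a {#VM (i - 1)#} * (of_nat (p + i) * c)) \<cdot> v \<in> J"
proof -
  let ?\<nu> = "{#VM (i - 1)#}"
  define T where "T \<mu> = U_L (int p) * (lift (Poly_Mapping.single \<mu> 1) * w) -
      lift (Poly_Mapping.single \<mu> 1) * (U_L (int p) * w) -
      (if \<mu> = ?\<nu> then of_nat (p + i) * c else 0) \<cdot> v" for \<mu>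
  have "(\<Sum>\<mu>\<in>Poly_Mapping.keys a. Poly_Mapping.lookup a \<mu> \<cdot> T \<mu>) \<in> J"
  proof (intro left_ideal_sum left_ideal_scale left_ideal_J)
    fix \<mu>
    assume "\<mu> \<in> Poly_Mapping.keys a"
    then have "wdeg ldeg \<mu> = 0" "wdeg level \<mu> \<le> i"
      using a by (auto simp: homog_def)
    from L_p_monomial[OF assms(1,2,4,5) this] show "T \<mu> \<in> J"
      using assms(3) by (simp add: T_def)
  qed
  moreover have "(\<Sum>\<mu>\<in>Poly_Mapping.keys a. Poly_Mapping.lookup a \<mu> \<cdot> T \<mu>) =
      U_L (int p) * (lift a * w) - lift a * (U_L (int p) * w) -
      (\<Sum>\<mu>\<in>Poly_Mapping.keys a. (Poly_Mapping.lookup a \<mu> * (if \<mu> = ?\<nu> then of_nat (p + i) * c else 0)) \<cdot> v)"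
    unfolding T_def lift_def[THEN fun_cong, unfolded uea_ext_def]
    by (simp add: lift_def uea_ext_def sum_distrib_left sum_distrib_right uea_scale_diff_right sum_subtractf)
  moreover have "(\<Sum>\<mu>\<in>Poly_Mapping.keys a. (Poly_Mapping.lookup a \<mu> * (if \<mu> = ?\<nu> then of_nat (p + i) * c else 0)) \<cdot> v)
      = (Poly_Mapping.lookup a ?\<nu> * (of_nat (p + i) * c)) \<cdot> v"
  proof -
    have "(\<Sum>\<mu>\<in>Poly_Mapping.keys a. (Poly_Mapping.lookup a \<mu> * (if \<mu> = ?\<nu> then of_nat (p + i) * c else 0)) \<cdot> v) =
        (\<Sum>\<mu>\<in>Poly_Mapping.keys a. if \<mu> = ?\<nu> then (Poly_Mapping.lookup a ?\<nu> * (of_nat (p + i) * c)) \<cdot> v else 0)"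
      by (rule sum.cong) auto
    then show ?thesis
      by (simp add: in_keys_iff)
  qed
  ultimately show ?thesis by simp
qed

text \<open>
  In the recursion for \<open>b i\<close> only the summand with \<open>b 0 = 1\<close> is linear; it is \<open>(2 p - i) x\<^sub>i\<close>.
\<close>

lemma b_linear_coefficient:
  assumes "0 < i" "i < p"
  shows "Poly_Mapping.lookup (b i) {#VM (i - 1)#} * (of_nat (p - i) * \<phi> (p - i)) = - of_nat (p - i + p)"
proof -
  let ?\<nu> = "{#VM (i - 1)#}"
  have "Poly_Mapping.lookup (Const (of_nat (p - i) * \<phi> (p - i)) * b i) ?\<nu> =
      - (\<Sum>j<i. Poly_Mapping.lookup (coef (int (p - i)) (p - 1 - j) * b j) ?\<nu>)"
    by (simp add: b_step[OF assms] Poly_Mapping.lookup_sum)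
  also have "(\<Sum>j<i. Poly_Mapping.lookup (coef (int (p - i)) (p - 1 - j) * b j) ?\<nu>) =
      (\<Sum>j<i. if j = 0 then of_nat (p - i + p) else 0)"
  proof (rule sum.cong)
    fix j
    assume "j \<in> {..<i}"
    then have j: "j < i" "1 \<le> p - i" "p - i \<le> p - 1 - j" "p - 1 - j - (p - i) = i - 1 - j"
      using assms by auto
    have "coef (int (p - i)) (p - 1 - j) = Const (of_nat (p - i + (p - 1 - j) + 1)) * Var (VM (i - 1 - j))"
      unfolding Const_of_nat using coef_Var[OF j(2,3)] j(4) by simp
    then have "Poly_Mapping.lookup (coef (int (p - i)) (p - 1 - j) * b j) ?\<nu> =
        of_nat (p - i + (p - 1 - j) + 1) * Poly_Mapping.lookup (Var (VM (i - 1 - j)) * b j) ?\<nu>"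
      by (simp only: mult.assoc lookup_Const_mult)
    also have "\<dots> = (if j = 0 then of_nat (p - i + p) else 0)"
    proof (cases "j = 0")
      case True
      then show ?thesis
        using assms by (simp add: Var_def)
    next
      case False
      then have "i - 1 - j \<noteq> i - 1"
        using j(1) by auto
      with False show ?thesis
        by (simp add: lookup_Var_mult)
    qed
    finally show "Poly_Mapping.lookup (coef (int (p - i)) (p - 1 - j) * b j) ?\<nu> = (if j = 0 then of_nat (p - i + p) else 0)" .
  qed simp
  finally have "of_nat (p - i) * \<phi> (p - i) * Poly_Mapping.lookup (b i) ?\<nu> = - of_nat (p - i + p)"
    using assms(1) by simp
  then show ?thesis
    by (simp only: ac_simps)
qed

text \<open>
  The contribution of the \<open>i\<close>-th summand \<open>b i L\<^bsub>-(p-i)\<^esub>\<close> of \<open>Z\<close> to the scalar by which \<open>[L\<^sub>p, Z]\<close> acts on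
  \<open>Z\<^sup>k\<close>, up to \<open>W k\<close>: the first summand gives the Virasoro term \<open>2 p L\<^sub>0 + (p\<^sup>3 - p) c\<^sub>L / 12\<close>, the others
  enter through the linear coefficients of the \<open>b i\<close>.
\<close>

definition \<delta>_term :: "nat \<Rightarrow> nat \<Rightarrow> complex" where
  "\<delta>_term k i = (if i = 0 then 2 * of_nat p * (hL + of_nat (p * k)) + (of_nat p ^ 3 - of_nat p) / 12 * cL
     else - ((2 * of_nat p - of_nat i) * (of_nat p + of_nat i)))"

definition \<delta> :: "nat \<Rightarrow> complex" where
  "\<delta> k = (\<Sum>i<p. \<delta>_term k i)"

lemma L_p_Z_term:
  assumes i: "i < p"
  defines "X \<equiv> U_L (- int (p - 1 - i) - 1)"
  shows "U_L (int p) * (lift (b i) * (X * Z ^ k)) - lift (b i) * (X * (U_L (int p) * Z ^ k)) - \<delta>_term k i \<cdot> Z ^ k \<in> W k"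
proof (cases "i = 0")
  case True
  then have X: "X = U_L (- int p)"
    using i by (simp add: X_def of_nat_diff)
  have L0: "U_L 0 * Z ^ k - (hL + of_nat (p * k)) \<cdot> Z ^ k \<in> J"
    using L0_homog[OF homog_Z_power, of k] K_subset_J by auto
  have CL: "U_CL * Z ^ k - cL \<cdot> Z ^ k \<in> J"
  proof -
    have "Z ^ k * (U_CL - cL \<cdot> 1) \<in> K"
      by (intro left_ideal_mult left_ideal_K K_generators)
    then show ?thesis
      using K_subset_J by (auto simp: right_diff_distrib uea_CL_central)
  qed
  have "(2 * of_nat p) \<cdot> (U_L 0 * Z ^ k - (hL + of_nat (p * k)) \<cdot> Z ^ k) +
      ((of_nat p ^ 3 - of_nat p) / 12) \<cdot> (U_CL * Z ^ k - cL \<cdot> Z ^ k) \<in> J"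
    by (intro left_ideal_add[OF left_ideal_J] left_ideal_scale[OF left_ideal_J] L0 CL)
  moreover have "U_L (int p) * (X * Z ^ k) = X * (U_L (int p) * Z ^ k) + (2 * of_nat p) \<cdot> (U_L 0 * Z ^ k) +
      ((of_nat p ^ 3 - of_nat p) / 12) \<cdot> (U_CL * Z ^ k)"
  proof -
    have "U_L (int p) * (X * Z ^ k) = (U_L (int p) * X) * Z ^ k"
      by (simp only: mult.assoc)
    then show ?thesis
      unfolding X uea_LL[of "int p" "- int p"] by (simp add: distrib_right mult.assoc)
  qed
  ultimately have "U_L (int p) * (X * Z ^ k) - X * (U_L (int p) * Z ^ k) - \<delta>_term k 0 \<cdot> Z ^ k \<in> J"
    by (simp add: \<delta>_term_def uea_scale_diff_right uea_scale_add_left uea_scale_add_right diff_diff_eq algebra_simps)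
  then show ?thesis
    using True J_subset_W by auto
next
  case False
  define m where "m = p - i"
  have m: "m + i = p" "m > 0" "i > 0" "Suc (p - 1 - i) = m" and X: "X = U_L (- int m)"
    using False i by (auto simp: m_def X_def)
  have v: "hw_M J (Z ^ k)"
    using Z_power_killed by blast
  have "U_M j * (X * Z ^ k) \<in> J" if "j > int m" for j
    using M_L_neg[OF v, of j "p - 1 - i"] coef_eq_0[of "p - 1 - i" j] that m by (simp add: X_def)
  moreover have "U_M (int m) * (X * Z ^ k) - (of_nat m * \<phi> m) \<cdot> Z ^ k \<in> J"
  proof -
    have "int m = int (p - 1 - i) + 1"
      using m by simp
    then have "coef (int m) (p - 1 - i) = Const (of_nat m * \<phi> m)"
      using coef_diag[of "p - 1 - i"] unfolding m(4) by (simp only:)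
    then show ?thesis
      using M_L_neg[OF v, of "int m" "p - 1 - i"] m(2) by (simp add: X_def)
  qed
  ultimately have "U_L (int p) * (lift (b i) * (X * Z ^ k)) - lift (b i) * (U_L (int p) * (X * Z ^ k)) -
    (Poly_Mapping.lookup (b i) {#VM (i - 1)#} * (of_nat (p + i) * (of_nat m * \<phi> m))) \<cdot> Z ^ k \<in> J"
    by (rule L_p_lift[OF m(1-3) _ _ M_pol_b homog_b[OF i]])
  moreover have "Poly_Mapping.lookup (b i) {#VM (i - 1)#} * (of_nat (p + i) * (of_nat m * \<phi> m)) = \<delta>_term k i"
    using b_linear_coefficient[OF m(3) i] i m(3)
    by (simp add: \<delta>_term_def m_def of_nat_diff mult.left_commute[of "Poly_Mapping.lookup _ _" "of_nat (p + i)"] del: of_nat_add)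
       (simp add: algebra_simps)
  ultimately have "U_L (int p) * (lift (b i) * (X * Z ^ k)) - lift (b i) * (U_L (int p) * (X * Z ^ k)) -
      \<delta>_term k i \<cdot> Z ^ k \<in> W k"
    using J_subset_W by auto
  moreover have "of_int (int p + int m) \<cdot> (lift (b i) * (U_L (int i) * Z ^ k)) \<in> W k"
    by (intro W_scale W_lift M_pol_b L_Z_power) (simp add: m)
  ultimately have "U_L (int p) * (lift (b i) * (X * Z ^ k)) - lift (b i) * (U_L (int p) * (X * Z ^ k)) -
      \<delta>_term k i \<cdot> Z ^ k + of_int (int p + int m) \<cdot> (lift (b i) * (U_L (int i) * Z ^ k)) \<in> W k"
    by (rule W_add)
  moreover have "U_L (int p) * (X * Z ^ k) = X * (U_L (int p) * Z ^ k) + of_int (int p + int m) \<cdot> (U_L (int i) * Z ^ k)"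
  proof -
    have "int p + - int m = int i" "int i \<noteq> 0"
      using m by auto
    then have "U_L (int p) * X = X * U_L (int p) + of_int (int p + int m) \<cdot> U_L (int i)"
      unfolding X uea_LL[of "int p" "- int m"] by simp
    then show ?thesis
      by (simp add: mult.assoc [symmetric] distrib_right)
  qed
  ultimately show ?thesis
    by (simp add: distrib_left algebra_simps del: of_int_add)
qed

lemma L_p_Z:
  "U_L (int p) * (Z * Z ^ k) - Z * (U_L (int p) * Z ^ k) - \<delta> k \<cdot> Z ^ k \<in> W k"
proof -
  have scale_sum: "(\<Sum>i<n. f i) \<cdot> (u :: uea) = (\<Sum>i<n. f i \<cdot> u)" for n :: nat and f u
    by (induction n) (simp_all add: uea_scale_add_left)
  have "(\<Sum>i<p. U_L (int p) * (lift (b i) * (U_L (- int (p - 1 - i) - 1) * Z ^ k)) -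
      lift (b i) * (U_L (- int (p - 1 - i) - 1) * (U_L (int p) * Z ^ k)) - \<delta>_term k i \<cdot> Z ^ k) \<in> W k"
    by (intro W_sum L_p_Z_term) simp
  then show ?thesis
    by (simp only: Z_def \<delta>_def scale_sum sum_distrib_left sum_distrib_right sum_subtractf mult.assoc)
qed

lemma \<delta>_formula:
  "\<delta> k = 2 * of_nat p * hL + (of_nat p ^ 3 - of_nat p) / 12 * cL
      - of_nat p * (of_nat p - 1) * (13 * of_nat p + 1) / 6 + 2 * of_nat p ^ 2 * of_nat k"
proof -
  have sum: "(\<Sum>i<n. (2 * x - of_nat i) * (x + of_nat i)) = 2 * x ^ 2 * of_nat n +
      x * of_nat n * (of_nat n - 1) / 2 - (of_nat n - 1) * of_nat n * (2 * of_nat n - 1) / 6"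
    for n and x :: complex
    by (induction n) (simp_all add: field_simps power2_eq_square)
  let ?A = "2 * of_nat p * (hL + of_nat (p * k)) + (of_nat p ^ 3 - of_nat p) / 12 * cL"
  have "\<delta> k = (\<Sum>i<p. (if i = 0 then ?A + 2 * of_nat p ^ 2 else 0) - (2 * of_nat p - of_nat i) * (of_nat p + of_nat i))"
    unfolding \<delta>_def \<delta>_term_def by (intro sum.cong) (auto simp: power2_eq_square)
  also have "\<dots> = ?A + 2 * of_nat p ^ 2 - (\<Sum>i<p. (2 * of_nat p - of_nat i) * (of_nat p + of_nat i))"
    using p_pos by (simp add: sum_subtractf)
  finally show ?thesis
    unfolding sum by (simp add: field_simps power2_eq_square power3_eq_cube)
qed

text \<open>
  The scalar \<open>\<gamma> k\<close> of \<open>L\<^sub>p Z\<^sup>k = \<gamma> k Z\<^bsup>k-1\<^esup> + \<dots>\<close>; each factor \<open>Z\<close> that \<open>L\<^sub>p\<close> passes contributes one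
  \<open>\<delta> j\<close>.
\<close>

definition \<gamma> :: "nat \<Rightarrow> complex" where
  "\<gamma> k = (\<Sum>j<k. \<delta> j)"

lemma \<gamma>_formula: "\<gamma> k = 2 * of_nat p * of_nat k * (hL - h' cL p k)"
proof -
  define A where "A = 2 * of_nat p * hL + (of_nat p ^ 3 - of_nat p) / 12 * cL
      - of_nat p * (of_nat p - 1) * (13 * of_nat p + 1) / 6"
  have "\<delta> j = A + 2 * of_nat p ^ 2 * of_nat j" for j
    unfolding \<delta>_formula A_def ..
  then have "\<gamma> k = of_nat k * A + of_nat p ^ 2 * of_nat k * (of_nat k - 1)"
    by (induction k) (simp_all add: \<gamma>_def algebra_simps)
  moreover have "n * (2 * x * h + (x ^ 3 - x) / 12 * c - x * (x - 1) * (13 * x + 1) / 6) + x ^ 2 * n * (n - 1) =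
      2 * x * n * (h - (- ((x ^ 2 - 1) / 24) * c + (13 * x + 1) * (x - 1) / 12 + (1 - n) * x / 2))"
    for n x h c :: complex
    by (simp add: field_simps power2_eq_square power3_eq_cube)
  ultimately show ?thesis
    by (simp only: h'_def A_def)
qed

lemma \<gamma>_eq_0_iff: "k \<ge> 1 \<Longrightarrow> \<gamma> k = 0 \<longleftrightarrow> hL = h' cL p k"
  using p_pos by (auto simp: \<gamma>_formula)

lemma L_p_Z_power: "U_L (int p) * Z ^ k - \<gamma> k \<cdot> Z ^ (k - 1) \<in> W (k - 1)"
proof (induction k)
  case 0
  have "U_L (int p) \<in> K"
    using p_pos by (intro K_generators) simp
  then show ?case
    using K_subset_J by (auto simp: \<gamma>_def)
next
  case (Suc k)
  have "Z * (U_L (int p) * Z ^ k) - \<gamma> k \<cdot> Z ^ k \<in> W k"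
  proof (cases k)
    case 0
    with Suc show ?thesis
      by (simp add: \<gamma>_def left_ideal_mult[OF left_ideal_J])
  next
    case (Suc k')
    from Z_W[OF Suc.IH] show ?thesis
      by (simp add: Suc right_diff_distrib)
  qed
  from W_add[OF L_p_Z this] show ?case
    by (simp add: \<gamma>_def uea_scale_add_left algebra_simps)
qed

lemma E_p_level_p:
  assumes "M_pol a" "homog level (int p) a"
  shows "E (int p) a = 0"
proof -
  obtain N where N: "vars_below N a"
    using vars_below_exists by blast
  have "coef (int p) k * pd (VM k) a = 0" for k
  proof -
    consider "Suc k < p" | "Suc k = p" | "Suc k > p" by linarith
    then show ?thesis
    proof cases
      case 1
      then show ?thesis by (simp add: coef_eq_0)
    next
      case 2
      then have "int p = int k + 1"
        by simp
      then have "coef (int p) k = Const (of_nat p * \<phi> p)"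
        using coef_diag[of k] 2 by (simp only:)
      then show ?thesis using \<phi>_p[OF p_pos] by simp
    next
      case 3
      have "pd (VM k) a = 0"
        using homog_pd[OF assms(2), of "VM k"] 3 by (intro homog_neg) auto
      then show ?thesis by simp
    qed
  qed
  then show ?thesis
    by (simp add: E_sum[OF N])
qed

text \<open>
  Besides \<open>c Z\<^bsup>k+1\<^esup>\<close>, only the term \<open>a Z\<^sup>k\<close> of \<open>u\<close> could contribute to \<open>Z\<^sup>k\<close> in \<open>L\<^sub>p u\<close>, with coefficient
  \<open>E p a\<close>. But \<open>a\<close> has level \<open>p\<close>, so \<open>E p a\<close> is \<open>p \<phi> p\<close> times its linear coefficient, which is \<open>0\<close>.
\<close>

lemma L_p_step:
  assumes hom: "homog level (int (p * Suc k)) (\<Phi> u)" and M: "\<And>n. n > 0 \<Longrightarrow> U_M n * u \<in> J"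
    and u: "u - c \<cdot> Z ^ Suc k \<in> W (Suc k)"
  shows "U_L (int p) * u - (c * \<gamma> (Suc k)) \<cdot> Z ^ k \<in> W k"
proof -
  define w where "w = u - c \<cdot> Z ^ Suc k"
  have w_hom: "homog level (int (p * Suc k)) (\<Phi> w)"
    unfolding w_def \<Phi>_diff \<Phi>_scale by (intro homog_diff hom homog_Const_mult homog_Z_power)
  have w_M: "U_M n * w \<in> J" if "n > 0" for n
    using left_ideal_diff[OF left_ideal_J M[OF that] left_ideal_scale[OF left_ideal_J, of "U_M n * Z ^ Suc k" c]]
      Z_power_killed[of "Suc k"] that by (simp add: w_def right_diff_distrib hw_M_def)
  obtain e where e: "\<And>i. M_pol (e i)" "\<And>i. homog level (int (p * Suc k) - int (p * i)) (e i)"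
    "\<And>k'. int (p * Suc k) < int (p * k') \<Longrightarrow> w - (\<Sum>i<k'. lift (e i) * Z ^ i) \<in> J"
    by (rule Z_expansion[OF w_hom w_M]) (assumption, rule that, assumption+)
  have "w - (\<Sum>i<Suc (Suc k). lift (e i) * Z ^ i) \<in> J"
    by (rule e(3)) (use p_pos in simp)
  then have exp: "w - (\<Sum>i<k. lift (e i) * Z ^ i) - lift (e k) * Z ^ k - lift (e (Suc k)) * Z ^ Suc k \<in> J"
    by (simp add: algebra_simps)
  have low: "(\<Sum>i<k. lift (e i) * Z ^ i) \<in> W k"
    by (intro W_sum W_term e(1)) simp
  have "lift (e (Suc k)) * Z ^ Suc k \<in> J"
  proof -
    have "w - (\<Sum>i<k. lift (e i) * Z ^ i) - lift (e k) * Z ^ k \<in> W (Suc k)"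
      using u low W_mono[of k "Suc k"] by (intro W_diff W_term e(1)) (auto simp: w_def simp del: W.simps)
    then have "lift (e (Suc k)) * Z ^ Suc k \<in> W (Suc k)"
      using exp J_subset_W W_diff_iff by blast
    then have "Q dvd e (Suc k)"
      using W_term_iff[OF e(1)] by blast
    then obtain f where "e (Suc k) = f * Q"
      by (metis dvdE mult.commute)
    then have "lift (e (Suc k)) * Z ^ Suc k = lift f * (lift Q * Z ^ Suc k)"
      by (simp add: lift_mult[OF M_pol_Q] mult.assoc)
    then show ?thesis
      using Z_power_killed[of "Suc k"] by (simp add: left_ideal_mult[OF left_ideal_J])
  qed
  from left_ideal_add[OF left_ideal_J exp this]
  have "w - (\<Sum>i<k. lift (e i) * Z ^ i) - lift (e k) * Z ^ k \<in> J"
    by simp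
  then have "(w - (\<Sum>i<k. lift (e i) * Z ^ i) - lift (e k) * Z ^ k) + (\<Sum>i<k. lift (e i) * Z ^ i) \<in> W k"
    using J_subset_W low by (intro W_add) auto
  then have "w - lift (e k) * Z ^ k \<in> W k"
    by (simp add: algebra_simps)
  then have "U_L (int p) * (w - lift (e k) * Z ^ k) \<in> W k"
    using p_pos by (intro L_W) simp_all
  moreover have "U_L (int p) * (lift (e k) * Z ^ k) \<in> W k"
  proof -
    have "homog level (int p) (e k)"
      using e(2)[of k] by (simp add: algebra_simps)
    then have "E (int p) (e k) = 0"
      by (rule E_p_level_p[OF e(1)])
    then show ?thesis
      using L_lift_Z_power[of "int p" "e k" k] e(1) p_pos by simp
  qed
  ultimately have "U_L (int p) * w \<in> W k"
    using W_diff_iff[of "U_L (int p) * w" "U_L (int p) * (lift (e k) * Z ^ k)"] by (simp add: right_diff_distrib)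
  from W_add[OF this W_scale[OF L_p_Z_power[of "Suc k", unfolded diff_Suc_1], of c]] show ?thesis
    by (simp add: w_def right_diff_distrib uea_scale_diff_right algebra_simps)
qed

lemma homog_level_0: "homog level 0 f \<Longrightarrow> \<exists>a. f = Const a"
proof -
  assume "homog level 0 f"
  then obtain a where "lift f - a \<cdot> 1 \<in> K"
    using level_0_multiple_of_one[of "lift f"] by auto
  then show ?thesis
    by (auto simp: mem_K_iff \<Phi>_diff \<Phi>_scale)
qed

lemma leading_term:
  assumes "\<And>i. M_pol (c i)" "u - (\<Sum>i<N. lift (c i) * Z ^ i) \<in> J" "u \<notin> J"
  shows "\<exists>k. \<not> Q dvd c k \<and> u - lift (c k) * Z ^ k \<in> W k"
  using assms(2)
proof (induction N)
  case (Suc N)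
  then have J: "u - (\<Sum>i<N. lift (c i) * Z ^ i) - lift (c N) * Z ^ N \<in> J"
    by (simp add: diff_diff_eq)
  show ?case
  proof (cases "Q dvd c N")
    case True
    then obtain f where "c N = f * Q"
      by (metis dvdE mult.commute)
    then have "lift (c N) * Z ^ N = lift f * (lift Q * Z ^ N)"
      by (simp add: lift_mult[OF M_pol_Q] mult.assoc)
    then have "lift (c N) * Z ^ N \<in> J"
      using Z_power_killed[of N] by (simp add: left_ideal_mult[OF left_ideal_J])
    with J have "u - (\<Sum>i<N. lift (c i) * Z ^ i) \<in> J"
      using left_ideal_diff_iff[OF left_ideal_J] by blast
    then show ?thesis by (rule Suc.IH)
  next
    case False
    have "(u - (\<Sum>i<N. lift (c i) * Z ^ i) - lift (c N) * Z ^ N) + (\<Sum>i<N. lift (c i) * Z ^ i) \<in> W N"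
      using J J_subset_W by (intro W_add W_sum W_term assms(1)) auto
    then have "u - lift (c N) * Z ^ N \<in> W N"
      by (simp add: algebra_simps)
    with False show ?thesis by blast
  qed
qed (use assms(3) in simp)

text \<open>
  The leading coefficient of the expansion of \<open>u\<close> in powers of \<open>Z\<close> is killed modulo \<open>Q\<close> by all \<open>E n\<close>,
  so it is a constant by \<open>kernel_E\<close>, and \<open>L_p_step\<close> compares the next leading terms.
\<close>

theorem subsingular_imp_\<gamma>_0:
  assumes "subsingular hL hM cL cM u"
  shows "\<exists>k\<ge>1. \<gamma> k = 0"
proof -
  have sing: "singular_mod J u" "\<not> multiple_of_one_mod J u" "eigenvector_mod K (U_L 0) u"
    using assms by (simp_all add: subsingular_def singular_ideal_eq_J)
  then have uJ: "u \<notin> J" and L: "\<And>n. n > 0 \<Longrightarrow> U_L n * u \<in> J" and M: "\<And>n. n > 0 \<Longrightarrow> U_M n * u \<in> J"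
    by (simp_all add: singular_mod_def eigenvector_mod_def)
  obtain d where d: "homog level (int d) (\<Phi> u)"
    using sing(3) homog_\<Phi>_eigenvector by (auto simp: eigenvector_mod_def)
  have "d > 0"
    using level_0_multiple_of_one[of u] d sing(2) K_subset_J
    by (cases "d = 0") (auto simp: multiple_of_one_mod_def)
  obtain c where c: "\<And>i. M_pol (c i)" "\<And>i. homog level (int d - int (p * i)) (c i)"
    "\<And>k. int d < int (p * k) \<Longrightarrow> u - (\<Sum>i<k. lift (c i) * Z ^ i) \<in> J"
    by (rule Z_expansion[OF d M]) (assumption, rule that, assumption+)
  have "int d < int (p * Suc d)"
    using p_pos by (cases p) (simp_all only: of_nat_less_iff, simp_all)
  from leading_term[OF c(1) c(3)[OF this] uJ] obtain k
    where k: "\<not> Q dvd c k" "u - lift (c k) * Z ^ k \<in> W k"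
    by blast
  have "Q dvd E (int n) (c k)" if n: "n \<ge> 1" for n
  proof -
    have "U_L (int n) * (u - lift (c k) * Z ^ k) + (U_L (int n) * (lift (c k) * Z ^ k) - lift (E (int n) (c k)) * Z ^ k) \<in> W k"
      using n by (intro W_add L_W k L_lift_Z_power c(1)) simp_all
    then have "U_L (int n) * u - lift (E (int n) (c k)) * Z ^ k \<in> W k"
      by (simp add: right_diff_distrib)
    moreover have "U_L (int n) * u \<in> W k"
      using L[of "int n"] n J_subset_W by auto
    ultimately have "lift (E (int n) (c k)) * Z ^ k \<in> W k"
      using W_diff_iff by blast
    then show ?thesis
      using W_term_iff[OF M_pol_E[OF c(1)]] by blast
  qed
  then have "\<not> 0 < int d - int (p * k)"
    using kernel_E[OF c(1), of "nat (int d - int (p * k))" k] c(2)[of k] k(1) by auto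
  moreover have "\<not> int d - int (p * k) < 0"
    using homog_neg[OF c(2)] k(1) by fastforce
  ultimately have dk: "d = p * k"
    by linarith
  then have "homog level 0 (c k)"
    using c(2)[of k] by simp
  then obtain e where e: "c k = Const e"
    using homog_level_0 by blast
  then have "e \<noteq> 0"
    using k(1) by auto
  obtain l where l: "k = Suc l"
    using \<open>d > 0\<close> dk by (cases k) auto
  have "U_L (int p) * u - (e * \<gamma> k) \<cdot> Z ^ l \<in> W l"
    using L_p_step[of l u e] d M k(2) e l dk by simp
  moreover have "U_L (int p) * u \<in> W l"
    using L[of "int p"] p_pos J_subset_W by auto
  ultimately have "e * \<gamma> k = 0"
    using W_diff_iff scale_Z_power_W_iff by blast
  then show ?thesis
    using \<open>e \<noteq> 0\<close> l by (intro exI[of _ k]) simp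
qed

end

section \<open>Existence of subsingular vectors\<close>

lemma homogeneous_system:
  fixes A :: "'e \<Rightarrow> 'i \<Rightarrow> 'f :: field"
  assumes "finite Es" "finite Is" "card Es < card Is"
  shows "\<exists>c. (\<exists>i\<in>Is. c i \<noteq> 0) \<and> (\<forall>e\<in>Es. (\<Sum>i\<in>Is. A e i * c i) = 0)"
  using assms
proof (induction Es arbitrary: Is A)
  case empty
  then obtain i where "i \<in> Is"
    by fastforce
  then show ?case
    by (intro exI[of _ "\<lambda>_. 1"]) auto
next
  case (insert e Es)
  show ?case
  proof (cases "\<forall>i\<in>Is. A e i = 0")
    case True
    with insert.IH[OF insert.prems(1), of A] insert show ?thesis
      by auto
  next
    case False
    then obtain i0 where i0: "i0 \<in> Is" "A e i0 \<noteq> 0"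
      by blast
    let ?I = "Is - {i0}"
    have "card Es < card ?I"
      using insert i0 by simp
    from insert.IH[OF _ this, of "\<lambda>f i. A f i - A f i0 * A e i / A e i0"] insert.prems(1)
    obtain c where c: "\<exists>i\<in>?I. c i \<noteq> 0"
      "\<And>f. f \<in> Es \<Longrightarrow> (\<Sum>i\<in>?I. (A f i - A f i0 * A e i / A e i0) * c i) = 0"
      by auto
    define c' where "c' = c(i0 := - (\<Sum>i\<in>?I. A e i * c i) / A e i0)"
    have split: "(\<Sum>i\<in>Is. A f i * c' i) = A f i0 * c' i0 + (\<Sum>i\<in>?I. A f i * c i)" for f
      using insert.prems(1) i0(1) by (subst sum.remove[of _ i0]) (auto simp: c'_def intro!: sum.cong)
    have "(\<Sum>i\<in>Is. A e i * c' i) = 0"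
      unfolding split using i0(2) by (simp add: c'_def)
    moreover have "(\<Sum>i\<in>Is. A f i * c' i) = 0" if "f \<in> Es" for f
    proof -
      have "(\<Sum>i\<in>?I. (A f i - A f i0 * A e i / A e i0) * c i) =
          (\<Sum>i\<in>?I. A f i * c i) - A f i0 / A e i0 * (\<Sum>i\<in>?I. A e i * c i)"
        by (simp add: left_diff_distrib sum_subtractf sum_distrib_left mult.assoc)
      with c(2)[OF that] show ?thesis
        unfolding split by (simp add: c'_def)
    qed
    moreover have "\<exists>i\<in>Is. c' i \<noteq> 0"
      using c(1) by (auto simp: c'_def)
    ultimately show ?thesis by blast
  qed
qed

text \<open>
  By induction on the length, words of the same total that are shorter give \<open>0\<close>, so \<open>f\<close> does not
  depend on the order of the letters.
\<close>

lemma straighten: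
  fixes f :: "nat list \<Rightarrow> complex"
  assumes swap: "\<And>u x y v. x > 0 \<Longrightarrow> y > 0 \<Longrightarrow> f (u @ [x, y] @ v) = f (u @ [y, x] @ v) + g x y * f (u @ [x + y] @ v)"
    and sorted: "\<And>w. sorted w \<Longrightarrow> 0 \<notin> set w \<Longrightarrow> sum_list w = d \<Longrightarrow> f w = 0"
  shows "0 \<notin> set w \<Longrightarrow> sum_list w = d \<Longrightarrow> f w = 0"
proof (induction "length w" arbitrary: w rule: less_induct)
  case (less w)
  have swap0: "f (u @ [x, y] @ v) = f (u @ [y, x] @ v)"
    if "mset (u @ [x, y] @ v) = mset w" for u x y v
  proof -
    have eq: "set (u @ [x, y] @ v) = set w" "sum_list (u @ [x, y] @ v) = sum_list w"
      "length (u @ [x, y] @ v) = length w"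
      using that by (metis mset_eq_setD, metis sum_mset_sum_list, metis size_mset)
    then have "0 \<notin> set (u @ [x, y] @ v)"
      using less.prems(1) by (simp only: not_False_eq_True)
    then have pos: "x > 0" "y > 0" and "0 \<notin> set (u @ [x + y] @ v)"
      by auto
    have "f (u @ [x + y] @ v) = 0"
    proof (rule less.hyps)
      show "length (u @ [x + y] @ v) < length w"
        unfolding eq(3) [symmetric] by simp
      show "sum_list (u @ [x + y] @ v) = d"
        unfolding less.prems(2) [symmetric] eq(2) [symmetric] by simp
    qed fact
    with pos show ?thesis
      using swap[of x y u v] by simp
  qed
  have insort: "f (u @ x # v) = f (u @ insort x v)" if "mset (u @ x # v) = mset w" for u x v
    using that
  proof (induction v arbitrary: u)
    case (Cons y v)
    show ?case
    proof (cases "x \<le> y")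
      case False
      have "f (u @ x # y # v) = f ((u @ [y]) @ x # v)"
        using swap0[of u x y v] Cons.prems by simp
      also have "\<dots> = f ((u @ [y]) @ insort x v)"
        using Cons.prems by (intro Cons.IH) (simp add: add_mset_commute)
      finally show ?thesis
        using False by simp
    qed simp
  qed simp
  have "f (u @ v) = f (u @ sort v)" if "mset (u @ v) = mset w" for u v
    using that
  proof (induction v arbitrary: u)
    case (Cons x v)
    have "f (u @ x # v) = f ((u @ [x]) @ sort v)"
      using Cons.IH[of "u @ [x]"] Cons.prems by simp
    also have "\<dots> = f (u @ insort x (sort v))"
      using insort[of u x "sort v"] Cons.prems by simp
    finally show ?case by simp
  qed simp
  from this[of "[]" w] have "f w = f (sort w)" by simp
  also have "\<dots> = 0"
    using less.prems by (intro sorted) (simp_all, metis mset_sort sum_mset_sum_list)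
  finally show ?case .
qed

context resonant
begin

definition Lpos :: "nat list \<Rightarrow> uea" where
  "Lpos w = uword (map (\<lambda>n. genL (int n)) w)"

lemma Lpos_simps [simp]: "Lpos [] = 1" "Lpos (n # w) = U_L (int n) * Lpos w" "Lpos (u @ w) = Lpos u * Lpos w"
  by (simp_all add: Lpos_def)

text \<open>
  The coefficient of the highest weight vector.
\<close>

definition vac :: "uea \<Rightarrow> complex" where
  "vac u = Poly_Mapping.lookup (\<Phi> u) {#}"

lemma vac_add: "vac (u + v) = vac u + vac v"
  and vac_scale: "vac (c \<cdot> u) = c * vac u"
  by (simp_all add: vac_def \<Phi>_add \<Phi>_scale Poly_Mapping.lookup_add)

lemma vac_sum: "vac (sum f S) = (\<Sum>i\<in>S. vac (f i))"
  by (simp add: vac_def \<Phi>_sum Poly_Mapping.lookup_sum)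

lemma vac_J: "u \<in> J \<Longrightarrow> vac u = 0"
proof -
  assume "u \<in> J"
  then obtain f where f: "\<Phi> u = Q * f"
    by (auto simp: J_def elim: dvdE)
  have "Poly_Mapping.lookup (g * f) {#} = Poly_Mapping.lookup g {#} * Poly_Mapping.lookup f {#}" for g f :: "nvar pol"
  proof (induction g rule: pol_induct)
    case (Const c)
    then show ?case by (simp add: lookup_Const)
  next
    case (add g h)
    then show ?case by (simp add: distrib_right Poly_Mapping.lookup_add)
  next
    case (Var v g)
    then show ?case by (simp add: mult.assoc lookup_Var_mult)
  qed
  moreover have "Poly_Mapping.lookup Q {#} = 0"
    using homog_lookup[OF homog_Q, of "{#}"] p_pos by simp
  ultimately show "vac u = 0"
    by (simp add: vac_def f)
qed

lemma vac_swap: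
  assumes "x > 0" "y > 0"
  shows "vac (Lpos (u @ [x, y] @ w) * v) = vac (Lpos (u @ [y, x] @ w) * v) + of_int (int x - int y) * vac (Lpos (u @ [x + y] @ w) * v)"
proof -
  have "int x + int y \<noteq> 0"
    using assms by simp
  then have "U_L (int x) * U_L (int y) = U_L (int y) * U_L (int x) + of_int (int x - int y) \<cdot> U_L (int (x + y))"
    using uea_LL[of "int x" "int y"] by (simp del: of_int_diff)
  then have "Lpos (u @ [x, y] @ w) = Lpos (u @ [y, x] @ w) + of_int (int x - int y) \<cdot> Lpos (u @ [x + y] @ w)"
    by (simp add: mult.assoc [symmetric] distrib_left distrib_right del: of_int_diff)
  then show ?thesis
    by (simp add: distrib_right vac_add vac_scale del: of_int_diff Lpos_simps)
qed

lemma hw_M_L: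
  assumes "hw_M J v" "m > 0"
  shows "hw_M J (U_L m * v)"
proof -
  have pos: "U_M n * v \<in> J" if "n > 0" for n
    using assms(1) that by (simp add: hw_M_def)
  have "U_L m * (U_M 0 * v - hM \<cdot> v) + of_int (- m) \<cdot> (U_M m * v) \<in> J"
    using assms by (intro left_ideal_add[OF left_ideal_J] left_ideal_scale[OF left_ideal_J pos]
        left_ideal_mult[OF left_ideal_J]) (simp_all add: hw_M_def)
  moreover have eq: "U_M 0 * (U_L m * v) = U_L m * (U_M 0 * v) + of_int (- m) \<cdot> (U_M m * v)"
    using assms(2) uea_ML[of 0 m] by (simp add: mult.assoc [symmetric] left_diff_distrib)
  ultimately have "U_M 0 * (U_L m * v) - hM \<cdot> (U_L m * v) \<in> J"
    unfolding eq by (simp only: right_diff_distrib diff_add_eq uea_scale_mult_right)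
  then show ?thesis
    using M_pos_L[OF left_ideal_J pos assms(2)] by (simp add: hw_M_def)
qed

lemma hw_M_Lpos: "hw_M J v \<Longrightarrow> 0 \<notin> set w \<Longrightarrow> hw_M J (Lpos w * v)"
  by (induction w) (simp_all add: mult.assoc hw_M_L)

lemma homog_Lpos: "homog level d (\<Phi> v) \<Longrightarrow> homog level (d - int (sum_list w)) (\<Phi> (Lpos w * v))"
proof (induction w)
  case (Cons n w)
  from homog_mult_ad_level[OF ad_level_L Cons.IH[OF Cons.prems], of "int n"] show ?case
    by (simp add: mult.assoc algebra_simps)
qed simp

text \<open>
  The leading coefficient with respect to powers of \<open>Z\<close> is multiplied by \<open>\<gamma> k\<close>, \<open>\<gamma> (k - 1)\<close>, \<open>\<dots>\<close>;
  the first of these is \<open>0\<close>.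
\<close>

lemma L_p_power_J:
  assumes "\<gamma> k = 0" "k \<ge> 1" and v: "hw_M J v" "homog level (int (p * k)) (\<Phi> v)"
  shows "Lpos (replicate k p) * v \<in> J"
proof -
  have p: "int p > 0" using p_pos by simp
  have "\<exists>c. v - c \<cdot> Z ^ k \<in> W k"
  proof -
    have "int (p * k) < int (p * Suc k)"
      using p_pos by (simp only: of_nat_less_iff) simp
    moreover obtain c where c: "\<And>i. M_pol (c i)" "\<And>i. homog level (int (p * k) - int (p * i)) (c i)"
      "\<And>k'. int (p * k) < int (p * k') \<Longrightarrow> v - (\<Sum>i<k'. lift (c i) * Z ^ i) \<in> J"
      by (rule Z_expansion[OF v(2)]) (use v(1) in \<open>simp add: hw_M_def\<close>, rule that, assumption+)
    ultimately have "v - (\<Sum>i<Suc k. lift (c i) * Z ^ i) \<in> J"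
      by blast
    moreover obtain a where "c k = Const a"
      using homog_level_0[of "c k"] c(2)[of k] by auto
    ultimately have 1: "v - a \<cdot> Z ^ k - (\<Sum>i<k. lift (c i) * Z ^ i) \<in> J"
      by (simp add: algebra_simps)
    have 2: "(\<Sum>i<k. lift (c i) * Z ^ i) \<in> W k"
      by (intro W_sum W_term c(1)) simp
    have "v - a \<cdot> Z ^ k - (\<Sum>i<k. lift (c i) * Z ^ i) \<in> W k"
      using 1 J_subset_W by blast
    from W_add[OF this 2] show ?thesis
      by (intro exI[of _ a]) simp
  qed
  then obtain c where c: "v - c \<cdot> Z ^ k \<in> W k" ..
  have step: "\<exists>c'. Lpos (replicate j p) * v - c' \<cdot> Z ^ (k - j) \<in> W (k - j) \<and> (j \<ge> 1 \<longrightarrow> c' = 0)" if "j \<le> k" for j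
    using that
  proof (induction j)
    case 0
    then show ?case using c by auto
  next
    case (Suc j)
    let ?v = "Lpos (replicate j p) * v"
    obtain c' where c': "?v - c' \<cdot> Z ^ (k - j) \<in> W (k - j)" "j \<ge> 1 \<longrightarrow> c' = 0"
      using Suc by auto
    have kj: "k - j = Suc (k - Suc j)"
      using Suc.prems by simp
    have hw: "hw_M J ?v"
      using p_pos by (intro hw_M_Lpos v(1)) auto
    have "int (p * k) - int (sum_list (replicate j p)) = int (p * Suc (k - Suc j))"
      using Suc.prems by (simp add: sum_list_replicate kj[symmetric] of_nat_diff algebra_simps)
    with homog_Lpos[OF v(2), of "replicate j p"] have "homog level (int (p * Suc (k - Suc j))) (\<Phi> ?v)"
      by simp
    from L_p_step[OF this _ c'(1)[unfolded kj]] hw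
    have "U_L (int p) * ?v - (c' * \<gamma> (Suc (k - Suc j))) \<cdot> Z ^ (k - Suc j) \<in> W (k - Suc j)"
      by (simp add: hw_M_def)
    moreover have "c' * \<gamma> (Suc (k - Suc j)) = 0"
      unfolding kj [symmetric] using c'(2) assms(1) by (cases j) simp_all
    ultimately show ?case
      by (intro exI[of _ 0]) (simp add: mult.assoc)
  qed
  from step[of k] show ?thesis
    using assms(2) by auto
qed

text \<open>
  A partition indexes the vector that has a factor \<open>M\<^bsub>-m\<^esub>\<close> for each part \<open>m \<noteq> p\<close> and a factor \<open>Z\<close> for
  each part \<open>p\<close>. Leaving out \<open>M\<^bsub>-p\<^esub>\<close> picks representatives modulo \<open>Q\<close>, in which \<open>x\<^sub>p\<close> occurs linearly.
\<close>

definition partition_monomial :: "nat multiset \<Rightarrow> nvar multiset" where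
  "partition_monomial \<nu> = image_mset (\<lambda>m. VM (m - 1)) (filter_mset (\<lambda>m. m \<noteq> p) \<nu>)"

definition T :: "nat multiset \<Rightarrow> uea" where
  "T \<nu> = lift (Poly_Mapping.single (partition_monomial \<nu>) 1) * Z ^ count \<nu> p"

definition partitions_of :: "nat \<Rightarrow> nat multiset set" where
  "partitions_of d = {\<nu>. 0 \<notin># \<nu> \<and> sum_mset \<nu> = d}"

lemma size_le_sum_mset: "0 \<notin># \<nu> \<Longrightarrow> size \<nu> \<le> sum_mset (\<nu> :: nat multiset)"
  by (induction \<nu>) auto

lemma finite_partitions_of: "finite (partitions_of d)"
proof -
  have "partitions_of d \<subseteq> mset ` {xs. set xs \<subseteq> {..d} \<and> length xs \<le> d}"
  proof
    fix \<nu>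
    assume \<nu>: "\<nu> \<in> partitions_of d"
    obtain xs where xs: "\<nu> = mset xs"
      by (metis ex_mset)
    have "m \<le> d" if "m \<in> set xs" for m
      using \<nu> that member_le_sum_list[of m xs] by (simp add: partitions_of_def xs sum_mset_sum_list)
    moreover have "length xs \<le> d"
      using \<nu> size_le_sum_mset[of \<nu>] by (simp add: partitions_of_def xs)
    ultimately show "\<nu> \<in> mset ` {xs. set xs \<subseteq> {..d} \<and> length xs \<le> d}"
      using xs by auto
  qed
  then show ?thesis
    by (rule finite_subset) (intro finite_imageI finite_lists_length_le, simp)
qed

lemma M_pol_partition: "M_pol (Poly_Mapping.single (partition_monomial \<nu>) c)"
proof -
  have "wdeg ldeg (image_mset (\<lambda>m. VM (m - 1)) M) = 0" for M :: "nat multiset"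
    by (induction M) simp_all
  then show ?thesis
    by (simp add: homog_def partition_monomial_def)
qed

lemma level_partition:
  assumes "0 \<notin># \<nu>"
  shows "wdeg level (partition_monomial \<nu>) + p * count \<nu> p = sum_mset \<nu>"
  using assms by (induction \<nu>) (auto simp: partition_monomial_def)

lemma homog_T: "\<nu> \<in> partitions_of d \<Longrightarrow> homog level (int d) (\<Phi> (T \<nu>))"
  unfolding T_def
proof (rule homog_lift_Z_power)
  assume "\<nu> \<in> partitions_of d"
  then have "wdeg level (partition_monomial \<nu>) + p * count \<nu> p = d"
    using level_partition[of \<nu>] by (simp add: partitions_of_def)
  then have "int (wdeg level (partition_monomial \<nu>)) + int (p * count \<nu> p) = int d"
    by (simp only: of_nat_add [symmetric])
  then show "homog level (int d - int (p * count \<nu> p)) (Poly_Mapping.single (partition_monomial \<nu>) 1)"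
    by (simp add: homog_def)
qed

lemma hw_M_lift:
  assumes "M_pol a" "hw_M J v"
  shows "hw_M J (lift a * v)"
proof -
  have "U_M n * (lift a * v) = lift a * (U_M n * v)" for n
    by (simp add: mult.assoc [symmetric] lift_commute_M[OF assms(1)])
  moreover have "lift a * (U_M n * v) \<in> J" if "n > 0" for n
    by (rule left_ideal_mult[OF left_ideal_J]) (use assms(2) that in \<open>simp add: hw_M_def\<close>)
  moreover have "lift a * (U_M 0 * v - hM \<cdot> v) \<in> J"
    by (rule left_ideal_mult[OF left_ideal_J]) (use assms(2) in \<open>simp add: hw_M_def\<close>)
  ultimately show ?thesis
    by (simp add: hw_M_def right_diff_distrib)
qed

lemma hw_M_T: "hw_M J (T \<nu>)"
  unfolding T_def using Z_power_killed by (intro hw_M_lift M_pol_partition) blast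

lemma hw_M_combination: "hw_M J (\<Sum>\<nu>\<in>S. c \<nu> \<cdot> T \<nu>)"
proof -
  have "(\<Sum>\<nu>\<in>S. c \<nu> \<cdot> (U_M n * T \<nu>)) \<in> J" if "n > 0" for n
    using hw_M_T that by (intro left_ideal_sum left_ideal_scale left_ideal_J) (simp add: hw_M_def)
  moreover have "(\<Sum>\<nu>\<in>S. c \<nu> \<cdot> (U_M 0 * T \<nu> - hM \<cdot> T \<nu>)) \<in> J"
    using hw_M_T by (intro left_ideal_sum left_ideal_scale left_ideal_J) (simp add: hw_M_def)
  ultimately show ?thesis
    by (simp add: hw_M_def sum_distrib_left uea_scale_sum uea_scale_diff_right sum_subtractf mult.commute)
qed

lemma partition_monomial_inj:
  assumes "0 \<notin># \<nu>" "0 \<notin># \<nu>'" "count \<nu> p = count \<nu>' p" "partition_monomial \<nu> = partition_monomial \<nu>'"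
  shows "\<nu> = \<nu>'"
proof -
  have "image_mset level (partition_monomial \<nu>) = filter_mset (\<lambda>m. m \<noteq> p) \<nu>" if "0 \<notin># \<nu>" for \<nu>
    using that by (induction \<nu>) (auto simp: partition_monomial_def)
  with assms have "filter_mset (\<lambda>m. m \<noteq> p) \<nu> = filter_mset (\<lambda>m. m \<noteq> p) \<nu>'"
    by metis
  then have "count \<nu> m = count \<nu>' m" for m
    using assms(3) by (cases "m = p") (auto simp: multiset_eq_iff split: if_splits)
  then show ?thesis
    by (simp add: multiset_eq_iff)
qed

text \<open>
  Otherwise the nonzero coefficient of the highest power of \<open>Z\<close> would be divisible by \<open>Q\<close>, which is
  impossible since it is free of \<open>x\<^sub>p\<close>.
\<close>

lemma T_independent:
  assumes "(\<Sum>\<nu>\<in>partitions_of d. c \<nu> \<cdot> T \<nu>) \<in> J" and "\<nu> \<in> partitions_of d"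
  shows "c \<nu> = 0"
proof (rule ccontr)
  assume "c \<nu> \<noteq> 0"
  let ?I = "{\<nu> \<in> partitions_of d. c \<nu> \<noteq> 0}"
  define k where "k = Max ((\<lambda>\<nu>. count \<nu> p) ` ?I)"
  have I: "finite ?I" "?I \<noteq> {}"
    using finite_partitions_of assms(2) \<open>c \<nu> \<noteq> 0\<close> by auto
  have le: "count \<mu> p \<le> k" if "\<mu> \<in> ?I" for \<mu>
    unfolding k_def using I that by (intro Max_ge) auto
  have "k \<in> (\<lambda>\<nu>. count \<nu> p) ` ?I"
    unfolding k_def using I by (intro Max_in) auto
  then obtain \<nu>0 where \<nu>0: "\<nu>0 \<in> ?I" "count \<nu>0 p = k"
    by auto
  let ?T = "{\<nu> \<in> ?I. count \<nu> p = k}"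
  define a where "a = (\<Sum>\<nu>\<in>?T. Poly_Mapping.single (partition_monomial \<nu>) (c \<nu>))"
  have a: "M_pol a"
    unfolding a_def by (intro homog_sum M_pol_partition)
  have top: "(\<Sum>\<nu>\<in>?T. c \<nu> \<cdot> T \<nu>) = lift a * Z ^ k"
    unfolding a_def lift_sum sum_distrib_right by (intro sum.cong) (auto simp: T_def)
  have low: "(\<Sum>\<nu>\<in>?I - ?T. c \<nu> \<cdot> T \<nu>) \<in> W k"
  proof (intro W_sum W_scale)
    fix \<mu>
    assume "\<mu> \<in> ?I - ?T"
    then show "T \<mu> \<in> W k"
      unfolding T_def using le[of \<mu>] by (intro W_term M_pol_partition) auto
  qed
  have "(\<Sum>\<nu>\<in>partitions_of d. c \<nu> \<cdot> T \<nu>) = (\<Sum>\<nu>\<in>?I. c \<nu> \<cdot> T \<nu>)"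
    using finite_partitions_of by (intro sum.mono_neutral_right) auto
  also have "\<dots> = (\<Sum>\<nu>\<in>?I - ?T. c \<nu> \<cdot> T \<nu>) + (\<Sum>\<nu>\<in>?T. c \<nu> \<cdot> T \<nu>)"
    using I by (intro sum.subset_diff) auto
  finally have "(\<Sum>\<nu>\<in>?I - ?T. c \<nu> \<cdot> T \<nu>) + lift a * Z ^ k \<in> J"
    using assms(1) top by simp
  then have "(\<Sum>\<nu>\<in>?I - ?T. c \<nu> \<cdot> T \<nu>) + lift a * Z ^ k \<in> W k"
    using J_subset_W by blast
  from W_diff[OF this low] have "lift a * Z ^ k \<in> W k"
    by simp
  then have "Q dvd a"
    using W_term_iff[OF a] by blast
  moreover have "pd (VM (p - 1)) a = 0"
  proof -
    have "VM (p - 1) \<notin># partition_monomial \<mu>" if "0 \<notin># \<mu>" for \<mu>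
    proof
      assume "VM (p - 1) \<in># partition_monomial \<mu>"
      then obtain m where m: "m \<in># \<mu>" "m \<noteq> p" "m - 1 = p - 1"
        by (auto simp: partition_monomial_def)
      then have "m \<noteq> 0"
        using that by metis
      with m p_pos show False by linarith
    qed
    then have "pd (VM (p - 1)) (Poly_Mapping.single (partition_monomial \<mu>) (c \<mu>)) = 0" if "\<mu> \<in> ?T" for \<mu>
      using that by (intro pd_eq_0) (auto simp: vars_def partitions_of_def)
    then show ?thesis
      by (simp add: a_def pd_sum)
  qed
  ultimately have "a = 0"
    by (rule Q_dvd_pd_0[OF p_pos])
  moreover have "Poly_Mapping.lookup a (partition_monomial \<nu>0) = c \<nu>0"
  proof -
    have "Poly_Mapping.lookup a (partition_monomial \<nu>0) = (\<Sum>\<mu>\<in>?T. if \<mu> = \<nu>0 then c \<nu>0 else 0)"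
      unfolding a_def Poly_Mapping.lookup_sum
    proof (rule sum.cong)
      fix \<mu>
      assume "\<mu> \<in> ?T"
      then have "partition_monomial \<mu> = partition_monomial \<nu>0 \<longleftrightarrow> \<mu> = \<nu>0"
        using partition_monomial_inj[of \<mu> \<nu>0] \<nu>0 by (auto simp: partitions_of_def)
      then show "Poly_Mapping.lookup (Poly_Mapping.single (partition_monomial \<mu>) (c \<mu>)) (partition_monomial \<nu>0) =
          (if \<mu> = \<nu>0 then c \<nu>0 else 0)"
        by (auto simp: Poly_Mapping.lookup_single when_def)
    qed simp
    moreover have "finite ?T"
      by (rule finite_subset[OF _ I(1)]) auto
    ultimately show ?thesis
      using \<nu>0 by simp
  qed
  ultimately show False
    using \<nu>0 by simp
qed

text \<open>
  The unknowns are the coefficients \<open>c\<close> of a combination of the \<open>T \<nu>\<close>, one for each partition of \<open>p k\<close>;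
  the equations say that \<open>L\<^bsub>n\<^sub>1\<^esub> L\<^bsub>n\<^sub>2\<^esub> \<dots>\<close> kills it for every partition \<open>(n\<^sub>1, n\<^sub>2, \<dots>)\<close> other than
  \<open>(p, \<dots>, p)\<close>, for which it holds anyway.
\<close>

theorem \<gamma>_0_imp_subsingular:
  assumes "\<gamma> k = 0" "k \<ge> 1"
  shows "\<exists>u. subsingular hL hM cL cM u"
proof -
  define d where "d = p * k"
  let ?I = "partitions_of d" and ?pk = "replicate_mset k p"
  let ?word = "\<lambda>\<nu>. sorted_list_of_multiset \<nu> :: nat list"
  have pk: "?pk \<in> ?I"
    using p_pos by (auto simp: partitions_of_def d_def)
  then have "card (?I - {?pk}) < card ?I"
    by (intro psubset_card_mono finite_partitions_of) auto
  from homogeneous_system[OF _ finite_partitions_of this, of "\<lambda>\<mu> \<nu>. vac (Lpos (?word \<mu>) * T \<nu>)"]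
  obtain c where c: "\<exists>\<nu>\<in>?I. c \<nu> \<noteq> 0"
    "\<And>\<mu>. \<mu> \<in> ?I - {?pk} \<Longrightarrow> (\<Sum>\<nu>\<in>?I. vac (Lpos (?word \<mu>) * T \<nu>) * c \<nu>) = 0"
    using finite_partitions_of by auto
  define v where "v = (\<Sum>\<nu>\<in>?I. c \<nu> \<cdot> T \<nu>)"
  have v_notin: "v \<notin> J"
    using T_independent[of c d] c(1) by (auto simp: v_def)
  have v_hw: "hw_M J v"
    unfolding v_def by (rule hw_M_combination)
  have v_hom: "homog level (int d) (\<Phi> v)"
    unfolding v_def \<Phi>_sum \<Phi>_scale by (intro homog_sum homog_Const_mult homog_T)
  have sorted_0: "vac (Lpos w * v) = 0" if "sorted w" "0 \<notin> set w" "sum_list w = d" for w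
  proof (cases "mset w = ?pk")
    case True
    then have "w = replicate k p"
      using that(1) by (metis mset_replicate sorted_sort_id sort_replicate sorted_list_of_multiset_mset)
    then show ?thesis
      using L_p_power_J[OF assms v_hw v_hom[unfolded d_def]] vac_J by simp
  next
    case False
    then have "mset w \<in> ?I - {?pk}"
      using that by (auto simp: partitions_of_def sum_mset_sum_list)
    from c(2)[OF this] that(1) show ?thesis
      by (simp add: v_def sum_distrib_left vac_sum vac_scale sorted_sort_id mult.commute)
  qed
  have vac_0: "vac (Lpos w * v) = 0" if "0 \<notin> set w" "sum_list w = d" for w
    by (rule straighten[where f = "\<lambda>w. vac (Lpos w * v)" and g = "\<lambda>x y. of_int (int x - int y)"])
       (use that sorted_0 vac_swap in blast)+
  let ?P = "\<lambda>w. 0 \<notin> set w \<and> Lpos w * v \<notin> J"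
  \<comment> \<open>Words of total \<open>d\<close> kill \<open>v\<close> because level \<open>0\<close> is spanned by the highest weight vector.\<close>
  have bound: "sum_list w < d" if "?P w" for w
  proof (rule ccontr)
    assume "\<not> sum_list w < d"
    then consider "sum_list w > d" | "sum_list w = d" by linarith
    then have "\<Phi> (Lpos w * v) = 0"
    proof cases
      case 1
      then show ?thesis
        using homog_neg[OF homog_Lpos[OF v_hom, of w]] by simp
    next
      case 2
      then obtain a where a: "\<Phi> (Lpos w * v) = Const a"
        using homog_level_0 homog_Lpos[OF v_hom, of w] by auto
      with vac_0[OF _ 2] that show ?thesis
        by (simp add: vac_def lookup_Const)
    qed
    then show False
      using that by (simp add: J_def)
  qed
  have "?P []"
    using v_notin by simp
  \<comment> \<open>A word of largest total that does not kill \<open>v\<close>; by \<open>bound\<close> it stays above level \<open>0\<close>.\<close>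
  then obtain w where w: "?P w" and w_max: "\<And>w'. ?P w' \<Longrightarrow> sum_list w' \<le> sum_list w"
    using bound ex_has_greatest_nat[of ?P "[]" sum_list d] by (metis less_imp_le)
  define u where "u = Lpos w * v"
  define e where "e = d - sum_list w"
  have e: "e > 0" "homog level (int e) (\<Phi> u)"
    using bound[OF w] homog_Lpos[OF v_hom, of w] by (simp_all add: e_def u_def of_nat_diff)
  have u_notin: "u \<notin> J"
    using w by (simp add: u_def)
  have u_hw: "hw_M J u"
    unfolding u_def using w by (intro hw_M_Lpos v_hw) simp
  have u_L: "U_L n * u \<in> J" if "n > 0" for n
  proof (rule ccontr)
    assume "U_L n * u \<notin> J"
    then have "?P (nat n # w)"
      using that w by (simp add: u_def mult.assoc)
    from w_max[OF this] that show False
      by simp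
  qed
  have L0: "U_L 0 * u - (hL + of_nat e) \<cdot> u \<in> K"
    using L0_homog[OF e(2)] by simp
  have central: "U_CL * u - cL \<cdot> u \<in> J" "U_CM * u - cM \<cdot> u \<in> J"
  proof -
    have "u * (U_CL - cL \<cdot> 1) \<in> K" "u * (U_CM - cM \<cdot> 1) \<in> K"
      by (intro left_ideal_mult left_ideal_K K_generators)+
    then show "U_CL * u - cL \<cdot> u \<in> J" "U_CM * u - cM \<cdot> u \<in> J"
      using K_subset_J by (auto simp: right_diff_distrib uea_CL_central uea_CM_central)
  qed
  have "\<not> multiple_of_one_mod J u"
  proof
    assume "multiple_of_one_mod J u"
    then obtain a where a: "u - a \<cdot> 1 \<in> J"
      by (auto simp: multiple_of_one_mod_def)
    have "U_L 0 * (u - a \<cdot> 1) - (hL + of_nat e) \<cdot> (u - a \<cdot> 1) - (U_L 0 * u - (hL + of_nat e) \<cdot> u) +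
        a \<cdot> (U_L 0 - hL \<cdot> 1) \<in> J"
      by (rule left_ideal_add[OF left_ideal_J left_ideal_diff[OF left_ideal_J left_ideal_diff[OF left_ideal_J
            left_ideal_mult[OF left_ideal_J a] left_ideal_scale[OF left_ideal_J a]]
            subsetD[OF K_subset_J L0]] left_ideal_scale[OF left_ideal_J subsetD[OF K_subset_J K_generators(3)]]])
    also have "U_L 0 * (u - a \<cdot> 1) - (hL + of_nat e) \<cdot> (u - a \<cdot> 1) - (U_L 0 * u - (hL + of_nat e) \<cdot> u) +
        a \<cdot> (U_L 0 - hL \<cdot> 1) = (a * of_nat e) \<cdot> 1"
      by (simp add: right_diff_distrib uea_scale_diff_right uea_scale_add_left distrib_right algebra_simps)
    finally have "a * of_nat e = 0"
      using left_ideal_scale_iff[OF left_ideal_J, of "a * of_nat e" 1] one_notin_J by blast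
    then have "a = 0"
      using e(1) by simp
    with a u_notin show False by simp
  qed
  moreover have "singular_mod J u"
    using u_notin u_hw u_L L0 K_subset_J central
    by (auto simp: singular_mod_def eigenvector_mod_def hw_M_def)
  moreover have "eigenvector_mod K (U_L 0) u"
    using u_notin L0 K_subset_J by (auto simp: eigenvector_mod_def)
  ultimately have "subsingular hL hM cL cM u"
    by (simp add: subsingular_def singular_ideal_eq_J)
  then show ?thesis ..
qed

end

section \<open>The criterion\<close>

theorem corollary4p20:
  fixes cL cM hL hM :: complex
  assumes "cM \<noteq> 0"
  shows "(\<exists>u. subsingular hL hM cL cM u) \<longleftrightarrow>
    (\<exists>p::nat. p \<ge> 1 \<and> 2 * hM + (of_nat p ^ 2 - 1) / 12 * cM = 0 \<and>
       (\<exists>r::nat. r \<ge> 1 \<and> hL = h' cL p r))"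
proof -
  interpret V: verma hL hM cL cM .
  have res: "resonant hM cM p" if p: "p \<ge> 1" "V.\<phi> p = 0" for p
  proof (unfold_locales)
    fix n :: nat
    assume n: "n \<ge> 1" "n \<noteq> p"
    show "V.\<phi> n \<noteq> 0"
    proof
      assume "V.\<phi> n = 0"
      have "(of_nat n ^ 2 - of_nat p ^ 2) * cM = 12 * (V.\<phi> n - V.\<phi> p)"
        by (simp add: V.\<phi>_def field_simps)
      then have "(of_nat n ^ 2 - of_nat p ^ 2) * cM = 0"
        using p(2) \<open>V.\<phi> n = 0\<close> by simp
      then have "(of_nat (n ^ 2) :: complex) = of_nat (p ^ 2)"
        using assms by simp
      then have "n ^ 2 = p ^ 2"
        by (simp only: of_nat_eq_iff)
      with n show False
        by (simp add: power2_eq_iff_nonneg)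
    qed
  qed (use p in auto)
  show ?thesis
  proof
    assume "\<exists>u. subsingular hL hM cL cM u"
    then obtain u where u: "subsingular hL hM cL cM u" ..
    have "\<exists>p\<ge>1. V.\<phi> p = 0"
    proof (rule ccontr)
      assume none: "\<not> (\<exists>p\<ge>1. V.\<phi> p = 0)"
      \<comment> \<open>Here \<open>J = 0\<close>, so every singular vector is already counted in \<open>J'\<close>.\<close>
      interpret N: verma_level hL hM cL cM 0
        by unfold_locales (use none in auto)
      have "N.J = V.K"
        by (auto simp: N.J_def N.Q_def V.mem_K_iff)
      then have "singular_mod V.K u" "\<not> multiple_of_one_mod V.K u" "singular_ideal hL hM cL cM = V.K"
        using u N.singular_ideal_eq_J by (simp_all add: subsingular_def)
      then have "u \<in> singular_ideal hL hM cL cM"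
        unfolding singular_ideal_def Let_def by (intro hull_inc) simp
      with \<open>singular_ideal hL hM cL cM = V.K\<close> \<open>singular_mod V.K u\<close> show False
        by (simp add: singular_mod_def eigenvector_mod_def)
    qed
    then obtain p where p: "p \<ge> 1" "V.\<phi> p = 0" by blast
    interpret R: resonant hL hM cL cM p
      using res[OF p] .
    obtain k where k: "k \<ge> 1" "R.\<gamma> k = 0"
      using R.subsingular_imp_\<gamma>_0[OF u] by blast
    then have "hL = h' cL p k"
      using R.\<gamma>_eq_0_iff by blast
    with p k(1) show "\<exists>p::nat. p \<ge> 1 \<and> 2 * hM + (of_nat p ^ 2 - 1) / 12 * cM = 0 \<and>
       (\<exists>r::nat. r \<ge> 1 \<and> hL = h' cL p r)"
      by (auto simp: V.\<phi>_def)
  next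
    assume "\<exists>p::nat. p \<ge> 1 \<and> 2 * hM + (of_nat p ^ 2 - 1) / 12 * cM = 0 \<and>
       (\<exists>r::nat. r \<ge> 1 \<and> hL = h' cL p r)"
    then obtain p r where pr: "p \<ge> 1" "V.\<phi> p = 0" "r \<ge> 1" "hL = h' cL p r"
      by (auto simp: V.\<phi>_def)
    interpret R: resonant hL hM cL cM p
      using res[OF pr(1,2)] .
    show "\<exists>u. subsingular hL hM cL cM u"
      using R.\<gamma>_0_imp_subsingular[OF _ pr(3)] R.\<gamma>_eq_0_iff[OF pr(3)] pr(4) by blast
  qed
qed
end
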